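(* Let $m,n\in\mathbb R$, $\mathcal B>0$, $q=m-n+1$. Let $h_{\rm ss}\in C^4(\mathbb R)$ be a non-constant positive periodic steady state of $h_t=-(h^nh_{xxx})_x-\mathcal B(h^mh_x)_x$ with least period $X$. Translate $h_{\rm ss}$ to put its minimum at $x=0$, so that $h_{\rm ss}$ rescales to $k_\alpha$ for some $\alpha\in(0,1)$ (rescaling as in the context). If $1<q<2$ and $E'(\alpha)<0$, then $h_{\rm ss}$ is energy stable (with respect to zero-mean perturbations at period $X$).
   Context: A positive periodic steady state is a positive periodic $C^4$ function with $(h^nh'''+\mathcal B h^mh')'=0$ classically. Rescaling (for $q\neq 0$): a non-constant positive periodic steady state $h_{\rm ss}$ satisfies $h_{\rm ss}''+\frac{\mathcal B h_{\rm ss}^q-D}{q}=0$ for some constant $D>0$. With the minimum of $h_{\rm ss}$ at $x=0$, put $k(x)=(\mathcal B/D)^{1/q}\,h_{\rm ss}\big((D/\mathcal B)^{1/(2q)}D^{-1/2}x\big)$. Then $k=k_\alpha$ with $\alpha=\min k\in(0,1)$; this is what "$h_{\rm ss}$ rescales to $k_\alpha$" means. For $\alpha\in(0,1)$, $k_\alpha$ is the unique smooth positive periodic solution of $k''+\frac{k^q-1}{q}=0$ with $k(0)=\alpha$, $k'(0)=0$. $P(\alpha)$ is its least period, $A(\alpha)=\int_0^{P(\alpha)}k_\alpha\,dx$, and $E(\alpha)=P(\alpha)^{3-q}A(\alpha)^{q-1}$; these are smooth functions of $\alpha\in(0,1)$. Energy at period $X$: for positive $\ell\in H^1(\mathbb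 T_X)$ ($\mathbb T_X$ the circle of circumference $X$), $\mathcal E(\ell)=\int_0^X[\frac12(\ell')^2-H(\ell)]dx$, where $H$ is a fixed function on $(0,\infty)$ with $H''(y)=\mathcal B y^{q-1}$. $h_{\rm ss}$ is energy stable (with respect to zero-mean perturbations at period $X$) if for each $u\in H^1(\mathbb T_X)\setminus\{0\}$ with $\int_0^Xu\,dx=0$ one has $\mathcal E(h_{\rm ss}+\varepsilon u)>\mathcal E(h_{\rm ss})$ for all sufficiently small $\varepsilon>0$ (how small may depend on $u$). *)

theory Defs
  imports "HOL-Analysis.Analysis" "HOL-Library.Periodic_Fun"
begin

definition Ck_fun :: "nat \<Rightarrow> (real \<Rightarrow> real) \<Rightarrow> bool" where
  "Ck_fun k f \<longleftrightarrow>
     (\<forall>i<k. \<forall>x. (deriv ^^ i) f field_differentiable at x) \<and>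
     continuous_on UNIV ((deriv ^^ k) f)"

definition smooth_fun :: "(real \<Rightarrow> real) \<Rightarrow> bool" where
  "smooth_fun f \<longleftrightarrow> (\<forall>k. Ck_fun k f)"

definition is_least_period :: "(real \<Rightarrow> real) \<Rightarrow> real \<Rightarrow> bool" where
  "is_least_period f T \<longleftrightarrow>
     T > 0 \<and> periodic_fun_simple f T \<and> (\<forall>S>0. periodic_fun_simple f S \<longrightarrow> T \<le> S)"

definition positive_periodic :: "(real \<Rightarrow> real) \<Rightarrow> bool" where
  "positive_periodic f \<longleftrightarrow> (\<forall>x. f x > 0) \<and> (\<exists>T>0. periodic_fun_simple f T)"

text \<open>
  The equation is read classically: the flux is differentiable everywhere, with derivative 0.
\<close>

definition positive_periodic_steady_state ::
    "real \<Rightarrow> real \<Rightarrow> real \<Rightarrow> (real \<Rightarrow> real) \<Rightarrow> bool" where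
  "positive_periodic_steady_state n m B h \<longleftrightarrow>
     Ck_fun 4 h \<and> positive_periodic h \<and>
     (\<forall>x. ((\<lambda>y. h y powr n * (deriv ^^ 3) h y + B * h y powr m * deriv h y)
              has_real_derivative 0) (at x))"


definition is_canonical_solution :: "real \<Rightarrow> real \<Rightarrow> (real \<Rightarrow> real) \<Rightarrow> bool" where
  "is_canonical_solution q \<alpha> k \<longleftrightarrow>
     smooth_fun k \<and> positive_periodic k \<and>
     (\<forall>x. (deriv ^^ 2) k x + (k x powr q - 1) / q = 0) \<and>
     k 0 = \<alpha> \<and> deriv k 0 = 0"

text \<open>
  The descriptions below are meaningful for \<open>q \<noteq> 0\<close> and \<open>0 < \<alpha> < 1\<close>, where the canonical
  solution exists, is unique and is non-constant.
\<close>

definition k_sol :: "real \<Rightarrow> real \<Rightarrow> real \<Rightarrow> real" where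
  "k_sol q \<alpha> = (THE k. is_canonical_solution q \<alpha> k)"

definition P_fun :: "real \<Rightarrow> real \<Rightarrow> real" where
  "P_fun q \<alpha> = (THE T. is_least_period (k_sol q \<alpha>) T)"

definition A_fun :: "real \<Rightarrow> real \<Rightarrow> real" where
  "A_fun q \<alpha> = (LINT x:{0..P_fun q \<alpha>}|lebesgue. k_sol q \<alpha> x)"

definition E_fun :: "real \<Rightarrow> real \<Rightarrow> real" where
  "E_fun q \<alpha> = P_fun q \<alpha> powr (3 - q) * A_fun q \<alpha> powr (q - 1)"

text \<open>
  Here \<open>h\<close> is assumed to attain its minimum at 0.
\<close>

definition rescales_to :: "real \<Rightarrow> real \<Rightarrow> (real \<Rightarrow> real) \<Rightarrow> real \<Rightarrow> bool" where
  "rescales_to B q h \<alpha> \<longleftrightarrow>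
     (\<exists>D>0. (\<forall>x. (deriv ^^ 2) h x + (B * h x powr q - D) / q = 0) \<and>
        (\<lambda>x. (B / D) powr (1 / q) *
              h ((D / B) powr (1 / (2 * q)) * D powr (- 1 / 2) * x)) = k_sol q \<alpha>)"


text \<open>
  Functions on the circle of circumference \<open>X\<close> are represented by \<open>X\<close>-periodic functions
  on the line; elements of \<open>L\<^sup>2\<close> and \<open>H\<^sup>1\<close> are represented by arbitrary members of their
  almost-everywhere classes.
\<close>

definition L2_circle :: "real \<Rightarrow> (real \<Rightarrow> real) set" where
  "L2_circle X = {u. periodic_fun_simple u X \<and> u \<in> borel_measurable lebesgue \<and>
                     set_integrable lebesgue {0..X} (\<lambda>x. (u x)\<^sup>2)}"

definition has_weak_deriv_circle ::
    "real \<Rightarrow> (real \<Rightarrow> real) \<Rightarrow> (real \<Rightarrow> real) \<Rightarrow> bool" where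
  "has_weak_deriv_circle X u v \<longleftrightarrow>
     (\<forall>\<phi>. smooth_fun \<phi> \<and> periodic_fun_simple \<phi> X \<longrightarrow>
        (LINT x:{0..X}|lebesgue. u x * deriv \<phi> x) =
        - (LINT x:{0..X}|lebesgue. v x * \<phi> x))"

definition H1_circle :: "real \<Rightarrow> (real \<Rightarrow> real) set" where
  "H1_circle X =
     {u \<in> L2_circle X. \<exists>v \<in> L2_circle X. has_weak_deriv_circle X u v}"

text \<open>
  A representative of the weak derivative, which is unique up to null sets.
\<close>

definition weak_deriv_circle :: "real \<Rightarrow> (real \<Rightarrow> real) \<Rightarrow> real \<Rightarrow> real" where
  "weak_deriv_circle X u =
     (SOME v. v \<in> L2_circle X \<and> has_weak_deriv_circle X u v)"

definition energy :: "(real \<Rightarrow> real) \<Rightarrow> real \<Rightarrow> (real \<Rightarrow> real) \<Rightarrow> real" where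
  "energy H X l =
     (LINT x:{0..X}|lebesgue. 1 / 2 * (weak_deriv_circle X l x)\<^sup>2 - H (l x))"

definition is_energy_potential :: "real \<Rightarrow> real \<Rightarrow> (real \<Rightarrow> real) \<Rightarrow> bool" where
  "is_energy_potential B q H \<longleftrightarrow>
     (\<forall>y>0. H field_differentiable at y \<and>
            (deriv H has_real_derivative B * y powr (q - 1)) (at y))"

text \<open>
  Since elements of \<open>H\<^sup>1\<close> of the circle are essentially bounded, for positive continuous \<open>h\<close>
  the perturbed profile is positive almost everywhere for all small \<open>\<epsilon>\<close>, so that the values
  of \<open>H\<close> outside the positive half-line play no role. A nonzero element of \<open>H\<^sup>1\<close> is one that
  is not almost everywhere zero.
\<close>

definition energy_stable :: "(real \<Rightarrow> real) \<Rightarrow> real \<Rightarrow> (real \<Rightarrow> real) \<Rightarrow> bool" where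
  "energy_stable H X h \<longleftrightarrow>
     (\<forall>u \<in> H1_circle X.
        \<not> (AE x in lebesgue. u x = 0) \<longrightarrow> (LINT x:{0..X}|lebesgue. u x) = 0 \<longrightarrow>
        (\<forall>\<^sub>F \<epsilon> in at_right 0. energy H X (\<lambda>x. h x + \<epsilon> * u x) > energy H X h))"

end

theory Submission
  imports Defs "HOL-Real_Asymp.Real_Asymp"
begin

text \<open>
  After rescaling, the second variation of the energy at \<open>k\<close> is \<open>Q(u) = \<integral> u'\<^sup>2 - k\<^sup>q\<^sup>-\<^sup>1 u\<^sup>2\<close>. Split \<open>u\<close>
  into its odd and even parts about the minimum of \<open>k\<close>. On odd functions, which satisfy Dirichlet conditions
  on half a period, \<open>Q\<close> is nonnegative with kernel spanned by \<open>k'\<close> (Picone's identity). On even functions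
  \<open>Q\<close> has exactly one negative direction, so it is positive on even functions of mean zero as soon as
  \<open>Q(\<eta>) < 0\<close> for the function \<open>\<eta>\<close> that represents the mean: \<open>- \<eta>'' - k\<^sup>q\<^sup>-\<^sup>1 \<eta> = c\<close>. This \<open>\<eta>\<close> is
  the derivative of the steady state along the family of steady states with the given period, so the sign of
  \<open>Q(\<eta>) = c \<integral> \<eta>\<close> is determined by \<open>E'(\<alpha>)\<close> (for the mean) and by the monotonicity of the period (for \<open>c\<close>).
  In the only degenerate direction \<open>h'\<close> the cubic term of the energy is odd and the quartic term is
  positive because the fourth derivative of \<open>H\<close> is negative when \<open>1 < q < 2\<close>.
\<close>

section \<open>Smooth functions and periodic test functions\<close>

text \<open>Written as integrals over the values of \<open>k\<close>, period and area have singular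
  integrands at the turning points, which obstructs differentiating them in the amplitude. The chart
  \<open>K\<close>, built so that \<open>well q (K s) = s^2 / 2\<close>, turns every orbit into
  \<open>s = a * cos t\<close> over the fixed range {0..pi}, and differentiation under the integral
  becomes legitimate. The count of negative even directions is obtained by duality: a function with
  vanishing V-weighted mean is replaced by the primitive of its product with \<open>V\<close>, which
  vanishes at both ends. The Neumann bound becomes a Dirichlet bound with weight 1 / V, and this is
  certified by one explicit function, k' times the power (q - 1) / 3 of k. The same function yields
  the monotonicity of the period. The functional E arises from scaling. With \<sigma> = 2 / (q - 1),
  the maps k(x) to \<lambda>^\<sigma> k(\<lambda> x) preserve the equation up to its constant term,
  and P^(3-q) A^(q-1) is the combination of period and area that they leave invariant. Hence E'
  measures the change of area after the period has been scaled back to its old value, and it is a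
  positive multiple of the integral of \<eta>.\<close>

lemma periodic_fun_simpleI': "(\<And>x. f (x + T) = f x) \<Longrightarrow> periodic_fun_simple f (T::real)"
  by unfold_locales simp

lemma periodic_fun_simpleD: "periodic_fun_simple f (T::real) \<Longrightarrow> f (x + T) = f x"
  by (rule periodic_fun_simple.plus_period)

text \<open>A certificate of smoothness: if the derivatives of the generators in \<open>K\<close>
  lie in the closure, so do the derivatives of all its members, and iterated derivatives exist
  without any formula for them.\<close>

inductive_set smooth_gen :: "(real \<Rightarrow> real) set \<Rightarrow> (real \<Rightarrow> real) set" for K where
  base: "f \<in> K \<Longrightarrow> f \<in> smooth_gen K"
| const: "(\<lambda>x. c) \<in> smooth_gen K"
| add: "f \<in> smooth_gen K \<Longrightarrow> g \<in> smooth_gen K \<Longrightarrow> (\<lambda>x. f x + g x) \<in> smooth_gen K"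
| mult: "f \<in> smooth_gen K \<Longrightarrow> g \<in> smooth_gen K \<Longrightarrow> (\<lambda>x. f x * g x) \<in> smooth_gen K"
| powr: "f \<in> smooth_gen K \<Longrightarrow> (\<And>x. f x > 0) \<Longrightarrow> (\<lambda>x. f x powr c) \<in> smooth_gen K"
| exp: "f \<in> smooth_gen K \<Longrightarrow> (\<lambda>x. exp (f x)) \<in> smooth_gen K"

lemma smooth_gen_deriv:
  assumes K: "\<And>f. f \<in> K \<Longrightarrow> \<exists>f'\<in>smooth_gen K. \<forall>x. DERIV f x :> f' x"
    and "f \<in> smooth_gen K"
  shows "\<exists>f'\<in>smooth_gen K. \<forall>x. DERIV f x :> f' x"
  using assms(2)
proof induction
  case (base f) then show ?case by (rule K)
next
  case (const c) show ?case
    by (rule bexI[OF _ smooth_gen.const[of 0]]) auto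
next
  case (add f g)
  then obtain f' g' where "f' \<in> smooth_gen K" "g' \<in> smooth_gen K"
    "\<forall>x. DERIV f x :> f' x" "\<forall>x. DERIV g x :> g' x" by blast
  then show ?case
    by (intro bexI[of _ "\<lambda>x. f' x + g' x"] smooth_gen.add) (auto intro!: derivative_eq_intros)
next
  case (mult f g)
  then obtain f' g' where "f' \<in> smooth_gen K" "g' \<in> smooth_gen K"
    "\<forall>x. DERIV f x :> f' x" "\<forall>x. DERIV g x :> g' x" by blast
  with mult show ?case
    by (intro bexI[of _ "\<lambda>x. f' x * g x + f x * g' x"] smooth_gen.add smooth_gen.mult)
       (auto intro!: derivative_eq_intros)
next
  case (powr f c)
  then obtain f' where f': "f' \<in> smooth_gen K"
    "\<And>x. DERIV f x :> f' x" by blast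
  have "DERIV (\<lambda>x. f x powr c) x :> c * (f x powr (c - 1) * f' x)" for x
    using DERIV_powr[OF f'(2) powr.hyps(2) DERIV_const[of c]] powr.hyps(2)[of x]
    by (simp add: powr_diff field_simps)
  moreover have "(\<lambda>x. c * (f x powr (c - 1) * f' x)) \<in> smooth_gen K"
    using f'(1) powr.hyps by (intro smooth_gen.mult smooth_gen.const smooth_gen.powr) auto
  ultimately show ?case by (intro bexI[of _ "\<lambda>x. c * (f x powr (c - 1) * f' x)"]) auto
next
  case (exp f)
  then obtain f' where f': "f' \<in> smooth_gen K"
    "\<forall>x. DERIV f x :> f' x" by blast
  with exp.hyps show ?case
    by (intro bexI[of _ "\<lambda>x. exp (f x) * f' x"] smooth_gen.mult smooth_gen.exp) (auto intro!: derivative_eq_intros)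
qed

lemma smooth_gen_smooth_fun:
  assumes K: "\<And>f. f \<in> K \<Longrightarrow> \<exists>f'\<in>smooth_gen K. \<forall>x. DERIV f x :> f' x"
    and "f \<in> smooth_gen K"
  shows "smooth_fun f"
proof -
  have 1: "deriv f \<in> smooth_gen K \<and> (\<forall>x. f field_differentiable at x)" if fK: "f \<in> smooth_gen K" for f
  proof -
    obtain f' where f': "f' \<in> smooth_gen K" "\<And>x. DERIV f x :> f' x"
      using smooth_gen_deriv[OF K fK] by auto
    then have "deriv f = f'" by (simp add: DERIV_imp_deriv fun_eq_iff)
    with f' show ?thesis by (auto simp: field_differentiable_def)
  qed
  have 2: "(deriv ^^ i) f \<in> smooth_gen K" for i
    by (induction i) (auto simp: assms(2) 1)
  show ?thesis
    unfolding smooth_fun_def Ck_fun_def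
    using 1[OF 2] by (auto simp: continuous_on_eq_continuous_at intro!: field_differentiable_imp_continuous_at)
qed

lemma smooth_fun_deriv:
  assumes "smooth_fun f" shows "DERIV f x :> deriv f x" "smooth_fun (deriv f)"
    "continuous_on UNIV f"
proof -
  have "Ck_fun 1 f" using assms by (simp add: smooth_fun_def)
  then have "f field_differentiable at x" for x
    unfolding Ck_fun_def by (metis funpow_0 zero_less_one)
  then show "DERIV f x :> deriv f x" "continuous_on UNIV f"
    using field_differentiable_imp_continuous_at
    by (auto simp: field_differentiable_derivI continuous_on_eq_continuous_at)
  show "smooth_fun (deriv f)"
    unfolding smooth_fun_def
  proof
    fix k
    have "Ck_fun (Suc k) f" using assms by (simp add: smooth_fun_def)
    then show "Ck_fun k (deriv f)"
      unfolding Ck_fun_def by (auto simp: funpow_Suc_right simp del: funpow.simps)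
  qed
qed

lemma smooth_funI:
  assumes "\<And>x. DERIV f x :> f' x" "smooth_fun f'"
  shows "smooth_fun f"
  unfolding smooth_fun_def
proof
  fix k
  have d: "deriv f = f'" using assms(1) by (simp add: DERIV_imp_deriv fun_eq_iff)
  have c: "continuous_on UNIV f"
    using assms(1) DERIV_isCont by (auto simp: continuous_on_eq_continuous_at)
  show "Ck_fun k f"
  proof (cases k)
    case 0 then show ?thesis using c by (simp add: Ck_fun_def)
  next
    case (Suc j)
    have "Ck_fun j f'" using assms(2) by (simp add: smooth_fun_def)
    then show ?thesis
      unfolding Ck_fun_def Suc using assms(1)
      by (auto simp: less_Suc_eq_0_disj funpow_Suc_right d field_differentiable_def simp del: funpow.simps)
  qed
qed

text \<open>Sigmoids of a product of two sines converge to the indicator function of an arc; they supply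
  enough periodic test functions.\<close>

definition arc_sigmoid :: "real \<Rightarrow> real \<Rightarrow> real \<Rightarrow> nat \<Rightarrow> real \<Rightarrow> real" where
  "arc_sigmoid X c d n x =
     (1 + exp (- real n * (sin (pi * (x - c) / X) * sin (pi * (d - x) / X)))) powr (-1)"

lemma arc_sigmoid_smooth: "smooth_fun (arc_sigmoid X c d n)"
proof -
  define K where "K = range (\<lambda>(a,b) x::real. sin (a * x + b))"
  have K: "(\<lambda>x. sin (a * x + b)) \<in> smooth_gen K" for a b
    by (rule smooth_gen.base) (auto simp: K_def)
  have 1: "\<exists>f'\<in>smooth_gen K. \<forall>x. DERIV f x :> f' x" if fK: "f \<in> K" for f
  proof -
    obtain a b where f: "f = (\<lambda>x. sin (a * x + b))" using fK by (auto simp: K_def)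
    have "DERIV f x :> a * sin (a * x + (b + pi/2))" for x
      unfolding f by (auto intro!: derivative_eq_intros simp: sin_add cos_add algebra_simps)
    moreover have "(\<lambda>x. a * sin (a * x + (b + pi/2))) \<in> smooth_gen K"
      by (intro smooth_gen.intros(2,4) K)
    ultimately show ?thesis by (intro bexI[of _ "\<lambda>x. a * sin (a * x + (b + pi/2))"]) auto
  qed
  have "(\<lambda>x. (1 + exp (- real n * (sin ((pi/X) * x + (- pi*c/X)) * sin ((-pi/X) * x + (pi * d/X))))) powr (-1)) \<in> smooth_gen K"
    by (intro smooth_gen.intros(2-) K) (simp add: add_pos_pos)
  also have "(\<lambda>x. (1 + exp (- real n * (sin ((pi/X) * x + (- pi*c/X)) * sin ((-pi/X) * x + (pi * d/X))))) powr (-1)) = arc_sigmoid X c d n"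
    unfolding arc_sigmoid_def
    by (intro ext) (simp add: diff_divide_distrib right_diff_distrib)
  finally show ?thesis by (rule smooth_gen_smooth_fun[rotated]) (rule 1)
qed

text \<open>The frequency pi / X is half the natural one, so that each sine has a single zero per
  period. A shift by \<open>X\<close> then flips the sign of each sine, and the product of the two
  is periodic.\<close>

lemma arc_sigmoid_periodic:
  assumes "X \<noteq> 0" shows "periodic_fun_simple (arc_sigmoid X c d n) X"
proof (rule periodic_fun_simpleI')
  fix x
  have "sin (pi * (x + X - c) / X) = - sin (pi * (x - c) / X)"
    using assms sin_periodic_pi[of "pi * (x - c) / X"] by (simp add: field_simps)
  moreover have "sin (pi * (d - (x + X)) / X) = - sin (pi * (d - x) / X)"
  proof -
    have "pi * (d - (x + X)) / X = pi * (d - x) / X - pi" using assms by (simp add: field_simps)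
    then show ?thesis by (simp add: sin_diff)
  qed
  ultimately show "arc_sigmoid X c d n (x + X) = arc_sigmoid X c d n x"
    by (simp add: arc_sigmoid_def)
qed

lemma arc_sigmoid_bounds: "0 < arc_sigmoid X c d n x" "arc_sigmoid X c d n x \<le> 1"
proof -
  let ?e = "exp (- real n * (sin (pi * (x - c) / X) * sin (pi * (d - x) / X)))"
  have "?e > 0" by simp
  then have "arc_sigmoid X c d n x = 1 / (1 + ?e)"
    unfolding arc_sigmoid_def by (subst powr_minus) (auto simp: divide_inverse)
  with \<open>?e > 0\<close> show "0 < arc_sigmoid X c d n x" "arc_sigmoid X c d n x \<le> 1"
    by (simp_all add: add_pos_pos)
qed

text \<open>Inside the arc both sines are positive, outside it exactly one is negative, so the
  exponent tends to minus or plus infinity.\<close>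

lemma arc_sigmoid_limit:
  assumes "0 \<le> c" "c < d" "d \<le> X" "x \<in> {0<..<X}" "x \<noteq> c" "x \<noteq> d"
  shows "(\<lambda>n. arc_sigmoid X c d n x) \<longlonglongrightarrow> indicator {c..d} x"
proof -
  define s where "s = sin (pi * (x - c) / X) * sin (pi * (d - x) / X)"
  have X: "X > 0" using assms by simp
  have *: "arc_sigmoid X c d n x = inverse (1 + exp (- (real n * s)))" for n
  proof -
    have "1 + exp (- real n * s) > 0" by (simp add: add_pos_pos)
    then show ?thesis unfolding arc_sigmoid_def s_def[symmetric]
      by (subst powr_minus) auto
  qed
  have pos: "sin (pi * y / X) > 0" if "0 < y" "y < X" for y
    using X that by (intro sin_gt_zero) (auto simp: field_simps)
  have neg: "sin (pi * y / X) < 0" if "y < 0" "-X < y" for y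
    using pos[of "-y"] that by simp
  have sgn: "s > 0" if "x \<in> {c..d}"
    unfolding s_def using assms that by (intro mult_pos_pos pos) auto
  have sgn': "s < 0" if "x \<notin> {c..d}"
  proof (cases "x < c")
    case True
    then show ?thesis unfolding s_def using assms by (intro mult_neg_pos pos neg) auto
  next
    case False
    then show ?thesis unfolding s_def using assms that by (intro mult_pos_neg pos neg) auto
  qed
  show ?thesis
  proof (cases "x \<in> {c..d}")
    case True
    then have "s > 0" by (rule sgn)
    then have "(\<lambda>n. inverse (1 + exp (- (real n * s)))) \<longlonglongrightarrow> 1" by real_asymp
    then show ?thesis using True by (simp add: *)
  next
    case False
    then have "s < 0" by (rule sgn')
    then have "(\<lambda>n. inverse (1 + exp (- (real n * s)))) \<longlonglongrightarrow> 0" by real_asymp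
    then show ?thesis using False by (simp add: *)
  qed
qed

section \<open>Absolutely continuous functions\<close>

abbreviation abs_int :: "real \<Rightarrow> real \<Rightarrow> (real \<Rightarrow> real) \<Rightarrow> bool" where
  "abs_int a b f \<equiv> f absolutely_integrable_on {a..b}"

lemmas abs_int_def = absolutely_integrable_on_def

lemma fundamental_theorem_real:
  fixes F :: "real \<Rightarrow> real"
  assumes "a \<le> b" "\<And>x. DERIV F x :> f x"
  shows "(f has_integral (F b - F a)) {a..b}"
  using assms by (intro fundamental_theorem_of_calculus)
    (auto simp flip: has_real_derivative_iff_has_vector_derivative intro: has_field_derivative_at_within)

lemma integral_join:
  fixes f :: "real \<Rightarrow> real"
  assumes "a \<le> c" "c \<le> b" "f integrable_on {a..b}"
  shows "integral {a..c} f + integral {c..b} f = integral {a..b} f"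
  using assms by (rule Henstock_Kurzweil_Integration.integral_combine)

text \<open>Absolute continuity is encoded by an integral identity with a prescribed density
  \<open>v\<close> instead of differentiability almost everywhere: a weak derivative arrives in this
  form, and integration by parts uses it in this form.\<close>

definition ac_on :: "real \<Rightarrow> real \<Rightarrow> (real \<Rightarrow> real) \<Rightarrow> (real \<Rightarrow> real) \<Rightarrow> bool" where
  "ac_on a b U v \<longleftrightarrow> abs_int a b v \<and>
     (\<forall>x\<in>{a..b}. (v has_integral (U x - U a)) {a..x})"

lemma ac_onD:
  assumes "ac_on a b U v" "a \<le> s" "s \<le> t" "t \<le> b"
  shows "(v has_integral (U t - U s)) {s..t}"
proof -
  have v: "v integrable_on {a..b}"
    using assms(1) abs_int_def unfolding ac_on_def by blast
  have i: "v integrable_on {s..t}" "v integrable_on {a..t}"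
    using assms by (auto intro!: integrable_subinterval_real[OF v])
  have "integral {a..s} v + integral {s..t} v = integral {a..t} v"
    using assms i by (intro integral_join) auto
  moreover have "integral {a..s} v = U s - U a" "integral {a..t} v = U t - U a"
    using assms unfolding ac_on_def by (auto intro!: integral_unique)
  ultimately have "integral {s..t} v = U t - U s" by simp
  with i show ?thesis by (metis integrable_integral)
qed

lemma ac_on_abs: "ac_on a b U v \<Longrightarrow> abs_int a b v"
  by (simp add: ac_on_def)

lemma ac_on_subinterval:
  assumes "ac_on a b U v" "a \<le> s" "t \<le> b"
  shows "ac_on s t U v"
  unfolding ac_on_def
proof
  show "abs_int s t v"
    using assms by (intro absolutely_integrable_on_subinterval[OF ac_on_abs[OF assms(1)]]) auto
  show "\<forall>x\<in>{s..t}. (v has_integral U x - U s) {s..x}"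
    using assms by (auto intro!: ac_onD)
qed

lemma ac_on_continuous:
  assumes "ac_on a b U v" shows "continuous_on {a..b} U"
proof -
  have v: "v integrable_on {a..b}"
    using assms abs_int_def unfolding ac_on_def by blast
  have "continuous_on {a..b} (\<lambda>x. U a + integral {a..x} v)"
    by (intro continuous_intros indefinite_integral_continuous_1 v)
  then show ?thesis
  proof (rule continuous_on_eq)
    fix x assume "x \<in> {a..b}"
    then have "integral {a..x} v = U x - U a" using assms
      unfolding ac_on_def by (auto intro!: integral_unique)
    then show "U a + integral {a..x} v = U x" by simp
  qed
qed

lemma ac_onI_C1:
  assumes "\<And>x. x \<in> {a..b} \<Longrightarrow> (U has_real_derivative v x) (at x within {a..b})"
    and "continuous_on {a..b} v"
  shows "ac_on a b U v"
  unfolding ac_on_def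
proof
  show "abs_int a b v"
    using assms(2) by (rule absolutely_integrable_continuous_real)
  show "\<forall>x\<in>{a..b}. (v has_integral U x - U a) {a..x}"
  proof
    fix x assume x: "x \<in> {a..b}"
    then show "(v has_integral U x - U a) {a..x}"
      using assms(1) has_field_derivative_subset[of U _ _ "{a..b}" "{a..x}"]
      by (intro fundamental_theorem_of_calculus)
         (auto simp flip: has_real_derivative_iff_has_vector_derivative)
  qed
qed

lemma ac_on_add:
  assumes "ac_on a b U v" "ac_on a b F f"
  shows "ac_on a b (\<lambda>x. U x + F x) (\<lambda>x. v x + f x)"
proof -
  have "((\<lambda>x. v x + f x) has_integral ((U x - U a) + (F x - F a))) {a..x}" if "x \<in> {a..b}" for x
    using assms that unfolding ac_on_def by (intro has_integral_add) auto
  then show ?thesis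
    using assms unfolding ac_on_def by (auto intro!: set_integral_add(1) simp: algebra_simps)
qed

lemma ac_on_cmul:
  assumes "ac_on a b U v" shows "ac_on a b (\<lambda>x. c * U x) (\<lambda>x. c * v x)"
proof -
  have "((\<lambda>x. c * v x) has_integral (c * (U x - U a))) {a..x}" if "x \<in> {a..b}" for x
    using assms that unfolding ac_on_def by (intro has_integral_mult_right) auto
  then show ?thesis
    using assms unfolding ac_on_def by (auto intro!: set_integrable_mult_right simp: algebra_simps)
qed

lemma abs_int_continuous_mult:
  fixes f g :: "real \<Rightarrow> real"
  assumes "continuous_on {a..b} f" "abs_int a b g"
  shows "abs_int a b (\<lambda>x. f x * g x)"
  using assms
  by (intro absolutely_integrable_bounded_measurable_product_real
        continuous_imp_measurable_on_sets_lebesgue compact_imp_bounded compact_continuous_image) auto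

lemma abs_int_square_mult:
  fixes f g :: "real \<Rightarrow> real"
  assumes "abs_int a b f" "abs_int a b g"
    and "abs_int a b (\<lambda>x. (f x)^2)" "abs_int a b (\<lambda>x. (g x)^2)"
  shows "abs_int a b (\<lambda>x. f x * g x)"
proof (rule measurable_bounded_by_integrable_imp_absolutely_integrable)
  show "(\<lambda>x. f x * g x) \<in> borel_measurable (lebesgue_on {a..b})"
    using assms(1,2) by (intro borel_measurable_times absolutely_integrable_imp_borel_measurable) auto
  show "(\<lambda>x. (f x)^2 + (g x)^2) integrable_on {a..b}"
    using assms(3,4) by (intro integrable_add) (auto simp: abs_int_def)
  show "norm (f x * g x) \<le> (f x)^2 + (g x)^2" for x
  proof -
    have "2 * (\<bar>f x\<bar> * \<bar>g x\<bar>) \<le> (f x)^2 + (g x)^2"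
      using sum_squares_bound[of "\<bar>f x\<bar>" "\<bar>g x\<bar>"] by simp
    moreover have "0 \<le> \<bar>f x\<bar> * \<bar>g x\<bar>" by simp
    ultimately show ?thesis unfolding real_norm_def abs_mult by linarith
  qed
qed auto

lemma abs_int_square_add:
  fixes f g :: "real \<Rightarrow> real"
  assumes "abs_int a b f" "abs_int a b g"
    and "abs_int a b (\<lambda>x. (f x)^2)" "abs_int a b (\<lambda>x. (g x)^2)"
  shows "abs_int a b (\<lambda>x. (f x + g x)^2)"
proof -
  have "abs_int a b (\<lambda>x. ((f x)^2 + (g x)^2) + 2 * (f x * g x))"
    using assms by (intro set_integral_add(1) set_integrable_mult_right abs_int_square_mult) auto
  then show ?thesis by (simp add: power2_sum algebra_simps)
qed

text \<open>On a short interval the two factors are nearly constant, so the product rule holds up to a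
  small multiple of the total variation; summing over a fine partition gives the exact identity.\<close>

lemma ac_on_mult_aux:
  assumes F: "ac_on a b F f" and G: "ac_on a b G g" and ab: "a \<le> b"
  shows "((\<lambda>x. f x * G x + F x * g x) has_integral (F b * G b - F a * G a)) {a..b}"
proof -
  define h where "h = (\<lambda>x. f x * G x + F x * g x)"
  define N where "N = (\<lambda>x. \<bar>f x\<bar> + \<bar>g x\<bar>)"
  note cF = ac_on_continuous[OF F] and cG = ac_on_continuous[OF G]
  have h: "abs_int a b h"
    using abs_int_continuous_mult[OF cG ac_on_abs[OF F]]
      abs_int_continuous_mult[OF cF ac_on_abs[OF G]]
    unfolding h_def by (intro set_integral_add(1)) (auto simp: mult.commute)
  have hi: "h integrable_on {s..t}" if "a \<le> s" "t \<le> b" for s t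
    using integrable_subinterval_real[of h a b s t] h that by (auto simp: abs_int_def)
  have N: "N integrable_on {a..b}"
    using ac_on_abs[OF F] ac_on_abs[OF G] unfolding N_def
    by (intro integrable_add) (auto simp: abs_int_def)
  have Ni: "N integrable_on {s..t}" if "a \<le> s" "t \<le> b" for s t
    using integrable_subinterval_real[OF N, of s t] that by auto
  have N0: "integral {a..b} N \<ge> 0" using N by (rule integral_nonneg) (simp add: N_def)
  have main: "\<bar>F b * G b - F a * G a - integral {a..b} h\<bar> \<le> e * integral {a..b} N" if e: "e > 0" for e
  proof -
    obtain d1 where d1: "d1 > 0" "\<And>x y. x \<in> {a..b} \<Longrightarrow> y \<in> {a..b} \<Longrightarrow> dist y x < d1 \<Longrightarrow> dist (F y) (F x) < e"
      using compact_uniformly_continuous[OF cF compact_Icc] e unfolding uniformly_continuous_on_def by metis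
    obtain d2 where d2: "d2 > 0" "\<And>x y. x \<in> {a..b} \<Longrightarrow> y \<in> {a..b} \<Longrightarrow> dist y x < d2 \<Longrightarrow> dist (G y) (G x) < e"
      using compact_uniformly_continuous[OF cG compact_Icc] e unfolding uniformly_continuous_on_def by metis
    define d where "d = min d1 d2"
    have d: "d > 0" using d1 d2 by (simp add: d_def)
    obtain n :: nat where n: "(b - a) / d < real n" using reals_Archimedean2 by blast
    have "0 \<le> (b - a) / d" using d ab by simp
    with n have n0: "n > 0" by (metis of_nat_0_less_iff le_less_trans)
    define t where "t = (\<lambda>i::nat. a + real i * ((b - a) / real n))"
    have t0: "t 0 = a" and tn: "t n = b" using n0 by (auto simp: t_def)
    have tle: "t i \<le> t (Suc i)" for i using ab unfolding t_def by (intro add_left_mono mult_right_mono) auto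
    have tmono: "t i \<le> t j" if "i \<le> j" for i j using tle that by (rule lift_Suc_mono_le)
    have tin: "t i \<in> {a..b}" if "i \<le> n" for i using tmono[of 0 i] tmono[of i n] t0 tn that by simp
    have tst: "t (Suc i) - t i < d" for i
    proof -
      have "t (Suc i) - t i = (b - a) / real n" by (simp add: t_def algebra_simps add_divide_distrib[symmetric])
      also have "\<dots> < d" using n n0 d by (simp add: field_simps)
      finally show ?thesis .
    qed
    have "\<bar>F (t i) * G (t i) - F a * G a - integral {a..t i} h\<bar> \<le> e * integral {a..t i} N" if "i \<le> n" for i
      using that
    proof (induction i)
      case 0 then show ?case by (simp add: t0)
    next
      case (Suc i)
      define s r where "s = t i" and "r = t (Suc i)"
      have sr: "a \<le> s" "s \<le> r" "r \<le> b" using tin[of i] tin[of "Suc i"] Suc.prems tle by (auto simp: s_def r_def)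
      have "((\<lambda>x. f x * G r + F s * g x - h x) has_integral ((F r - F s) * G r + F s * (G r - G s) - integral {s..r} h)) {s..r}"
        using ac_onD[OF F sr] ac_onD[OF G sr] hi[of s r] sr
        by (intro has_integral_diff has_integral_add has_integral_mult_left has_integral_mult_right) (auto simp: integrable_integral)
      then have 1: "((\<lambda>x. f x * (G r - G x) + (F s - F x) * g x) has_integral (F r * G r - F s * G s - integral {s..r} h)) {s..r}"
        by (rule has_integral_eq_rhs[OF has_integral_eq[rotated]]) (auto simp: h_def algebra_simps)
      have "norm (integral {s..r} (\<lambda>x. f x * (G r - G x) + (F s - F x) * g x)) \<le> integral {s..r} (\<lambda>x. e * N x)"
      proof (rule integral_norm_bound_integral)
        show "(\<lambda>x. f x * (G r - G x) + (F s - F x) * g x) integrable_on {s..r}" using 1 by blast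
        show "(\<lambda>x. e * N x) integrable_on {s..r}" using Ni[of s r] sr by (intro integrable_on_mult_right) auto
        fix x assume x: "x \<in> {s..r}"
        have "dist (G r) (G x) < e" "dist (F s) (F x) < e"
          using x sr tst[of i] by (intro d1 d2; auto simp: d_def dist_real_def s_def r_def)+
        then have "\<bar>f x\<bar> * \<bar>G r - G x\<bar> \<le> \<bar>f x\<bar> * e" "\<bar>F s - F x\<bar> * \<bar>g x\<bar> \<le> e * \<bar>g x\<bar>"
          by (auto simp: dist_real_def intro!: mult_left_mono mult_right_mono)
        moreover have "norm (f x * (G r - G x) + (F s - F x) * g x) \<le> \<bar>f x\<bar> * \<bar>G r - G x\<bar> + \<bar>F s - F x\<bar> * \<bar>g x\<bar>"
          unfolding real_norm_def abs_mult[symmetric] by (rule abs_triangle_ineq)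
        moreover have "\<bar>f x\<bar> * e + e * \<bar>g x\<bar> = e * N x" by (simp add: N_def algebra_simps)
        ultimately show "norm (f x * (G r - G x) + (F s - F x) * g x) \<le> e * N x" by linarith
      qed
      then have 2: "\<bar>F r * G r - F s * G s - integral {s..r} h\<bar> \<le> e * integral {s..r} N"
        using integral_unique[OF 1] by simp
      have 3: "integral {a..s} h + integral {s..r} h = integral {a..r} h"
        "integral {a..s} N + integral {s..r} N = integral {a..r} N"
        using sr by (intro integral_join hi Ni; simp)+
      have "e * integral {a..r} N = e * integral {a..s} N + e * integral {s..r} N"
        unfolding 3(2)[symmetric] by (simp add: algebra_simps)
      then show ?case using 2 3(1) Suc.IH Suc.prems unfolding s_def[symmetric] r_def[symmetric] by linarith
    qed
    from this[of n] show ?thesis by (simp add: tn)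
  qed
  have "\<bar>F b * G b - F a * G a - integral {a..b} h\<bar> \<le> 0"
  proof (rule field_le_epsilon)
    fix e :: real assume e: "e > 0"
    \<comment> \<open>The summand 1 covers the case that the integral of \<open>N\<close> is
      zero.\<close>
    have "e / (1 + integral {a..b} N) > 0" using e N0 by auto
    from main[OF this] have "\<bar>F b * G b - F a * G a - integral {a..b} h\<bar> \<le> e * (integral {a..b} N / (1 + integral {a..b} N))"
      by simp
    also have "\<dots> \<le> e * 1" using e N0 by (intro mult_left_mono) auto
    finally show "\<bar>F b * G b - F a * G a - integral {a..b} h\<bar> \<le> 0 + e" by simp
  qed
  then have "integral {a..b} h = F b * G b - F a * G a" by simp
  with hi[of a b] show ?thesis unfolding h_def by (metis integrable_integral order_refl)
qed

lemma ac_on_mult: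
  assumes F: "ac_on a b F f" and G: "ac_on a b G g"
  shows "ac_on a b (\<lambda>x. F x * G x) (\<lambda>x. f x * G x + F x * g x)"
proof -
  have "abs_int a b (\<lambda>x. f x * G x + F x * g x)"
    using abs_int_continuous_mult[OF ac_on_continuous[OF G] ac_on_abs[OF F]]
      abs_int_continuous_mult[OF ac_on_continuous[OF F] ac_on_abs[OF G]]
    by (intro set_integral_add(1)) (auto simp: mult.commute)
  then show ?thesis
    unfolding ac_on_def using ac_on_mult_aux[OF ac_on_subinterval[OF F] ac_on_subinterval[OF G]] by auto
qed

section \<open>Sobolev functions on the circle\<close>

text \<open>Lebesgue differentiation: at almost every point the value is the limit of averages over
  intervals to its right, and these averages vanish.\<close>

lemma integral_subintervals_zero:
  fixes f :: "real \<Rightarrow> real"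
  assumes f: "f integrable_on {a..b}"
    and 0: "\<And>c d. a \<le> c \<Longrightarrow> c < d \<Longrightarrow> d \<le> b \<Longrightarrow> integral {c..d} f = 0"
  shows "\<exists>N. negligible N \<and> (\<forall>x\<in>{a..b} - N. f x = 0)"
proof -
  define g where "g = (\<lambda>x. if x \<in> {a..b} then f x else 0)"
  have g: "g integrable_on UNIV" using f unfolding g_def by (subst integrable_restrict_UNIV)
  have g': "g integrable_on cbox c d" for c d
    by (rule integrable_on_subcbox[OF g]) auto
  obtain N where N: "negligible N"
    and k: "\<And>x e. \<lbrakk>x \<notin> N; 0 < e\<rbrakk> \<Longrightarrow> \<exists>d>0. \<forall>h. 0 < h \<and> h < d \<longrightarrow>
                  norm (integral (cbox x (x + h *\<^sub>R One)) g /\<^sub>R h ^ DIM(real) - g x) < e"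
    using integrable_ccontinuous_explicit[OF g'] by blast
  \<comment> \<open>The point \<open>b\<close> joins the null set because no interval to its right
    lies in {a..b}.\<close>
  have "f x = 0" if x: "x \<in> {a..b} - insert b N" for x
  proof (rule ccontr)
    assume nz: "f x \<noteq> 0"
    then obtain d where d: "d > 0" "\<And>h. 0 < h \<Longrightarrow> h < d \<Longrightarrow>
         norm (integral {x..x + h} g / h - g x) < \<bar>f x\<bar>"
      using k[of x "\<bar>f x\<bar>"] x by (auto simp: divide_inverse_commute)
    define h where "h = min (d/2) (b - x)"
    have h: "h > 0" "h < d" "x + h \<le> b" using d x by (auto simp: h_def min_def)
    have "integral {x..x + h} g = integral {x..x+h} f"
      using x h by (intro Henstock_Kurzweil_Integration.integral_cong) (auto simp: g_def)
    also have "\<dots> = 0" using x h by (intro 0) auto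
    finally show False using d(2)[OF h(1,2)] x by (simp add: g_def)
  qed
  moreover have "negligible (insert b N)" using N by simp
  ultimately show ?thesis by blast
qed

text \<open>Testing against \<open>arc_sigmoid\<close> and passing to the limit by dominated
  convergence, with majorant the absolute value of \<open>f\<close>, makes the integral over every
  subinterval vanish.\<close>

lemma smooth_periodic_separates:
  assumes X: "X > 0" and f: "abs_int 0 X f"
    and 0: "\<And>\<phi>. smooth_fun \<phi> \<Longrightarrow> periodic_fun_simple \<phi> X \<Longrightarrow> integral {0..X} (\<lambda>x. f x * \<phi> x) = 0"
  shows "\<exists>N. negligible N \<and> (\<forall>x\<in>{0..X} - N. f x = 0)"
proof (rule integral_subintervals_zero)
  show fi: "f integrable_on {0..X}" using f by (simp add: abs_int_def)
  fix c d assume cd: "0 \<le> c" "c < d" "d \<le> X"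
  define S where "S = {0,X,c,d}"
  have S: "negligible S" by (simp add: S_def)
  define F where "F = (\<lambda>n x. if x \<in> S then 0 else f x * arc_sigmoid X c d n x)"
  define G where "G = (\<lambda>x. if x \<in> S then 0 else f x * indicator {c..d} x)"
  have i: "((\<lambda>x. f x * arc_sigmoid X c d n x) has_integral 0) {0..X}" for n
  proof -
    have "continuous_on {0..X} (arc_sigmoid X c d n)"
      using smooth_fun_deriv(3)[OF arc_sigmoid_smooth] by (rule continuous_on_subset) auto
    from abs_int_continuous_mult[OF this f]
    have "(\<lambda>x. f x * arc_sigmoid X c d n x) integrable_on {0..X}"
      by (simp add: abs_int_def mult.commute)
    with 0[OF arc_sigmoid_smooth arc_sigmoid_periodic] X show ?thesis
      by (metis has_integral_integral less_irrefl)
  qed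
  have F: "(F n has_integral 0) {0..X}" for n
    by (rule has_integral_spike[OF S _ i]) (auto simp: F_def)
  have dc: "(\<lambda>k. integral {0..X} (F k)) \<longlonglongrightarrow> integral {0..X} G"
  proof (rule dominated_convergence(2)[where h="\<lambda>x. norm (f x)"])
    show "F k integrable_on {0..X}" for k using F by blast
    show "(\<lambda>x. norm (f x)) integrable_on {0..X}" using f by (simp add: abs_int_def)
    show "norm (F k x) \<le> norm (f x)" for k x
      using arc_sigmoid_bounds[of X c d k x] by (auto simp: F_def abs_mult mult_left_le)
    show "(\<lambda>k. F k x) \<longlonglongrightarrow> G x" if x: "x \<in> {0..X}" for x
    proof (cases "x \<in> S")
      case False
      then have "x \<in> {0<..<X}" "x \<noteq> c" "x \<noteq> d" using x by (auto simp: S_def)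
      then show ?thesis using False arc_sigmoid_limit[OF cd] unfolding F_def G_def
        by (auto intro!: tendsto_mult_left)
    qed (simp add: F_def G_def)
  qed
  have "integral {0..X} (F n) = 0" for n using F by (rule integral_unique)
  with dc have "integral {0..X} G = 0" by (simp add: LIMSEQ_const_iff)
  also have "integral {0..X} G = integral {0..X} (\<lambda>x. if x \<in> {c..d} then f x else 0)"
    by (rule integral_spike[OF S]) (auto simp: G_def)
  also have "\<dots> = integral {c..d} f"
    using cd by (subst integral_restrict_Int) (auto simp: Int_absorb2)
  finally show "integral {c..d} f = 0" .
qed

lemma L2_circleD:
  assumes "v \<in> L2_circle X"
  shows "abs_int 0 X v" "abs_int 0 X (\<lambda>x. (v x)^2)"
    "\<And>x. v (x + X) = v x" "v \<in> borel_measurable lebesgue"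
proof -
  show sq: "abs_int 0 X (\<lambda>x. (v x)^2)"
    and "\<And>x. v (x + X) = v x" and m: "v \<in> borel_measurable lebesgue"
    using assms by (auto simp: L2_circle_def dest: periodic_fun_simpleD)
  show "abs_int 0 X v"
  proof (rule measurable_bounded_by_integrable_imp_absolutely_integrable)
    show "v \<in> borel_measurable (lebesgue_on {0..X})" using m by (rule measurable_restrict_space1)
    show "(\<lambda>x. 1 + (v x)^2) integrable_on {0..X}"
      using sq by (intro integrable_add integrable_const_ivl) (auto simp: abs_int_def)
    show "norm (v x) \<le> 1 + (v x)^2" for x
      using sum_squares_bound[of 1 "\<bar>v x\<bar>"] abs_ge_zero[of "v x"] by simp
  qed simp
qed

lemma L2_circleI:
  assumes "\<And>x. v (x + X) = v x" "v \<in> borel_measurable lebesgue" "abs_int 0 X (\<lambda>x. (v x)^2)"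
  shows "v \<in> L2_circle X"
  using assms by (auto simp: L2_circle_def intro: periodic_fun_simpleI')

lemma weak_deriv_circle_iff_integral:
  assumes u: "u \<in> L2_circle X" and v: "v \<in> L2_circle X"
  shows "has_weak_deriv_circle X u v \<longleftrightarrow> (\<forall>\<phi>. smooth_fun \<phi> \<and> periodic_fun_simple \<phi> X \<longrightarrow>
        integral {0..X} (\<lambda>x. u x * deriv \<phi> x) = - integral {0..X} (\<lambda>x. v x * \<phi> x))"
proof -
  have "(LINT x:{0..X}|lebesgue. w x * \<phi> x) = integral {0..X} (\<lambda>x. w x * \<phi> x)"
    if w: "w \<in> L2_circle X" and "continuous_on UNIV \<phi>" for w \<phi>
    using abs_int_continuous_mult[OF _ L2_circleD(1)[OF w], of \<phi>] continuous_on_subset[OF that(2)]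
    by (intro set_lebesgue_integral_eq_integral) (auto simp: mult.commute)
  from this[OF u smooth_fun_deriv(3)[OF smooth_fun_deriv(2)]] this[OF v smooth_fun_deriv(3)]
  show ?thesis
    unfolding has_weak_deriv_circle_def by (intro all_cong1 imp_cong refl) auto
qed

text \<open>The energy refers to an unspecified choice of weak derivative. Two candidates differ by
  a function orthogonal to all periodic test functions, so the choice may be exchanged for a
  concrete \<open>v\<close>.\<close>

lemma weak_deriv_circle_AE_unique:
  assumes X: "X > 0" and u: "u \<in> L2_circle X" and v: "v \<in> L2_circle X" and w: "has_weak_deriv_circle X u v"
  shows "weak_deriv_circle X u \<in> L2_circle X"
    "\<exists>N. negligible N \<and> (\<forall>x\<in>{0..X} - N. weak_deriv_circle X u x = v x)"
proof -
  have *: "weak_deriv_circle X u \<in> L2_circle X \<and> has_weak_deriv_circle X u (weak_deriv_circle X u)"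
    unfolding weak_deriv_circle_def by (rule someI[of _ v]) (use v w in blast)
  then show d: "weak_deriv_circle X u \<in> L2_circle X" by blast
  have "\<exists>N. negligible N \<and> (\<forall>x\<in>{0..X} - N. weak_deriv_circle X u x - v x = 0)"
  proof (rule smooth_periodic_separates[OF X])
    show "abs_int 0 X (\<lambda>x. weak_deriv_circle X u x - v x)"
      using L2_circleD(1)[OF d] L2_circleD(1)[OF v] by (rule set_integral_diff(1))
    fix \<phi> assume p: "smooth_fun \<phi>" "periodic_fun_simple \<phi> X"
    have c: "continuous_on {0..X} \<phi>" using smooth_fun_deriv(3)[OF p(1)] by (rule continuous_on_subset) auto
    have i: "(\<lambda>x. w x * \<phi> x) integrable_on {0..X}" if "w \<in> L2_circle X" for w
      using abs_int_continuous_mult[OF c L2_circleD(1)[OF that]]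
      by (simp add: abs_int_def mult.commute)
    have "integral {0..X} (\<lambda>x. (weak_deriv_circle X u x - v x) * \<phi> x) =
       integral {0..X} (\<lambda>x. weak_deriv_circle X u x * \<phi> x) - integral {0..X} (\<lambda>x. v x * \<phi> x)"
      unfolding left_diff_distrib by (intro integral_diff i d v)
    also have "\<dots> = 0"
      using weak_deriv_circle_iff_integral[OF u d, THEN iffD1, OF conjunct2[OF *], rule_format, OF conjI[OF p]]
        weak_deriv_circle_iff_integral[OF u v, THEN iffD1, OF w, rule_format, OF conjI[OF p]] by simp
    finally show "integral {0..X} (\<lambda>x. (weak_deriv_circle X u x - v x) * \<phi> x) = 0" .
  qed
  then show "\<exists>N. negligible N \<and> (\<forall>x\<in>{0..X} - N. weak_deriv_circle X u x = v x)" by simp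
qed

lemma smooth_fun_periodic_parts:
  assumes "ac_on 0 X U v" "U X = U 0" "smooth_fun \<phi>" "periodic_fun_simple \<phi> X" "0 \<le> X"
  shows "((\<lambda>x. v x * \<phi> x + U x * deriv \<phi> x) has_integral 0) {0..X}"
proof -
  have "ac_on 0 X \<phi> (deriv \<phi>)"
    using smooth_fun_deriv[OF assms(3)] smooth_fun_deriv(3)[OF smooth_fun_deriv(2)[OF assms(3)]]
    by (intro ac_onI_C1) (auto intro: has_field_derivative_at_within continuous_on_subset)
  from ac_on_mult_aux[OF assms(1) this assms(5)] show ?thesis
    using assms(2) periodic_fun_simpleD[OF assms(4), of 0] by simp
qed

lemma has_weak_deriv_circleI:
  assumes X: "X > 0" and u: "u \<in> L2_circle X" and v: "v \<in> L2_circle X"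
    and U: "ac_on 0 X U v" "U X = U 0" and N: "negligible N" "\<And>x. x \<in> {0..X} - N \<Longrightarrow> u x = U x"
  shows "has_weak_deriv_circle X u v"
  unfolding weak_deriv_circle_iff_integral[OF u v]
proof (intro allI impI, elim conjE)
  fix \<phi> assume p: "smooth_fun \<phi>" "periodic_fun_simple \<phi> X"
  have c: "continuous_on {0..X} \<phi>" "continuous_on {0..X} (deriv \<phi>)"
    using smooth_fun_deriv(3)[OF p(1)] smooth_fun_deriv(3)[OF smooth_fun_deriv(2)[OF p(1)]]
    by (auto intro: continuous_on_subset)
  have i: "(\<lambda>x. v x * \<phi> x) integrable_on {0..X}" "(\<lambda>x. U x * deriv \<phi> x) integrable_on {0..X}"
    using abs_int_continuous_mult[OF c(1) ac_on_abs[OF U(1)]]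
      ac_on_continuous[OF U(1)] c(2)
    by (auto simp: abs_int_def mult.commute intro!: integrable_continuous_real continuous_intros)
  have "integral {0..X} (\<lambda>x. u x * deriv \<phi> x) = integral {0..X} (\<lambda>x. U x * deriv \<phi> x)"
    using N(2) by (intro integral_spike[OF N(1)]) auto
  moreover have "integral {0..X} (\<lambda>x. v x * \<phi> x + U x * deriv \<phi> x) = 0"
    using smooth_fun_periodic_parts[OF U p] X by (auto intro: integral_unique)
  ultimately show "integral {0..X} (\<lambda>x. u x * deriv \<phi> x) = - integral {0..X} (\<lambda>x. v x * \<phi> x)"
    using integral_add[OF i] by simp
qed

lemma periodic_abs_int:
  fixes f :: "real \<Rightarrow> real"
  assumes X: "X > 0" and p: "\<And>x. f (x + X) = f x" and f: "abs_int 0 X f"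
  shows "abs_int a b f"
proof -
  interpret periodic_fun_simple f X by unfold_locales (rule p)
  have p': "f (x + real n * X) = f x" for x n by (rule plus_of_nat)
  have 1: "abs_int c d f \<longleftrightarrow> abs_int (c - t) (d - t) f"
    if "\<And>x. f (x + t) = f x" for c d t
    using integrable_shift_real_ivl_iff[of f t c d] integrable_shift_real_ivl_iff[of "\<lambda>x. norm (f x)" t c d] that
    by (simp add: abs_int_def)
  have 2: "abs_int 0 (real n * X) f" for n
  proof (induction n)
    case (Suc n)
    have "abs_int (real n * X) (real (Suc n) * X) f"
      using 1[of "real n * X" "real n * X" "real (Suc n) * X"] p' f by (simp add: distrib_right)
    then show ?case
      by (rule absolutely_integrable_on_combine[OF Suc]) (use X in \<open>auto intro: mult_right_mono\<close>)
  qed (simp add: absolutely_integrable_negligible)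
  obtain n where n: "\<bar>a\<bar> / X + \<bar>b\<bar> / X \<le> real n" using real_arch_simple by blast
  have "abs_int (- (real n * X)) (real n * X) f"
    using 2[of "2*n"] 1[of "real n * X" 0 "real (2*n) * X"] p' by (simp add: algebra_simps)
  moreover have "\<bar>a\<bar> + \<bar>b\<bar> \<le> real n * X" using n X by (simp add: field_simps)
  then have "{a..b} \<subseteq> {- (real n * X)..real n * X}" by auto
  ultimately show ?thesis by (rule absolutely_integrable_on_subinterval)
qed

lemma periodic_integral:
  fixes f :: "real \<Rightarrow> real"
  assumes X: "X > 0" and p: "\<And>x. f (x + X) = f x" and f: "abs_int 0 X f"
  shows "integral {a..a + X} f = integral {0..X} f"
proof -
  interpret periodic_fun_simple f X by unfold_locales (rule p)
  define n where "n = \<lfloor>a / X\<rfloor>"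
  define r where "r = a - of_int n * X"
  have r: "0 \<le> r" "r < X"
    using floor_divide_lower[OF X, of a] floor_divide_upper[OF X, of a]
    unfolding r_def n_def by (auto simp: algebra_simps)
  have i: "f integrable_on {c..d}" for c d
    using periodic_abs_int[OF assms] by (simp add: abs_int_def)
  have "integral {a..a + X} f = integral {r..r + X} f"
    using integral_shift_real_ivl[of a "of_int n * X" "a + X" f] plus_of_int by (simp add: r_def algebra_simps)
  also have "\<dots> = integral {r..X} f + integral {X..r+X} f"
    using r by (intro integral_join[symmetric] i) auto
  also have "integral {X..r+X} f = integral {0..r} f"
    using integral_shift_real_ivl[of X X "r + X" f] p by simp
  also have "integral {r..X} f + integral {0..r} f = integral {0..X} f"
    using r by (subst add.commute) (intro integral_join i; simp)
  finally show ?thesis .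
qed

lemma ac_on_antiderivative:
  assumes "\<And>a b. abs_int a (b::real) v"
  obtains U where "\<And>a b. ac_on a b U v"
proof
  have i: "v integrable_on {a..b}" for a b using assms by (simp add: abs_int_def)
  define U where "U = (\<lambda>x. if x \<ge> 0 then integral {0..x} v else - integral {x..0} v)"
  have c: "integral {a..b} v + integral {b..c} v = integral {a..c} v" if "a \<le> b" "b \<le> c" for a b c
    using that by (intro integral_join i)
  have "integral {s..t} v = U t - U s" if "s \<le> t" for s t
    using c[of 0 s t] c[of s 0 t] c[of s t 0] that by (auto simp: U_def)
  then have "(v has_integral (U t - U s)) {s..t}" if "s \<le> t" for s t
    using i that by (metis integrable_integral)
  then show "ac_on a b U v" for a b unfolding ac_on_def using assms by auto
qed

lemma continuous_antiderivative:
  assumes "continuous_on UNIV (g :: real \<Rightarrow> real)"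
  obtains F where "\<And>x. DERIV F x :> g x"
proof -
  have "isCont g x" for x using assms by (simp add: continuous_on_eq_continuous_at)
  then show ?thesis
    using einterval_antiderivative[of "-\<infinity>" "\<infinity>" g] that
    by (auto simp: has_real_derivative_iff_has_vector_derivative)
qed

text \<open>du Bois-Reymond: testing against \<open>\<phi>'\<close> only determines a function up to a constant, which
  is absorbed into the continuous representative.\<close>

lemma H1_circle_representative:
  assumes X: "X > 0" and u: "u \<in> L2_circle X" and v: "v \<in> L2_circle X" and w: "has_weak_deriv_circle X u v"
  obtains U N where "\<And>a b. ac_on a b U v" "\<And>x. U (x + X) = U x"
    "negligible N" "\<And>x. x \<in> {0..X} - N \<Longrightarrow> u x = U x"
proof -
  note L = L2_circleD[OF u] and Lv = L2_circleD[OF v]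
  note wi = weak_deriv_circle_iff_integral[OF u v, THEN iffD1, OF w, rule_format]
  have va: "abs_int a b v" for a b
    by (rule periodic_abs_int[OF X Lv(3,1)])
  then obtain U where U: "\<And>a b. ac_on a b U v" using ac_on_antiderivative by metis
  \<comment> \<open>Testing with the constant 1 gives \<open>v\<close> mean zero, which is what
    makes its primitive \<open>U\<close> periodic.\<close>
  have v0: "integral {0..X} v = 0"
  proof -
    have "smooth_fun (\<lambda>x::real. 1::real)"
      by (rule smooth_gen_smooth_fun[of "{}"]) (auto intro: smooth_gen.const)
    moreover have "periodic_fun_simple (\<lambda>x::real. 1::real) X" by (rule periodic_fun_simpleI') simp
    ultimately show ?thesis using wi[of "\<lambda>x. 1"] by simp
  qed
  have Up: "U (x + X) = U x" for x
  proof -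
    have "(v has_integral (U (x + X) - U x)) {x..x+X}" using X by (intro ac_onD[OF U[of x "x+X"]]) auto
    then have "U (x + X) - U x = integral {0..X} v"
      using periodic_integral[OF X Lv(3,1)] by (metis integral_unique)
    then show ?thesis by (simp add: v0)
  qed
  define W where "W = (\<lambda>x. u x - U x)"
  define m where "m = integral {0..X} W / X"
  have Uc: "continuous_on {0..X} U" by (rule ac_on_continuous[OF U])
  have Wa: "abs_int 0 X W"
    unfolding W_def using Uc by (intro set_integral_diff(1) L absolutely_integrable_continuous_real)
  have W1: "integral {0..X} (\<lambda>x. W x * deriv \<phi> x) = 0"
    if p: "smooth_fun \<phi>" "periodic_fun_simple \<phi> X" for \<phi>
  proof -
    have c: "continuous_on {0..X} \<phi>" "continuous_on {0..X} (deriv \<phi>)"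
      using smooth_fun_deriv(3)[OF p(1)] smooth_fun_deriv(3)[OF smooth_fun_deriv(2)[OF p(1)]]
      by (auto intro: continuous_on_subset)
    have i: "(\<lambda>x. v x * \<phi> x) integrable_on {0..X}" "(\<lambda>x. U x * deriv \<phi> x) integrable_on {0..X}"
       "(\<lambda>x. u x * deriv \<phi> x) integrable_on {0..X}"
      using abs_int_continuous_mult[OF c(1) Lv(1)] Uc c(2)
         abs_int_continuous_mult[OF c(2) L(1)]
      by (auto simp: abs_int_def mult.commute intro!: integrable_continuous_real continuous_intros)
    have "integral {0..X} (\<lambda>x. v x * \<phi> x + U x * deriv \<phi> x) = 0"
      using smooth_fun_periodic_parts[OF U _ p] X Up[of 0] by (auto intro: integral_unique)
    with wi[OF conjI[OF p]] show ?thesis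
      using integral_add[OF i(1,2)] integral_diff[OF i(3,2)] by (simp add: W_def left_diff_distrib)
  qed
  have "\<exists>N. negligible N \<and> (\<forall>x\<in>{0..X} - N. W x - m = 0)"
  proof (rule smooth_periodic_separates[OF X])
    show "abs_int 0 X (\<lambda>x. W x - m)"
      by (rule set_integral_diff(1)[OF Wa absolutely_integrable_continuous_real]) auto
    fix \<psi> assume p: "smooth_fun \<psi>" "periodic_fun_simple \<psi> X"
    \<comment> \<open>After subtraction of its mean, \<psi> has a periodic primitive, which is then
      an admissible test function.\<close>
    define c where "c = integral {0..X} \<psi> / X"
    have pc: "continuous_on UNIV \<psi>" by (rule smooth_fun_deriv(3)[OF p(1)])
    have pci: "abs_int 0 X \<psi>"
      by (rule absolutely_integrable_continuous_real[OF continuous_on_subset[OF pc]]) auto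
    have "continuous_on UNIV (\<lambda>x. \<psi> x - c)" using pc by (intro continuous_intros)
    then obtain \<phi> where \<phi>: "\<And>x. DERIV \<phi> x :> (\<psi> x - c)"
      by (rule continuous_antiderivative) blast
    have "smooth_fun (\<lambda>x. \<psi> x - c)"
      by (rule smooth_funI[OF _ smooth_fun_deriv(2)[OF p(1)]])
         (use DERIV_diff[OF smooth_fun_deriv(1)[OF p(1)] DERIV_const[of c]] in simp)
    then have s: "smooth_fun \<phi>" by (rule smooth_funI[OF \<phi>])
    have "\<phi> (x + X) = \<phi> x" for x
    proof -
      have "((\<lambda>x. \<psi> x - c) has_integral (\<phi> (x + X) - \<phi> x)) {x..x+X}"
        using X \<phi> by (intro fundamental_theorem_real) auto
      moreover have "((\<lambda>x. \<psi> x - c) has_integral (integral {x..x+X} \<psi> - X * c)) {x..x+X}"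
        using pc X by (intro has_integral_diff has_integral_const_real[THEN has_integral_eq_rhs] integrable_integral integrable_continuous_real)
          (auto intro: continuous_on_subset)
      ultimately have "\<phi> (x + X) - \<phi> x = integral {0..X} \<psi> - X * c"
        using periodic_integral[OF X periodic_fun_simpleD[OF p(2)] pci] by (metis has_integral_unique)
      then show ?thesis using X by (simp add: c_def)
    qed
    then have "periodic_fun_simple \<phi> X" by (rule periodic_fun_simpleI')
    moreover have "deriv \<phi> = (\<lambda>x. \<psi> x - c)" using \<phi> DERIV_imp_deriv by blast
    ultimately have 1: "integral {0..X} (\<lambda>x. W x * (\<psi> x - c)) = 0"
      using W1[OF s] by simp
    have Wi: "W integrable_on {0..X}" "(\<lambda>x. W x * \<psi> x) integrable_on {0..X}" "\<psi> integrable_on {0..X}"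
      using Wa pci abs_int_continuous_mult[OF continuous_on_subset[OF pc] Wa]
      by (auto simp: abs_int_def mult.commute)
    have "integral {0..X} (\<lambda>x. (W x - m) * \<psi> x) = integral {0..X} (\<lambda>x. W x * \<psi> x) - m * integral {0..X} \<psi>"
      using Wi by (simp add: left_diff_distrib integral_diff integrable_on_mult_right)
    moreover have "integral {0..X} (\<lambda>x. W x * (\<psi> x - c)) = integral {0..X} (\<lambda>x. W x * \<psi> x) - integral {0..X} W * c"
      using Wi by (simp add: right_diff_distrib integral_diff integrable_on_mult_left)
    ultimately show "integral {0..X} (\<lambda>x. (W x - m) * \<psi> x) = 0"
      using 1 X by (simp add: m_def c_def)
  qed
  then obtain N where N: "negligible N" "\<And>x. x \<in> {0..X} - N \<Longrightarrow> u x = U x + m"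
    by (force simp: W_def)
  show ?thesis
  proof (rule that[of "\<lambda>x. U x + m" N])
    show "ac_on a b (\<lambda>x. U x + m) v" for a b using U[of a b] unfolding ac_on_def by simp
  qed (use Up N in auto)
qed

section \<open>Picone's identity and constrained quadratic forms\<close>

lemma ac_on_cong:
  assumes "ac_on a b U v" "\<And>x. x \<in> {a..b} \<Longrightarrow> v x = f x"
  shows "ac_on a b U f"
  unfolding ac_on_def
proof
  have "abs_int a b v \<longleftrightarrow> abs_int a b f"
    using assms(2) by (intro set_integrable_cong) auto
  then show "abs_int a b f" using assms(1) by (simp add: ac_on_def)
  show "\<forall>x\<in>{a..b}. (f has_integral U x - U a) {a..x}"
    using assms by (auto simp: ac_on_def intro: has_integral_eq[of _ v f])
qed

text \<open>The integral of \<open>(v x - c)^2\<close> is nonnegative for the mean slope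
  \<open>c\<close>.\<close>

lemma ac_on_cauchy_schwarz:
  assumes U: "ac_on a b U v" and sq: "(\<lambda>x. (v x)^2) integrable_on {a..b}"
    and st: "a \<le> s" "s < t" "t \<le> b"
  shows "(U t - U s)^2 \<le> (t - s) * integral {s..t} (\<lambda>x. (v x)^2)"
proof -
  define c where "c = (U t - U s) / (t - s)"
  have v: "(v has_integral (U t - U s)) {s..t}" using ac_onD[OF U] st by simp
  have i: "(\<lambda>x. (v x)^2) integrable_on {s..t}" using integrable_subinterval_real[OF sq] st by simp
  have "((\<lambda>x. (v x)^2 - 2 * c * v x + c^2) has_integral
      (integral {s..t} (\<lambda>x. (v x)^2) - 2 * c * (U t - U s) + (t - s) * c^2)) {s..t}"
    using i v st has_integral_const_real[of "c^2" s t]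
    by (intro has_integral_add has_integral_diff has_integral_mult_right) auto
  moreover have "0 \<le> (v x)^2 - 2 * c * v x + c^2" for x
    using zero_le_power2[of "v x - c"] by (simp add: power2_diff algebra_simps)
  ultimately have "0 \<le> integral {s..t} (\<lambda>x. (v x)^2) - 2 * c * (U t - U s) + (t - s) * c^2"
    by (rule has_integral_nonneg)
  also have "\<dots> = integral {s..t} (\<lambda>x. (v x)^2) - (U t - U s)^2 / (t - s)"
  proof -
    have "(t - s) * c^2 = (U t - U s)^2 / (t - s)" "2 * c * (U t - U s) = 2 * ((U t - U s)^2 / (t - s))"
      using st by (simp_all add: c_def power2_eq_square)
    then show ?thesis by simp
  qed
  finally show ?thesis using st by (simp add: field_simps)
qed

text \<open>By Cauchy-Schwarz \<open>(U x)^2\<close> is at most the distance to \<open>e\<close>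
  times an integral of \<open>v^2\<close> that shrinks to 0, whereas \<open>w\<close> vanishes only
  to first order. This removes the boundary terms in Picone's identity, where only square
  integrability of \<open>v\<close> is available.\<close>

lemma ac_on_sq_div_tendsto_0:
  assumes U: "ac_on a b U v" and sq: "(\<lambda>x. (v x)^2) integrable_on {a..b}"
    and e: "e \<in> {a..b}" "U e = 0" "w e = 0"
    and w: "DERIV w e :> w'" "w' \<noteq> 0"
  shows "((\<lambda>x. (U x)^2 / w x) \<longlongrightarrow> 0) (at e within {a..b})"
proof -
  define N where "N = (\<lambda>x. integral {a..x} (\<lambda>x. (v x)^2))"
  have "continuous_on {a..b} N" unfolding N_def by (rule indefinite_integral_continuous_1[OF sq])
  then have "(N \<longlongrightarrow> N e) (at e within {a..b})" using e by (simp add: continuous_on_def)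
  then have N: "((\<lambda>x. \<bar>N x - N e\<bar>) \<longlongrightarrow> 0) (at e within {a..b})"
    by (intro tendsto_rabs_zero LIM_zero)
  have bd: "(U x)^2 / \<bar>x - e\<bar> \<le> \<bar>N x - N e\<bar>" if x: "x \<in> {a..b}" "x \<noteq> e" for x
  proof -
    have *: "(U t - U s)^2 \<le> (t - s) * (N t - N s)" if "a \<le> s" "s < t" "t \<le> b" for s t
    proof -
      have "integral {a..s} (\<lambda>x. (v x)^2) + integral {s..t} (\<lambda>x. (v x)^2) = integral {a..t} (\<lambda>x. (v x)^2)"
        using that integrable_subinterval_real[OF sq, of a t]
        by (intro integral_join) auto
      then have "N t - N s = integral {s..t} (\<lambda>x. (v x)^2)" by (simp add: N_def)
      then show ?thesis using ac_on_cauchy_schwarz[OF U sq that] by simp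
    qed
    show ?thesis
    proof (cases "x < e")
      case True
      with *[of x e] x e have "(U x)^2 / \<bar>x - e\<bar> \<le> N e - N x" by (simp add: field_simps)
      then show ?thesis by linarith
    next
      case False
      with *[of e x] x e have "(U x)^2 / \<bar>x - e\<bar> \<le> N x - N e" by (simp add: field_simps)
      then show ?thesis by linarith
    qed
  qed
  have 1: "((\<lambda>x. (U x)^2 / (x - e)) \<longlongrightarrow> 0) (at e within {a..b})"
  proof (rule Lim_null_comparison[OF _ N])
    show "\<forall>\<^sub>F x in at e within {a..b}. norm ((U x)^2 / (x - e)) \<le> \<bar>N x - N e\<bar>"
      unfolding eventually_at using bd by (intro exI[of _ 1]) (auto simp: abs_div)
  qed
  have "((\<lambda>x. (w x - w e) / (x - e)) \<longlongrightarrow> w') (at e within {a..b})"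
    using has_field_derivative_at_within[OF w(1)] by (simp add: has_field_derivative_iff)
  then have "((\<lambda>x. w x / (x - e)) \<longlongrightarrow> w') (at e within {a..b})" by (simp add: e)
  from tendsto_divide[OF 1 this w(2)]
  have "((\<lambda>x. ((U x)^2 / (x - e)) / (w x / (x - e))) \<longlongrightarrow> 0) (at e within {a..b})" by simp
  moreover have "\<forall>\<^sub>F x in at e within {a..b}. ((U x)^2 / (x - e)) / (w x / (x - e)) = (U x)^2 / w x"
    unfolding eventually_at by (intro exI[of _ 1]) auto
  ultimately show ?thesis by (rule Lim_transform_eventually)
qed

text \<open>\<open>w\<close> is a Dirichlet solution of (\<rho> w')' + m w = 0, positive inside. The
  flux \<open>z\<close> is a parameter of its own, so that differentiability is asked of the flux
  and continuity alone of the weight \<rho>.\<close>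

locale picone =
  fixes a b :: real and w w' z \<rho> m :: "real \<Rightarrow> real"
  assumes ab: "a < b"
    and dw: "\<And>x. x \<in> {a..b} \<Longrightarrow> DERIV w x :> w' x"
    and dz: "\<And>x. x \<in> {a..b} \<Longrightarrow> DERIV z x :> - m x * w x"
    and z: "\<And>x. x \<in> {a..b} \<Longrightarrow> z x = \<rho> x * w' x"
    and wpos: "\<And>x. a < x \<Longrightarrow> x < b \<Longrightarrow> w x > 0"
    and wend: "w a = 0" "w b = 0" "w' a \<noteq> 0" "w' b \<noteq> 0"
    and \<rho>pos: "\<And>x. x \<in> {a..b} \<Longrightarrow> \<rho> x > 0"
    and \<rho>cont: "continuous_on {a..b} \<rho>" and mcont: "continuous_on {a..b} m"
begin

lemma cont: "continuous_on {a..b} w" "continuous_on {a..b} z" "continuous_on {a..b} w'"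
proof -
  show 1: "continuous_on {a..b} w" "continuous_on {a..b} z"
    using dw dz DERIV_isCont by (blast intro: continuous_at_imp_continuous_on)+
  have "continuous_on {a..b} (\<lambda>x. z x / \<rho> x)"
    using 1 \<rho>cont \<rho>pos by (intro continuous_intros) force+
  then show "continuous_on {a..b} w'"
    by (rule continuous_on_eq) (use z \<rho>pos in force)
qed

text \<open>Picone's identity: \<rho> v^2 - m U^2 is the sum of the square \<rho> (v - (w'/w) U)^2
  and the derivative of U^2 z / w. It is integrated over intervals exhausting the open interval; the
  boundary terms tend to 0 and the squares only grow with the interval.\<close>

lemma remainder_le:
  assumes U: "ac_on a b U v" "U a = 0" "U b = 0" and sq: "abs_int a b (\<lambda>x. (v x)^2)"
    and cd: "a < c" "c \<le> d" "d < b"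
  shows "(\<lambda>x. \<rho> x * (v x - w' x / w x * U x)^2) integrable_on {c..d}"
    and "integral {c..d} (\<lambda>x. \<rho> x * (v x - w' x / w x * U x)^2) \<le> integral {a..b} (\<lambda>x. \<rho> x * (v x)^2 - m x * (U x)^2)"
proof -
  define J where "J = (\<lambda>x. \<rho> x * (v x)^2 - m x * (U x)^2)"
  define R where "R = (\<lambda>x. \<rho> x * (v x - w' x / w x * U x)^2)"
  define B where "B = (\<lambda>x. (U x)^2 / w x * z x)"
  note Uc = ac_on_continuous[OF U(1)]
  have J: "J integrable_on {a..b}"
  proof -
    have "(\<lambda>x. \<rho> x * (v x)^2) integrable_on {a..b}"
      using abs_int_continuous_mult[OF \<rho>cont sq] by (simp add: abs_int_def)
    moreover have "(\<lambda>x. m x * (U x)^2) integrable_on {a..b}"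
      using Uc mcont by (intro integrable_continuous_real continuous_intros)
    ultimately show ?thesis unfolding J_def by (rule integrable_diff)
  qed
  define Jf where "Jf = (\<lambda>x. integral {a..x} J)"
  have Jc: "continuous_on {a..b} Jf" unfolding Jf_def by (rule indefinite_integral_continuous_1[OF J])
  have R: "(R has_integral (Jf d - Jf c - (B d - B c))) {c..d}" if cd: "a < c" "c \<le> d" "d < b" for c d
  proof -
    define g where "g = (\<lambda>x. z x / w x)"
    define g' where "g' = (\<lambda>x. - m x - z x * w' x / (w x)^2)"
    have w0: "w x > 0" if "x \<in> {c..d}" for x using wpos that cd by auto
    have sub: "{c..d} \<subseteq> {a..b}" using cd by auto
    have "ac_on c d g g'"
    proof (rule ac_onI_C1)
      fix x assume x: "x \<in> {c..d}"
      have "DERIV g x :> ((- m x * w x) * w x - z x * w' x) / (w x * w x)"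
        unfolding g_def using x cd w0[OF x] by (intro DERIV_divide dz dw) auto
      also have "((- m x * w x) * w x - z x * w' x) / (w x * w x) = g' x"
        using w0[OF x] by (simp add: g'_def field_simps power2_eq_square)
      finally show "(g has_real_derivative g' x) (at x within {c..d})" by (rule has_field_derivative_at_within)
    next
      show "continuous_on {c..d} g'"
        unfolding g'_def using w0 continuous_on_subset[OF mcont sub]
           continuous_on_subset[OF cont(1) sub] continuous_on_subset[OF cont(2) sub] continuous_on_subset[OF cont(3) sub]
        by (intro continuous_intros) force+
    qed
    moreover have Us: "ac_on c d U v" using U(1) cd by (intro ac_on_subinterval[OF U(1)]) auto
    ultimately have "((\<lambda>x. (v x * U x + U x * v x) * g x + (U x * U x) * g' x) has_integral
        (U d * U d) * g d - (U c * U c) * g c) {c..d}"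
      by (intro ac_on_mult_aux ac_on_mult cd)
    moreover have "integral {a..c} J + integral {c..d} J = integral {a..d} J"
      using cd integrable_subinterval_real[OF J, of a d]
      by (intro integral_join) auto
    then have "(J has_integral (Jf d - Jf c)) {c..d}"
      using integrable_subinterval_real[OF J, of c d] cd unfolding Jf_def
      by (metis add_diff_cancel_left' integrable_integral sub)
    ultimately have "((\<lambda>x. J x - ((v x * U x + U x * v x) * g x + (U x * U x) * g' x)) has_integral
       ((Jf d - Jf c) - ((U d * U d) * g d - (U c * U c) * g c))) {c..d}"
      by (intro has_integral_diff)
    then have "((\<lambda>x. J x - ((v x * U x + U x * v x) * g x + (U x * U x) * g' x)) has_integral
       ((Jf d - Jf c) - (B d - B c))) {c..d}"
      by (simp add: B_def g_def power2_eq_square)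
    then show ?thesis
    proof (rule has_integral_eq[rotated])
      fix x assume x: "x \<in> {c..d}"
      have zx: "z x = \<rho> x * w' x" using z x sub by auto
      show "J x - ((v x * U x + U x * v x) * g x + (U x * U x) * g' x) = R x"
        using w0[OF x] unfolding J_def R_def g_def g'_def zx
        by (simp add: field_simps power2_eq_square)
    qed
  qed
  from R[OF cd] show "R integrable_on {c..d}" by blast
  have Rnn: "R x \<ge> 0" if "x \<in> {a..b}" for x using \<rho>pos[OF that] by (simp add: R_def)
  \<comment> \<open>\<open>Suc n\<close> makes the sequences start at \<open>c\<close> and
    \<open>d\<close>, so every interval of the exhaustion contains {c..d}.\<close>
  define cn where "cn = (\<lambda>n. a + (c - a) / real (Suc n))"
  define dn where "dn = (\<lambda>n. b - (b - d) / real (Suc n))"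
  have cn: "a < cn n" "cn n \<le> c" for n
    using cd mult_left_mono[of 1 "1 + real n" "c - a"] by (auto simp: cn_def field_simps add_pos_pos)
  have dn: "d \<le> dn n" "dn n < b" for n
    using cd mult_left_mono[of 1 "1 + real n" "b - d"] by (auto simp: dn_def field_simps add_pos_pos)
  have cl: "filterlim cn (at a within {a..b}) sequentially"
  proof -
    have "cn \<longlonglongrightarrow> a" unfolding cn_def
      using tendsto_add[OF tendsto_const[of a] lim_const_over_n[of "c - a", THEN LIMSEQ_Suc]] by simp
    then show ?thesis using cn cd by (auto simp: filterlim_at intro!: always_eventually) (smt (verit))+
  qed
  have dl: "filterlim dn (at b within {a..b}) sequentially"
  proof -
    have "dn \<longlonglongrightarrow> b" unfolding dn_def
      using tendsto_diff[OF tendsto_const[of b] lim_const_over_n[of "b - d", THEN LIMSEQ_Suc]] by simp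
    then show ?thesis using dn cd by (auto simp: filterlim_at intro!: always_eventually) (smt (verit))+
  qed
  have Bl: "(B \<longlongrightarrow> 0) (at e within {a..b})" if "e = a \<or> e = b" for e
  proof -
    have "((\<lambda>x. (U x)^2 / w x) \<longlongrightarrow> 0) (at e within {a..b})"
      using ac_on_sq_div_tendsto_0[OF U(1) _ _ _ _ dw[of e]] sq U wend that ab
      by (auto simp: abs_int_def)
    moreover have "(z \<longlongrightarrow> z e) (at e within {a..b})" using cont(2) that ab by (auto simp: continuous_on_def)
    ultimately show ?thesis unfolding B_def using tendsto_mult by fastforce
  qed
  have Jl: "(Jf \<longlongrightarrow> Jf e) (at e within {a..b})" if "e = a \<or> e = b" for e
    using Jc that ab by (auto simp: continuous_on_def)
  have "(\<lambda>n. Jf (dn n) - Jf (cn n) - (B (dn n) - B (cn n))) \<longlonglongrightarrow> Jf b - Jf a - (0 - 0)"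
    by (intro tendsto_diff filterlim_compose[OF Jl cl] filterlim_compose[OF Jl dl]
        filterlim_compose[OF Bl cl] filterlim_compose[OF Bl dl]) auto
  moreover have "integral {c..d} R \<le> Jf (dn n) - Jf (cn n) - (B (dn n) - B (cn n))" for n
  proof -
    have "cn n \<le> dn n" using cn[of n] dn[of n] cd by linarith
    note Rn = R[OF cn(1) this dn(2)]
    have "integral {c..d} R \<le> integral {cn n..dn n} R"
    proof (rule integral_subset_le)
      show "{c..d} \<subseteq> {cn n..dn n}" using cn[of n] dn[of n] by auto
      show "R integrable_on {c..d}" using R[OF cd] by blast
      show "R integrable_on {cn n..dn n}" using Rn by blast
      show "\<forall>x\<in>{cn n..dn n}. 0 \<le> R x" using cn[of n] dn[of n] by (intro ballI Rnn) auto
    qed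
    then show ?thesis using Rn by (simp add: integral_unique)
  qed
  ultimately have "integral {c..d} R \<le> Jf b - Jf a - (0 - 0)" by (intro LIMSEQ_le_const) auto
  then show "integral {c..d} R \<le> integral {a..b} (\<lambda>x. \<rho> x * (v x)^2 - m x * (U x)^2)"
    by (simp add: Jf_def J_def)
qed

text \<open>The inequality \<open>remainder_le\<close> on a one-point interval, where its left side
  is 0.\<close>

lemma form_nonneg:
  assumes U: "ac_on a b U v" "U a = 0" "U b = 0" and sq: "abs_int a b (\<lambda>x. (v x)^2)"
  shows "integral {a..b} (\<lambda>x. \<rho> x * (v x)^2 - m x * (U x)^2) \<ge> 0"
  using remainder_le(2)[OF U sq, of "(a+b)/2" "(a+b)/2"] ab by simp

text \<open>In the equality case the square in Picone's identity has integral zero. It is a positive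
  weight times the square of the density of U / w, so Cauchy-Schwarz makes U / w constant between
  any two interior points.\<close>

lemma form_zero:
  assumes U: "ac_on a b U v" "U a = 0" "U b = 0" and sq: "abs_int a b (\<lambda>x. (v x)^2)"
    and le: "integral {a..b} (\<lambda>x. \<rho> x * (v x)^2 - m x * (U x)^2) \<le> 0"
  shows "\<exists>C. \<forall>x\<in>{a..b}. U x = C * w x"
proof -
  have eq: "U d / w d = U c / w c" if cd: "a < c" "c < d" "d < b" for c d
  proof -
    have sub: "{c..d} \<subseteq> {a..b}" using cd by auto
    have w0: "w x > 0" if "x \<in> {c..d}" for x using wpos that cd by auto
    define q where "q = (\<lambda>x. v x - w' x / w x * U x)"
    define g where "g = (\<lambda>x. 1 / w x)"
    define g' where "g' = (\<lambda>x. - w' x / (w x)^2)"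
    have cg: "continuous_on {c..d} g" unfolding g_def using w0 continuous_on_subset[OF cont(1) sub]
      by (intro continuous_intros) force+
    have "ac_on c d g g'"
    proof (rule ac_onI_C1)
      fix x assume x: "x \<in> {c..d}"
      show "(g has_real_derivative g' x) (at x within {c..d})"
        unfolding g_def g'_def using w0[OF x] dw[of x] x sub
        by (auto intro!: derivative_eq_intros has_field_derivative_at_within[OF dw] simp: power2_eq_square)
    next
      show "continuous_on {c..d} g'"
        unfolding g'_def using w0 continuous_on_subset[OF cont(1) sub] continuous_on_subset[OF cont(3) sub]
        by (intro continuous_intros) force+
    qed
    moreover have Us: "ac_on c d U v" using U(1) cd by (intro ac_on_subinterval[OF U(1)]) auto
    ultimately have "ac_on c d (\<lambda>x. U x * g x) (\<lambda>x. v x * g x + U x * g' x)" by (intro ac_on_mult)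
    then have ac: "ac_on c d (\<lambda>x. U x * g x) (\<lambda>x. q x * g x)"
    proof (rule ac_on_cong)
      show "v x * g x + U x * g' x = q x * g x" if "x \<in> {c..d}" for x
      using w0[OF that] by (simp add: g_def g'_def q_def field_simps power2_eq_square)
    qed
    have q2: "(\<lambda>x. \<rho> x * (q x)^2) integrable_on {c..d}"
      and q2': "integral {c..d} (\<lambda>x. \<rho> x * (q x)^2) \<le> 0"
      using remainder_le[OF U sq, of c d] cd le unfolding q_def by auto
    have "abs_int c d (\<lambda>x. \<rho> x * (q x)^2)"
      using q2 \<rho>pos sub by (intro nonnegative_absolutely_integrable_1) (auto simp: less_imp_le subset_iff)
    moreover have gc: "continuous_on {c..d} (\<lambda>x. (g x)^2 / \<rho> x)"
    proof (intro continuous_intros cg continuous_on_subset[OF \<rho>cont sub] ballI)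
      show "\<rho> x \<noteq> 0" if "x \<in> {c..d}" for x using \<rho>pos[of x] that sub by auto
    qed
    ultimately have "abs_int c d (\<lambda>x. ((g x)^2 / \<rho> x) * (\<rho> x * (q x)^2))"
      by (rule abs_int_continuous_mult[rotated])
    then have g2i: "(\<lambda>x. ((g x)^2 / \<rho> x) * (\<rho> x * (q x)^2)) integrable_on {c..d}"
      by (simp add: abs_int_def)
    have e: "((g x)^2 / \<rho> x) * (\<rho> x * (q x)^2) = (q x * g x)^2" if "x \<in> {c..d}" for x
      using \<rho>pos[of x] that sub by (auto simp: power_mult_distrib)
    have i: "(\<lambda>x. (q x * g x)^2) integrable_on {c..d}"
      using integrable_eq[OF g2i e] .
    \<comment> \<open>\<open>M\<close> bounds the ratio between the squared density of U / w and the
      integrand of the Picone remainder, away from the zeros of \<open>w\<close>.\<close>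
    from gc obtain M where M: "\<And>x. x \<in> {c..d} \<Longrightarrow> (g x)^2 / \<rho> x \<le> M"
      using continuous_attains_sup[OF compact_Icc, of c d "\<lambda>x. (g x)^2 / \<rho> x"] cd by fastforce
    have M0: "M \<ge> 0" using M[of c] \<rho>pos[of c] cd by (auto intro: order_trans[of 0 "(g c)^2 / \<rho> c"])
    have "integral {c..d} (\<lambda>x. (q x * g x)^2) \<le> integral {c..d} (\<lambda>x. M * (\<rho> x * (q x)^2))"
    proof (rule integral_le[OF i integrable_on_mult_right[OF q2]])
      fix x assume x: "x \<in> {c..d}"
      then have "0 \<le> \<rho> x * (q x)^2" using \<rho>pos[of x] sub by auto
      then show "(q x * g x)^2 \<le> M * (\<rho> x * (q x)^2)" using M[OF x] e[OF x] mult_right_mono by metis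
    qed
    also have "\<dots> = M * integral {c..d} (\<lambda>x. \<rho> x * (q x)^2)" by simp
    also have "\<dots> \<le> 0" using M0 q2' by (rule mult_nonneg_nonpos)
    finally have "integral {c..d} (\<lambda>x. (q x * g x)^2) \<le> 0" .
    then have "(d - c) * integral {c..d} (\<lambda>x. (q x * g x)^2) \<le> 0" using cd by (simp add: mult_nonneg_nonpos)
    with ac_on_cauchy_schwarz[OF ac i, of c d] cd have "(U d * g d - U c * g c)^2 \<le> 0" by linarith
    then show ?thesis by (simp add: g_def)
  qed
  define x0 where "x0 = (a + b) / 2"
  have x0: "a < x0" "x0 < b" using ab by (auto simp: x0_def)
  have "U x = U x0 / w x0 * w x" if x: "x \<in> {a..b}" for x
  proof (cases "x = a \<or> x = b")
    case True then show ?thesis using wend U by auto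
  next
    case False
    then have "a < x" "x < b" using x by auto
    then have "U x / w x = U x0 / w x0"
      using eq[of x x0] eq[of x0 x] x0 by (cases x x0 rule: linorder_cases) auto
    then show ?thesis using wpos[OF \<open>a < x\<close> \<open>x < b\<close>] by (simp add: field_simps)
  qed
  then show ?thesis by blast
qed

end

text \<open>Primitives of functions orthogonal to \<open>V\<close> satisfy Dirichlet conditions; this trades the
  second Neumann eigenvalue for a first Dirichlet eigenvalue, which Picone's identity controls.\<close>

lemma weighted_neumann:
  assumes P: "picone a b w w' z (\<lambda>x. 1 / V x) (\<lambda>x. 1 + r x)"
    and V: "continuous_on {a..b} V" "\<And>x. x \<in> {a..b} \<Longrightarrow> V x > 0"
    and r: "continuous_on {a..b} r" "\<And>x. x \<in> {a..b} \<Longrightarrow> r x \<ge> 0" "\<And>x. a < x \<Longrightarrow> x < b \<Longrightarrow> r x > 0"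
    and y: "ac_on a b y v" "abs_int a b (\<lambda>x. (v x)^2)"
    and V0: "integral {a..b} (\<lambda>x. V x * y x) = 0"
    and le: "integral {a..b} (\<lambda>x. (v x)^2 - V x * (y x)^2) \<le> 0"
    and x: "x \<in> {a..b}"
  shows "y x = 0"
proof -
  interpret picone a b w w' z "\<lambda>x. 1 / V x" "\<lambda>x. 1 + r x" by (rule P)
  note yc = ac_on_continuous[OF y(1)]
  have cV: "continuous_on {a..b} (\<lambda>x. V x * y x)" using V yc by (intro continuous_intros)
  define f where "f = (\<lambda>x. integral {a..x} (\<lambda>x. V x * y x))"
  have f: "ac_on a b f (\<lambda>x. V x * y x)"
  proof (rule ac_onI_C1[OF _ cV])
    show "(f has_real_derivative V x * y x) (at x within {a..b})" if "x \<in> {a..b}" for x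
      using integral_has_real_derivative[OF cV that] by (simp add: f_def)
  qed
  have f0: "f a = 0" "f b = 0" using V0 by (auto simp: f_def)
  note fc = ac_on_continuous[OF f]
  have int: "g integrable_on {a..b}" if "continuous_on {a..b} g" for g :: "real \<Rightarrow> real"
    using that by (rule integrable_continuous_real)
  define S where "S = integral {a..b} (\<lambda>x. V x * (y x)^2)"
  define F where "F = integral {a..b} (\<lambda>x. (f x)^2)"
  define Rf where "Rf = integral {a..b} (\<lambda>x. r x * (f x)^2)"
  define T where "T = integral {a..b} (\<lambda>x. (v x)^2)"
  have iv: "(\<lambda>x. (v x)^2) integrable_on {a..b}" using y(2) by (simp add: abs_int_def)
  \<comment> \<open>Picone for the primitive \<open>f\<close> of V y: the weight 1 / V turns the
    square of its density into V y^2.\<close>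
  have 1: "F + Rf \<le> S"
  proof -
    have "0 \<le> integral {a..b} (\<lambda>x. 1 / V x * (V x * y x)^2 - (1 + r x) * (f x)^2)"
      by (intro form_nonneg f f0 absolutely_integrable_continuous_real continuous_intros cV)
    also have "\<dots> = integral {a..b} (\<lambda>x. V x * (y x)^2 - ((f x)^2 + r x * (f x)^2))"
      using V(2) by (intro Henstock_Kurzweil_Integration.integral_cong) (force simp: power2_eq_square algebra_simps)
    also have "\<dots> = S - (F + Rf)"
      unfolding S_def F_def Rf_def using V(1) yc fc r(1)
      by (intro integral_unique has_integral_diff has_integral_add integrable_integral int continuous_intros)
    finally show ?thesis by simp
  qed
  have "((\<lambda>x. (V x * y x) * y x + f x * v x) has_integral 0) {a..b}"
    using ac_on_mult_aux[OF f y(1)] f0 ab by simp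
  moreover have "((\<lambda>x. V x * (y x)^2) has_integral S) {a..b}"
    unfolding S_def using V(1) yc by (intro integrable_integral int continuous_intros)
  ultimately have "((\<lambda>x. ((V x * y x) * y x + f x * v x) - V x * (y x)^2) has_integral 0 - S) {a..b}"
    by (rule has_integral_diff)
  then have fv: "((\<lambda>x. f x * v x) has_integral - S) {a..b}"
    by (simp add: power2_eq_square algebra_simps)
  have "((\<lambda>x. (f x)^2 + 2 * (f x * v x) + (v x)^2) has_integral (F + 2 * (- S) + T)) {a..b}"
    unfolding F_def T_def using fc
    by (intro has_integral_add has_integral_mult_right fv integrable_integral iv int continuous_intros)
  moreover have "0 \<le> (f x)^2 + 2 * (f x * v x) + (v x)^2" for x
    using zero_le_power2[of "f x + v x"] by (simp add: power2_sum algebra_simps)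
  ultimately have 2: "0 \<le> F + 2 * (- S) + T" by (rule has_integral_nonneg)
  have 3: "T \<le> S"
    using le unfolding T_def S_def by (subst (asm) integral_diff) (use V(1) yc iv in \<open>auto intro!: int continuous_intros\<close>)
  have "Rf \<ge> 0" unfolding Rf_def using r fc by (intro integral_nonneg int continuous_intros) auto
  \<comment> \<open>Facts 2 and 3 give 2 S <= F + T <= F + S, hence S <= F, while fact 1 gives F +
    Rf <= S. The slack \<open>Rf\<close> must vanish, and since \<open>r\<close> is positive inside,
    so must \<open>f\<close>.\<close>
  with 1 2 3 have Rf: "Rf = 0" and SF: "S \<le> F" by linarith+
  have "r x * (f x)^2 = 0" if "x \<in> {a..b}" for x
    using Rf unfolding Rf_def using ab r fc that
    by (subst (asm) integral_eq_0_iff) (auto intro!: continuous_intros)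
  then have fz: "f x = 0" if "a < x" "x < b" for x using r(3)[OF that] \<open>\<And>x. x \<in> {a..b} \<Longrightarrow> r x * (f x)^2 = 0\<close>[of x] that by auto
  then have fz': "f x = 0" if "x \<in> {a..b}" for x using f0 that by (cases "x = a \<or> x = b") auto
  then have "F = integral {a..b} (\<lambda>x. 0)"
    unfolding F_def by (intro Henstock_Kurzweil_Integration.integral_cong) auto
  then have "S \<le> 0" using SF by simp
  moreover have "S \<ge> 0" unfolding S_def using V yc by (intro integral_nonneg int continuous_intros) (auto simp: less_imp_le)
  ultimately have "S = 0" by simp
  then have "V x * (y x)^2 = 0"
    unfolding S_def using ab V yc x
    by (subst (asm) integral_eq_0_iff) (auto intro!: continuous_intros simp: less_imp_le)
  then show ?thesis using V(2)[OF x] by simp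
qed

text \<open>The form at \<eta> equals c times the integral of \<eta>, hence is negative, and the
  cross term with a function of mean zero vanishes. So \<open>u + t * \<eta>\<close> keeps a
  nonpositive form for every \<open>t\<close>. Choosing \<open>t\<close> to kill the V-weighted mean
  allows \<open>weighted_neumann\<close> to give \<open>u = - t * \<eta>\<close>, and comparing
  ordinary means forces t = 0.\<close>

lemma constrained_definite:
  assumes P: "picone a b w w' z (\<lambda>x. 1 / V x) (\<lambda>x. 1 + r x)"
    and V: "continuous_on {a..b} V" "\<And>x. x \<in> {a..b} \<Longrightarrow> V x > 0"
    and r: "continuous_on {a..b} r" "\<And>x. x \<in> {a..b} \<Longrightarrow> r x \<ge> 0" "\<And>x. a < x \<Longrightarrow> x < b \<Longrightarrow> r x > 0"
    and \<eta>: "\<And>x. x \<in> {a..b} \<Longrightarrow> DERIV \<eta> x :> \<eta>' x"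
      "\<And>x. x \<in> {a..b} \<Longrightarrow> DERIV \<eta>' x :> - V x * \<eta> x - c" "\<eta>' a = 0" "\<eta>' b = 0"
    and neg: "c * integral {a..b} \<eta> < 0"
    and u: "ac_on a b u v" "abs_int a b (\<lambda>x. (v x)^2)"
    and u0: "integral {a..b} u = 0"
    and le: "integral {a..b} (\<lambda>x. (v x)^2 - V x * (u x)^2) \<le> 0"
    and x: "x \<in> {a..b}"
  shows "u x = 0"
proof -
  have ab: "a < b" using P by (rule picone.ab)
  have int: "g integrable_on {a..b}" if "continuous_on {a..b} g" for g :: "real \<Rightarrow> real"
    using that by (rule integrable_continuous_real)
  have \<eta>c: "continuous_on {a..b} \<eta>" "continuous_on {a..b} \<eta>'"
    using \<eta>(1,2) DERIV_isCont by (blast intro: continuous_at_imp_continuous_on)+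
  have a\<eta>: "ac_on a b \<eta> \<eta>'"
    using \<eta>(1) \<eta>c by (intro ac_onI_C1) (auto intro: has_field_derivative_at_within)
  have a\<eta>': "ac_on a b \<eta>' (\<lambda>x. - V x * \<eta> x - c)"
    using \<eta>(2) \<eta>c V(1) by (intro ac_onI_C1 continuous_intros) (auto intro: has_field_derivative_at_within)
  note uc = ac_on_continuous[OF u(1)]
  have iv: "(\<lambda>x. (v x)^2) integrable_on {a..b}" using u(2) by (simp add: abs_int_def)
  text \<open>\<open>\<eta>\<close> is orthogonal, for the quadratic form, to functions of mean zero.\<close>
  have orth: "((\<lambda>x. g' x * \<eta>' x - V x * (g x * \<eta> x)) has_integral c * integral {a..b} g) {a..b}"
    if g: "ac_on a b g g'" for g g'
  proof -
    note gc = ac_on_continuous[OF g]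
    have "((\<lambda>x. g' x * \<eta>' x + g x * (- V x * \<eta> x - c)) has_integral 0) {a..b}"
      using ac_on_mult_aux[OF g a\<eta>'] ab \<eta> by simp
    moreover have "((\<lambda>x. c * g x) has_integral c * integral {a..b} g) {a..b}"
      by (intro has_integral_mult_right integrable_integral int gc)
    ultimately have "((\<lambda>x. (g' x * \<eta>' x + g x * (- V x * \<eta> x - c)) + c * g x) has_integral 0 + c * integral {a..b} g) {a..b}"
      by (rule has_integral_add)
    then show ?thesis by (simp add: algebra_simps)
  qed
  \<comment> \<open>Integrating the equation of \<eta> between its Neumann ends evaluates this mean
    as -(b - a) c.\<close>
  have V\<eta>: "integral {a..b} (\<lambda>x. V x * \<eta> x) \<noteq> 0"
  proof -
    have "((\<lambda>x. - (V x * \<eta> x) - c) has_integral 0) {a..b}"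
      using ac_onD[OF a\<eta>', of a b] \<eta> ab by simp
    moreover have "((\<lambda>x. - (V x * \<eta> x) - c) has_integral (- integral {a..b} (\<lambda>x. V x * \<eta> x) - (b - a) * c)) {a..b}"
      using V(1) \<eta>c ab has_integral_const_real[of c a b]
      by (intro has_integral_diff has_integral_neg integrable_integral int continuous_intros) auto
    ultimately have "0 = - integral {a..b} (\<lambda>x. V x * \<eta> x) - (b - a) * c"
      by (rule has_integral_unique)
    moreover have "(b - a) * c \<noteq> 0" using neg ab by auto
    ultimately show ?thesis by linarith
  qed
  define t where "t = - integral {a..b} (\<lambda>x. V x * u x) / integral {a..b} (\<lambda>x. V x * \<eta> x)"
  define y where "y = (\<lambda>x. u x + t * \<eta> x)"
  define y' where "y' = (\<lambda>x. v x + t * \<eta>' x)"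
  have y: "ac_on a b y y'" unfolding y_def y'_def by (intro ac_on_add ac_on_cmul u a\<eta>)
  have y2: "abs_int a b (\<lambda>x. (y' x)^2)"
    unfolding y'_def using \<eta>c
    by (intro abs_int_square_add[OF ac_on_abs[OF u(1)] _ u(2)]
        absolutely_integrable_continuous_real continuous_intros)
  have y0: "integral {a..b} (\<lambda>x. V x * y x) = 0"
  proof -
    have "((\<lambda>x. V x * u x + t * (V x * \<eta> x)) has_integral
        (integral {a..b} (\<lambda>x. V x * u x) + t * integral {a..b} (\<lambda>x. V x * \<eta> x))) {a..b}"
      using V(1) \<eta>c uc by (intro has_integral_add has_integral_mult_right integrable_integral int continuous_intros)
    then show ?thesis using V\<eta> by (simp add: integral_unique t_def y_def algebra_simps)
  qed
  have "((\<lambda>x. ((v x)^2 - V x * (u x)^2) + 2 * t * (v x * \<eta>' x - V x * (u x * \<eta> x)) + t^2 * (\<eta>' x * \<eta>' x - V x * (\<eta> x * \<eta> x))) has_integral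
     (integral {a..b} (\<lambda>x. (v x)^2 - V x * (u x)^2) + 2 * t * (c * integral {a..b} u) + t^2 * (c * integral {a..b} \<eta>))) {a..b}" (is "(_ has_integral ?I) _")
    using V(1) uc
    by (intro has_integral_add has_integral_mult_right orth u a\<eta> integrable_integral integrable_diff[OF iv] int continuous_intros)
  then have "((\<lambda>x. (y' x)^2 - V x * (y x)^2) has_integral
     ?I) {a..b}"
    by (rule has_integral_eq[rotated]) (simp add: y_def y'_def power2_eq_square algebra_simps)
  moreover have "t^2 * (c * integral {a..b} \<eta>) \<le> 0" by (rule mult_nonneg_nonpos[OF zero_le_power2 less_imp_le[OF neg]])
  ultimately have "integral {a..b} (\<lambda>x. (y' x)^2 - V x * (y x)^2) \<le> 0"
    using le u0 by (simp add: integral_unique)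
  then have yz: "y x = 0" if "x \<in> {a..b}" for x
    using weighted_neumann[OF P V r y y2 y0 _ that] by blast
  have "(y has_integral (integral {a..b} u + t * integral {a..b} \<eta>)) {a..b}"
    unfolding y_def using uc \<eta>c by (intro has_integral_add has_integral_mult_right integrable_integral int)
  moreover have "(y has_integral 0) {a..b}" using yz by (intro has_integral_is_0) auto
  ultimately have "integral {a..b} u + t * integral {a..b} \<eta> = 0" by (rule has_integral_unique)
  with u0 have "t * integral {a..b} \<eta> = 0" by simp
  then have "t = 0" using neg by auto
  then show ?thesis using yz[OF x] by (simp add: y_def)
qed

section \<open>The nonlinear oscillator\<close>

text \<open>Integral remainder of a second-order Taylor expansion about 1. The exponent
  \<open>j\<close> counts the factors \<open>t\<close> produced by differentiating in
  \<open>y\<close> under the integral.\<close>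

definition remainder_int :: "nat \<Rightarrow> real \<Rightarrow> real \<Rightarrow> real" where
  "remainder_int j c y = integral {0..1} (\<lambda>t. (1 - t) * t ^ j * (1 + t * (y - 1)) powr c)"

lemma segment_pos:
  fixes y t :: real
  assumes "0 < y" "0 \<le> t" "t \<le> 1" shows "0 < 1 + t * (y - 1)"
proof -
  have "1 + t * (y - 1) = (1 - t) + t * y" by (simp add: algebra_simps)
  also have "\<dots> > 0" using assms by (cases "t = 1") (auto intro: add_pos_nonneg)
  finally show ?thesis .
qed

lemma remainder_int_deriv:
  assumes "y > 0"
  shows "DERIV (remainder_int j c) y :> c * remainder_int (Suc j) (c - 1) y"
proof -
  have "((\<lambda>y. integral (cbox 0 1) (\<lambda>t. (1 - t) * t ^ j * (1 + t * (y - 1)) powr c)) has_real_derivative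
     integral (cbox 0 1) (\<lambda>t. c * ((1 - t) * t ^ Suc j * (1 + t * (y - 1)) powr (c - 1)))) (at y within {0<..})"
  proof (rule leibniz_rule_field_derivative)
    fix x t :: real assume x: "x \<in> {0<..}" and t: "t \<in> cbox 0 1"
    have p: "0 < 1 + t * (x - 1)" using x t by (intro segment_pos) auto
    have "DERIV (\<lambda>x. (1 + t * (x - 1)) powr c) x :> c * (1 + t * (x - 1)) powr (c - 1) * t"
      using p by (auto intro!: derivative_eq_intros simp: powr_diff)
    from DERIV_cmult[OF this, of "(1 - t) * t ^ j"]
    show "((\<lambda>x. (1 - t) * t ^ j * (1 + t * (x - 1)) powr c) has_real_derivative
      c * ((1 - t) * t ^ Suc j * (1 + t * (x - 1)) powr (c - 1))) (at x within {0<..})"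
      by (auto intro: has_field_derivative_at_within simp: mult_ac)
  next
    fix x :: real assume x: "x \<in> {0<..}"
    have "1 + t * (x - 1) \<noteq> 0" if "t \<in> {0..1}" for t using segment_pos[of x t] x that by auto
    then show "(\<lambda>t. (1 - t) * t ^ j * (1 + t * (x - 1)) powr c) integrable_on cbox 0 1"
      by (auto intro!: integrable_continuous_real continuous_intros)
  next
    have "1 + snd p * (fst p - 1) \<noteq> 0" if "p \<in> {0<..} \<times> cbox 0 1" for p :: "real \<times> real"
      using segment_pos[of "fst p" "snd p"] that by auto
    then show "continuous_on ({0<..} \<times> cbox 0 1)
      (\<lambda>(x, t). c * ((1 - t) * t ^ Suc j * (1 + t * (x - 1)) powr (c - 1)))"
      unfolding split_beta by (intro continuous_intros) auto
  qed (use assms in auto)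
  then show ?thesis
    using assms unfolding remainder_int_def[abs_def] by (simp add: at_within_open[of y "{0<..}"])
qed

lemma remainder_int_pos:
  assumes "y > 0" shows "remainder_int 0 c y > 0"
proof -
  let ?f = "\<lambda>t. (1 - t) * (1 + t * (y - 1)) powr c"
  have "1 + t * (y - 1) \<noteq> 0" if "t \<in> {0..1}" for t using segment_pos[of y t] assms that by auto
  then have c: "continuous_on {0..1} ?f" by (intro continuous_intros) auto
  have nn: "?f t \<ge> 0" if "t \<in> {0..1}" for t using that by simp
  have "integral {0..1} ?f \<noteq> 0"
    using integral_eq_0_iff[OF c _ nn] by (auto intro!: bexI[of _ 0])
  moreover have "integral {0..1} ?f \<ge> 0" by (intro integral_nonneg integrable_continuous_real c nn)
  ultimately show ?thesis by (simp add: remainder_int_def)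
qed

text \<open>The potential of the oscillator, with derivative (y^q - 1) / q, normalized to vanish at
  its minimum y = 1.\<close>

definition well :: "real \<Rightarrow> real \<Rightarrow> real" where
  "well q y = (y powr (q + 1) - 1 - (q + 1) * (y - 1)) / (q * (q + 1))"

lemma well_eq_remainder:
  assumes q: "q > 1" and y: "y > 0"
  shows "(y - 1)^2 * remainder_int 0 (q - 1) y = well q y"
proof -
  define z where "z = (\<lambda>t. 1 + t * (y - 1))"
  \<comment> \<open>This antiderivative comes from one integration by parts that removes the factor
    1 - t.\<close>
  define T where "T = (\<lambda>t. (1 - t) * (y - 1) * z t powr q / q + z t powr (q + 1) / (q * (q + 1)))"
  have d: "(T has_real_derivative (y - 1)^2 * ((1 - t) * z t powr (q - 1))) (at t within {0..1})" if t: "t \<in> {0..1}" for t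
  proof -
    have zp: "z t > 0" using segment_pos[OF y] t by (auto simp: z_def)
    have zd: "DERIV z t :> (y - 1)" unfolding z_def by (auto intro!: derivative_eq_intros)
    have p: "DERIV (\<lambda>t. z t powr c) t :> c * z t powr (c - 1) * (y - 1)" for c
      using DERIV_powr[OF zd zp DERIV_const[of c]] zp by (simp add: powr_diff field_simps)
    have "DERIV (\<lambda>t. (1 - t) * (y - 1)) t :> - (y - 1)"
      by (auto intro!: derivative_eq_intros)
    from DERIV_add[OF DERIV_cdivide[OF DERIV_mult[OF this p[of q]], of q] DERIV_cdivide[OF p[of "q + 1"], of "q * (q + 1)"]]
    have "DERIV T t :> (- (y - 1) * z t powr q + q * z t powr (q - 1) * (y - 1) * ((1 - t) * (y - 1))) / q
       + (q + 1) * z t powr (q + 1 - 1) * (y - 1) / (q * (q + 1))" (is "DERIV _ _ :> ?D")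
      unfolding T_def .
    also have "?D = (y - 1)^2 * ((1 - t) * z t powr (q - 1))"
    proof -
      have "(q + 1) * z t powr (q + 1 - 1) * (y - 1) / (q * (q + 1)) = z t powr q * (y - 1) / q"
        using q by simp
      then show ?thesis
        using q by (simp add: add_divide_distrib[symmetric] power2_eq_square) (simp add: field_simps)
    qed
    finally show ?thesis by (rule has_field_derivative_at_within)
  qed
  have "((\<lambda>t. (y - 1)^2 * ((1 - t) * z t powr (q - 1))) has_integral (T 1 - T 0)) {0..1}"
    using d by (intro fundamental_theorem_of_calculus) (auto simp flip: has_real_derivative_iff_has_vector_derivative)
  moreover have "T 1 - T 0 = well q y"
    using q y by (simp add: T_def z_def well_def diff_divide_distrib)
  ultimately show ?thesis
    by (simp add: remainder_int_def z_def integral_unique flip: integral_mult_right)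
qed

text \<open>Intended reading: \<open>G\<close> is the signed root of 2 * well, \<open>K\<close> its
  inverse, and \<open>K1\<close>, \<open>K2\<close> the derivatives of \<open>K\<close>. The last
  assumption is the identity well (K s) = s^2 / 2 differentiated in \<open>s\<close>.
  \<open>G\<close> is described on the branch of the minima \<alpha>, whereas an orbit runs
  \<open>K\<close> through both signs of \<open>s\<close>.\<close>

locale chart =
  fixes q g0 :: real and G G1 K K1 K2 :: "real \<Rightarrow> real"
  assumes q: "q > 1" and g0: "g0 > 0"
    and G: "\<And>\<alpha>. 0 < \<alpha> \<Longrightarrow> \<alpha> < 1 \<Longrightarrow> - g0 < G \<alpha>" "\<And>\<alpha>. 0 < \<alpha> \<Longrightarrow> \<alpha> < 1 \<Longrightarrow> G \<alpha> < 0"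
      "\<And>\<alpha>. 0 < \<alpha> \<Longrightarrow> \<alpha> < 1 \<Longrightarrow> K (G \<alpha>) = \<alpha>"
      "\<And>\<alpha>. 0 < \<alpha> \<Longrightarrow> \<alpha> < 1 \<Longrightarrow> DERIV G \<alpha> :> G1 \<alpha>"
      "\<And>\<alpha>. 0 < \<alpha> \<Longrightarrow> \<alpha> < 1 \<Longrightarrow> G1 \<alpha> > 0"
    and K: "\<And>s. \<bar>s\<bar> < g0 \<Longrightarrow> K s > 0"
      "\<And>s. \<bar>s\<bar> < g0 \<Longrightarrow> DERIV K s :> K1 s"
      "\<And>s. \<bar>s\<bar> < g0 \<Longrightarrow> DERIV K1 s :> K2 s"
      "\<And>s. \<bar>s\<bar> < g0 \<Longrightarrow> isCont K2 s"
      "\<And>s. \<bar>s\<bar> < g0 \<Longrightarrow> K1 s > 0"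
      "\<And>s. \<bar>s\<bar> < g0 \<Longrightarrow> s / K1 s = (K s powr q - 1) / q"

text \<open>Taylor's formula makes the signed root \<open>G\<close> of \<open>2 * well q\<close>, and hence its inverse, twice
  continuously differentiable through the minimum of the well.\<close>

lemma chart_exists:
  assumes q: "q > 1"
  obtains g0 G G1 K K1 K2 where "chart q g0 G G1 K K1 K2"
proof -
  define R0 where "R0 = remainder_int 0 (q - 1)"
  define R1 where "R1 = (\<lambda>y. (q - 1) * remainder_int 1 (q - 2) y)"
  define R2 where "R2 = (\<lambda>y. (q - 1) * ((q - 2) * remainder_int 2 (q - 3) y))"
  have R0d: "DERIV R0 y :> R1 y" if "y > 0" for y
    unfolding R0_def R1_def using remainder_int_deriv[OF that, of 0 "q - 1"] by simp
  have R1d: "DERIV R1 y :> R2 y" if "y > 0" for y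
    unfolding R1_def R2_def using DERIV_cmult[OF remainder_int_deriv[OF that, of 1 "q - 2"], of "q - 1"]
    by (simp add: numeral_2_eq_2)
  have R2c: "isCont R2 y" if "y > 0" for y
    unfolding R2_def using DERIV_isCont[OF remainder_int_deriv[OF that, of 2 "q - 3"]]
    by (intro continuous_intros)
  have R0p: "R0 y > 0" if "y > 0" for y unfolding R0_def using that by (rule remainder_int_pos)
  define S where "S = (\<lambda>y. sqrt (2 * R0 y))"
  define S1 where "S1 = (\<lambda>y. R1 y / S y)"
  define S2 where "S2 = (\<lambda>y. (R2 y * S y - R1 y * S1 y) / (S y * S y))"
  have Sp: "S y > 0" if "y > 0" for y using R0p[OF that] by (simp add: S_def)
  have Sd: "DERIV S y :> S1 y" if "y > 0" for y
    unfolding S_def S1_def using R0p[OF that] by (auto intro!: derivative_eq_intros R0d that simp: field_simps)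
  have S1d: "DERIV S1 y :> S2 y" if "y > 0" for y
    unfolding S1_def[abs_def] S2_def using Sp[OF that]
    by (intro DERIV_divide R1d Sd[unfolded S1_def] that) auto
  have S2c: "isCont S2 y" if "y > 0" for y
    unfolding S2_def using Sp[OF that] R2c[OF that] DERIV_isCont[OF Sd[OF that]] DERIV_isCont[OF S1d[OF that]]
      DERIV_isCont[OF R1d[OF that]] by (intro continuous_intros) auto
  define G where "G = (\<lambda>y. (y - 1) * S y)"
  define G1 where "G1 = (\<lambda>y. S y + (y - 1) * S1 y)"
  define G2 where "G2 = (\<lambda>y. 2 * S1 y + (y - 1) * S2 y)"
  have Gd: "DERIV G y :> G1 y" if "y > 0" for y
    unfolding G_def G1_def by (auto intro!: derivative_eq_intros Sd that)
  have G1d: "DERIV G1 y :> G2 y" if "y > 0" for y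
    unfolding G1_def G2_def by (auto intro!: derivative_eq_intros Sd S1d that)
  have G2c: "isCont G2 y" if "y > 0" for y
    unfolding G2_def using S2c[OF that] DERIV_isCont[OF S1d[OF that]] by (intro continuous_intros)
  have Gsq: "(G y)^2 = 2 * well q y" if "y > 0" for y
    using R0p[OF that] well_eq_remainder[OF q that]
    by (simp add: G_def S_def power_mult_distrib R0_def)
  have welld: "DERIV (well q) y :> (y powr q - 1) / q" if "y > 0" for y
  proof -
    have "DERIV (\<lambda>y. y powr (q + 1)) y :> (q + 1) * y powr ((q + 1) - 1)"
      using that by (rule has_real_derivative_powr)
    moreover have "DERIV (\<lambda>y. (q + 1) * (y - 1)) y :> (q + 1)"
      by (auto intro!: derivative_eq_intros)
    ultimately have "DERIV (well q) y :> ((q + 1) * y powr ((q + 1) - 1) - 0 - (q + 1)) / (q * (q + 1))"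
      unfolding well_def[abs_def] by (intro DERIV_cdivide DERIV_diff DERIV_const)
    then have "DERIV (well q) y :> (((q + 1) * y powr ((q + 1) - 1)) - (q + 1)) / (q * (q + 1))" (is "DERIV _ _ :> ?D")
      by simp
    also have "?D = (y powr q - 1) / q"
      using q by (simp add: divide_simps) (simp add: algebra_simps)
    finally show ?thesis .
  qed
  have GG1: "G y * G1 y = (y powr q - 1) / q" if y: "y > 0" for y
  proof -
    have "DERIV (\<lambda>y. (G y)^2) y :> 2 * G y * G1 y"
      using DERIV_power[OF Gd[OF y], of 2] by (simp add: mult_ac)
    moreover have "DERIV (\<lambda>y. (G y)^2) y :> 2 * ((y powr q - 1) / q)"
    proof (rule has_field_derivative_transform_within)
      show "DERIV (\<lambda>y. 2 * well q y) y :> 2 * ((y powr q - 1) / q)"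
        by (intro DERIV_cmult welld y)
      show "0 < y" "y \<in> UNIV" by (simp_all add: y)
      show "2 * well q x = (G x)^2" if "dist x y < y" for x
        using Gsq[of x] that by (auto simp: dist_real_def abs_if split: if_splits)
    qed
    ultimately have "2 * G y * G1 y = 2 * ((y powr q - 1) / q)" by (rule DERIV_unique)
    then show ?thesis by linarith
  qed
  have Gneg: "G y < 0" if "0 < y" "y < 1" for y using Sp[of y] that by (simp add: G_def mult_neg_pos)
  have Gpos: "G y > 0" if "1 < y" for y using Sp[of y] that by (simp add: G_def)
  \<comment> \<open>Away from 1 the sign is read off from \<open>G * G1\<close>, the derivative of
    the well; at 1 itself this product is 0 and the formula for \<open>G1\<close> decides.\<close>
  have G1p: "G1 y > 0" if y: "y > 0" for y
  proof (cases y "1::real" rule: linorder_cases)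
    case less
    have "y powr q < 1" using y less q powr_less_mono2[of q y 1] by simp
    then have "G y * G1 y < 0" using GG1[OF y] q by (simp add: divide_neg_pos)
    then show ?thesis using Gneg[OF y less] by (simp add: mult_less_0_iff)
  next
    case equal then show ?thesis using Sp[OF y] by (simp add: G1_def)
  next
    case greater
    have "y powr q > 1" using greater q powr_less_mono2[of q 1 y] by simp
    then have "G y * G1 y > 0" using GG1[OF y] q by simp
    then show ?thesis using Gpos[OF greater] by (simp add: zero_less_mult_iff)
  qed
  have mono: "G x < G y" if "0 < x" "x < y" for x y
    using DERIV_pos_imp_increasing[OF that(2), of G] Gd G1p that by (meson less_le_trans)
  have inj: "inj_on G {0<..}"
    by (rule linorder_inj_onI) (auto dest: mono)
  \<comment> \<open>The square of \<open>g0\<close> is twice the value 1 / (q + 1) of the well at y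
    = 0: larger amplitudes would not keep the orbit positive.\<close>
  define g0 where "g0 = sqrt (2 / (q + 1))"
  define K where "K = inv_into {0<..} G"
  have KG: "K (G y) = y" if "y > 0" for y unfolding K_def using inj that by (intro inv_into_f_f) auto
  have onto: "\<exists>y>0. G y = s" if s: "\<bar>s\<bar> < g0" for s
  proof -
    have "s^2 < g0^2" using s g0_def q by (metis abs_ge_zero power2_abs power_strict_mono pos2)
    then have s2: "s^2 / 2 < 1 / (q + 1)" using q by (simp add: g0_def field_simps)
    \<comment> \<open>Near 0 the well is at least 1 / (q + 1) - y / q, and this \<open>y\<close>
      makes that bound at least s^2 / 2. The minimum with 1/2 stays on the left branch, so that G y
      <= s.\<close>
    define y where "y = min (1/2) (q * (1 / (q + 1) - s^2 / 2))"
    have y: "0 < y" "y < 1" using s2 q by (auto simp: y_def)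
    have "y \<le> q * (1 / (q + 1) - s^2 / 2)" by (simp add: y_def)
    then have "y / q \<le> 1 / (q + 1) - s^2 / 2" using q by (simp add: pos_divide_le_eq mult.commute)
    moreover have "1 / (q + 1) - y / q \<le> well q y"
    proof -
      have "0 \<le> y powr (q + 1) / (q * (q + 1))" using q by simp
      also have "\<dots> = well q y - (1 / (q + 1) - y / q)"
        using q by (simp add: well_def divide_simps) (simp add: algebra_simps)
      finally show ?thesis by simp
    qed
    ultimately have "s^2 \<le> (G y)^2" using Gsq[OF y(1)] by simp
    then have "\<bar>s\<bar> \<le> \<bar>G y\<bar>" by (simp add: abs_le_square_iff)
    then have lo: "G y \<le> s" using Gneg[OF y] by linarith
    \<comment> \<open>The point to the right of the minimum at which the well is as high as at 0, so
      that \<open>G Y = g0\<close>.\<close>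
    define Y where "Y = (q + 1) powr (1 / q)"
    have Y: "Y > 1" unfolding Y_def using q by (intro gr_one_powr) auto
    have "Y powr (q + 1) = (q + 1) * Y" unfolding powr_add using q Y by (simp add: Y_def powr_powr)
    then have "well q Y = 1 / (q + 1)"
      using q by (simp add: well_def divide_simps) (simp add: algebra_simps)
    then have "(G Y)^2 = g0^2" using Gsq[of Y] Y q by (simp add: g0_def)
    then have hi: "s \<le> G Y" using Gpos[OF Y] s by (simp add: g0_def power2_eq_iff abs_less_iff)
    have "\<exists>x. y \<le> x \<and> x \<le> Y \<and> G x = s"
      using lo hi y Y DERIV_isCont[OF Gd] by (intro IVT) auto
    then obtain x where "y \<le> x" "G x = s" by blast
    then show ?thesis using y by (intro exI[of _ x]) auto
  qed
  have GK: "G (K s) = s" and Kp: "K s > 0" if "\<bar>s\<bar> < g0" for s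
    using onto[OF that] KG by auto
  have Kc: "isCont K s" if s: "\<bar>s\<bar> < g0" for s
  proof -
    have "isCont K (G (K s))"
    proof (rule isCont_inverse_function2[where f=G and x="K s" and a="K s / 2" and b="2 * K s"])
      show "K s / 2 < K s" "K s < 2 * K s" using Kp[OF s] by auto
      fix z assume "K s / 2 \<le> z"
      then have "z > 0" using Kp[OF s] by simp
      then show "K (G z) = z" "isCont G z" by (rule KG, rule DERIV_isCont[OF Gd])
    qed
    then show ?thesis by (simp add: GK[OF s])
  qed
  define K1 where "K1 = (\<lambda>s. inverse (G1 (K s)))"
  define K2 where "K2 = (\<lambda>s. - (inverse (G1 (K s)) * (G2 (K s) * K1 s) * inverse (G1 (K s))))"
  have Kd: "DERIV K s :> K1 s" if s: "\<bar>s\<bar> < g0" for s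
    unfolding K1_def
  proof (rule DERIV_inverse_function)
    show "DERIV G (K s) :> G1 (K s)" by (intro Gd Kp s)
    show "G1 (K s) \<noteq> 0" using G1p[OF Kp[OF s]] by simp
    show "- g0 < s" "s < g0" using s by auto
    show "G (K y) = y" if "- g0 < y" "y < g0" for y using that by (intro GK) auto
    show "isCont K s" by (rule Kc[OF s])
  qed
  have K1d: "DERIV K1 s :> K2 s" if s: "\<bar>s\<bar> < g0" for s
  proof -
    have "DERIV (\<lambda>s. G1 (K s)) s :> G2 (K s) * K1 s"
      by (rule DERIV_chain2[where f=G1 and g=K]) (intro G1d Kp Kd s)+
    then show ?thesis
      unfolding K1_def[abs_def] K2_def using G1p[OF Kp[OF s]] by (intro DERIV_inverse') (auto simp: K1_def)
  qed
  have K2c: "isCont K2 s" if s: "\<bar>s\<bar> < g0" for s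
  proof -
    have "isCont (\<lambda>s. G1 (K s)) s" "isCont (\<lambda>s. G2 (K s)) s"
      using isCont_o2[OF Kc[OF s] DERIV_isCont[OF G1d[OF Kp[OF s]]]] isCont_o2[OF Kc[OF s] G2c[OF Kp[OF s]]] by auto
    then show ?thesis unfolding K2_def K1_def using G1p[OF Kp[OF s]] by (intro continuous_intros) auto
  qed
  show ?thesis
  proof (rule that[of g0 G G1 K K1 K2], unfold_locales)
    fix \<alpha> :: real assume \<alpha>: "0 < \<alpha>" "\<alpha> < 1"
    show "- g0 < G \<alpha>"
    proof -
      have "\<alpha> powr (q + 1) < \<alpha> powr 1 * (q + 1)"
        unfolding powr_add using \<alpha> q powr_less_mono2[of q \<alpha> 1] by (simp add: mult.commute)
      then have "well q \<alpha> < 1 / (q + 1)"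
        using q \<alpha> by (simp add: well_def divide_simps) (simp add: algebra_simps)
      then have "(G \<alpha>)^2 < g0^2" using Gsq[OF \<alpha>(1)] q by (simp add: g0_def)
      then have "\<bar>G \<alpha>\<bar> < \<bar>g0\<bar>" by (metis abs_le_square_iff not_le)
      then show ?thesis using q by (simp add: g0_def abs_less_iff)
    qed
  next
    fix s assume s: "\<bar>s\<bar> < g0"
    show "s / K1 s = (K s powr q - 1) / q"
      using GG1[OF Kp[OF s]] GK[OF s] by (simp add: K1_def divide_inverse)
  qed (use q Gneg KG Gd G1p Kp Kd K1d K2c in \<open>auto simp: g0_def K1_def\<close>)
qed

section \<open>Primitives on the line and uniqueness for the oscillator equation\<close>

definition prim :: "(real \<Rightarrow> real) \<Rightarrow> real \<Rightarrow> real" where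
  "prim f = (SOME F. F 0 = 0 \<and> (\<forall>x. DERIV F x :> f x))"

lemma prim:
  assumes "continuous_on UNIV f"
  shows "prim f 0 = 0" "DERIV (prim f) x :> f x"
proof -
  obtain F where F: "\<And>x. DERIV F x :> f x"
    using continuous_antiderivative[OF assms] by blast
  have "DERIV (\<lambda>x. F x - F 0) x :> f x" for x
    using DERIV_diff[OF F DERIV_const] by simp
  then have "\<exists>F. F 0 = 0 \<and> (\<forall>x. DERIV F x :> f x)"
    by (intro exI[of _ "\<lambda>x. F x - F 0"]) simp
  from someI_ex[OF this] show "prim f 0 = 0" "DERIV (prim f) x :> f x"
    unfolding prim_def[symmetric] by auto
qed

lemma prim_eq_integral:
  assumes "continuous_on UNIV f" "0 \<le> x" shows "prim f x = integral {0..x} f"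
proof -
  have "(f has_integral (prim f x - prim f 0)) {0..x}"
    using prim[OF assms(1)] assms(2) by (intro fundamental_theorem_real) auto
  then show ?thesis using prim[OF assms(1)] by (simp add: integral_unique)
qed

lemma prim_even_periodic:
  assumes c: "continuous_on UNIV f" and even: "\<And>x. f (- x) = f x" and per: "\<And>x. f (x + 2 * L) = f x"
  shows "prim f (- x) = - prim f x" "prim f (x + 2 * L) = prim f x + 2 * prim f L"
proof -
  note d = prim(2)[OF c]
  have "DERIV (\<lambda>x. prim f (- x) + prim f x) x :> f (- x) * (- 1) + f x" for x
    by (intro DERIV_add DERIV_chain2[OF d] d) (auto intro!: derivative_eq_intros)
  then have "DERIV (\<lambda>x. prim f (- x) + prim f x) x :> 0" for x by (simp add: even)
  from DERIV_isconst_all[OF allI[OF this], of _ 0] have 1: "prim f (- x) + prim f x = 0" for x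
    by (simp add: prim(1)[OF c])
  then show "prim f (- x) = - prim f x" by (metis add_eq_0_iff2)
  have "DERIV (\<lambda>x. prim f (x + 2 * L) - prim f x) x :> f (x + 2 * L) * 1 - f x" for x
    by (intro DERIV_diff DERIV_chain2[OF d] d) (auto intro!: derivative_eq_intros)
  then have "DERIV (\<lambda>x. prim f (x + 2 * L) - prim f x) x :> 0" for x by (simp add: per)
  \<comment> \<open>Evaluating the constant at - L lets oddness express it as 2 * prim f L.\<close>
  from DERIV_isconst_all[OF allI[OF this], of x "- L"] 1[of L]
  show "prim f (x + 2 * L) = prim f x + 2 * prim f L" by simp
qed

text \<open>Gronwall for the squared distance in the phase plane. On {0..t} both solutions stay in a
  compact interval of positive numbers, on which the nonlinearity is Lipschitz.\<close>

lemma ode_unique_forward: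
  fixes k1 k2 p1 p2 :: "real \<Rightarrow> real"
  assumes k: "\<And>x. DERIV k1 x :> p1 x" "\<And>x. DERIV k2 x :> p2 x"
    and p: "\<And>x. DERIV p1 x :> - ((k1 x powr q - 1) / q)"
      "\<And>x. DERIV p2 x :> - ((k2 x powr q - 1) / q)"
    and pos: "\<And>x. k1 x > 0" "\<And>x. k2 x > 0" and q: "q \<noteq> 0"
    and init: "k1 0 = k2 0" "p1 0 = p2 0" and t: "0 \<le> t"
  shows "k1 t = k2 t"
proof -
  have kc: "continuous_on {0..t} k1" "continuous_on {0..t} k2"
    using k DERIV_isCont by (blast intro: continuous_at_imp_continuous_on)+
  define S where "S = k1 ` {0..t} \<union> k2 ` {0..t}"
  have S: "compact S" "S \<noteq> {}"
    unfolding S_def using kc t by (auto intro!: compact_Un compact_continuous_image)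
  obtain m where m: "m \<in> S" "\<forall>y\<in>S. m \<le> y" using compact_attains_inf[OF S] by blast
  obtain M where M: "\<forall>y\<in>S. y \<le> M" using compact_attains_sup[OF S] by blast
  define I where "I = {m..M}"
  have "m > 0" using m(1) pos by (auto simp: S_def)
  then have Ipos: "y > 0" if "y \<in> I" for y using that by (simp add: I_def)
  have I: "k1 x \<in> I" "k2 x \<in> I" if "x \<in> {0..t}" for x
    using m(2) M that by (auto simp: I_def S_def)
  have "continuous_on I (\<lambda>y. \<bar>y powr (q - 1)\<bar>)" using Ipos by (intro continuous_intros) force
  moreover have "compact I" by (simp add: I_def)
  moreover have "I \<noteq> {}" using I t by force
  ultimately obtain y0 where "\<forall>y\<in>I. \<bar>y powr (q - 1)\<bar> \<le> \<bar>y0 powr (q - 1)\<bar>"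
    using continuous_attains_sup[of I "\<lambda>y. \<bar>y powr (q - 1)\<bar>"] by auto
  then obtain L0 where L0: "\<And>y. y \<in> I \<Longrightarrow> \<bar>y powr (q - 1)\<bar> \<le> L0" by blast
  have lip: "\<bar>(u powr q - 1) / q - (v powr q - 1) / q\<bar> \<le> L0 * \<bar>u - v\<bar>" if "u \<in> I" "v \<in> I" for u v
  proof -
    have "norm ((\<lambda>y. (y powr q - 1) / q) u - (\<lambda>y. (y powr q - 1) / q) v) \<le> L0 * norm (u - v)"
    proof (rule field_differentiable_bound[of I _ "\<lambda>y. y powr (q - 1)"])
      show "convex I" by (simp add: I_def)
      show "((\<lambda>y. (y powr q - 1) / q) has_real_derivative y powr (q - 1)) (at y within I)" if "y \<in> I" for y
        using Ipos[OF that] q by (auto intro!: derivative_eq_intros simp: powr_diff field_simps)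
      show "norm (y powr (q - 1)) \<le> L0" if "y \<in> I" for y using L0[OF that] by simp
    qed fact+
    then show ?thesis by simp
  qed
  have L00: "L0 \<ge> 0" by (rule order_trans[OF abs_ge_zero L0[OF I(1)[of 0]]]) (use t in simp)
  define e where "e = (\<lambda>x. (k1 x - k2 x)^2 + (p1 x - p2 x)^2)"
  define e' where "e' = (\<lambda>x. 2 * (k1 x - k2 x) * (p1 x - p2 x) + 2 * (p1 x - p2 x) * (- ((k1 x powr q - 1) / q) - - ((k2 x powr q - 1) / q)))"
  have ed: "DERIV e x :> e' x" for x
  proof -
    have "real 2 * ((p1 x - p2 x) * (k1 x - k2 x) ^ (2 - Suc 0)) +
        real 2 * ((- ((k1 x powr q - 1) / q) - - ((k2 x powr q - 1) / q)) * (p1 x - p2 x) ^ (2 - Suc 0)) = e' x"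
      unfolding e'_def by (simp only: mult_ac) simp
    with DERIV_add[OF DERIV_power[OF DERIV_diff[OF k], of 2 x] DERIV_power[OF DERIV_diff[OF p], of 2 x]]
    show ?thesis unfolding e_def by (simp only:)
  qed
  have e'le: "e' x \<le> (1 + L0) * e x" if x: "x \<in> {0..t}" for x
  proof -
    let ?F = "2 * (p1 x - p2 x) * (- ((k1 x powr q - 1) / q) - - ((k2 x powr q - 1) / q))" and ?d = "\<bar>k1 x - k2 x\<bar>" and ?p = "\<bar>p1 x - p2 x\<bar>"
    have dbl: "2 * u * v \<le> 2 * \<bar>u\<bar> * \<bar>v\<bar>" for u v :: real
    proof -
      have "u * v \<le> \<bar>u\<bar> * \<bar>v\<bar>" using abs_ge_self[of "u * v"] unfolding abs_mult .
      from mult_left_mono[OF this, of 2] show ?thesis by (simp only: mult.assoc)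
    qed
    have s: "2 * ?d * ?p \<le> e x" using sum_squares_bound[of ?d ?p] by (simp add: e_def)
    have "?F
       \<le> 2 * ?p * \<bar>(k1 x powr q - 1) / q - (k2 x powr q - 1) / q\<bar>"
    proof -
      have *: "- v - - w = w - v" "\<bar>v - w\<bar> = \<bar>w - v\<bar>" for v w :: real by auto
      show ?thesis unfolding *(1) *(2)[of "(k1 x powr q - 1) / q"] by (rule dbl)
    qed
    also have "\<dots> \<le> 2 * ?p * (L0 * ?d)" by (intro mult_left_mono lip I x) auto
    also have "\<dots> = L0 * (2 * ?d * ?p)" by simp
    also have "\<dots> \<le> L0 * e x" by (rule mult_left_mono[OF s L00])
    finally have 1: "?F \<le> L0 * e x" .
    have "2 * (k1 x - k2 x) * (p1 x - p2 x) \<le> 2 * ?d * ?p"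
      by (rule dbl)
    with s 1 show ?thesis by (simp add: e'_def algebra_simps)
  qed
  have "e t * exp (- (1 + L0) * t) \<le> e 0 * exp (- (1 + L0) * 0)"
  proof (rule DERIV_nonpos_imp_nonincreasing[OF t])
    fix x assume x: "0 \<le> x" "x \<le> t"
    have "DERIV (\<lambda>x. e x * exp (- (1 + L0) * x)) x :> (e' x - (1 + L0) * e x) * exp (- (1 + L0) * x)"
      by (rule derivative_eq_intros refl ed)+ (simp add: algebra_simps)
    moreover have "(e' x - (1 + L0) * e x) * exp (- (1 + L0) * x) \<le> 0"
      using e'le[of x] x by (intro mult_nonpos_nonneg) auto
    ultimately show "\<exists>y. DERIV (\<lambda>x. e x * exp (- (1 + L0) * x)) x :> y \<and> y \<le> 0" by blast
  qed
  also have "e 0 * exp (- (1 + L0) * 0) = 0" by (simp add: e_def init)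
  finally have "e t \<le> 0" by (simp add: mult_le_0_iff not_le[symmetric] del: not_le)
  then have "(k1 t - k2 t)^2 \<le> 0" using zero_le_power2[of "p1 t - p2 t"] unfolding e_def by linarith
  then show ?thesis by simp
qed

text \<open>Backward uniqueness follows from invariance of the system under reversal of
  \<open>x\<close> together with the sign of the velocity.\<close>

lemma ode_unique:
  fixes k1 k2 p1 p2 :: "real \<Rightarrow> real"
  assumes k: "\<And>x. DERIV k1 x :> p1 x" "\<And>x. DERIV k2 x :> p2 x"
    and p: "\<And>x. DERIV p1 x :> - ((k1 x powr q - 1) / q)"
      "\<And>x. DERIV p2 x :> - ((k2 x powr q - 1) / q)"
    and pos: "\<And>x. k1 x > 0" "\<And>x. k2 x > 0" and q: "q \<noteq> 0"
    and init: "k1 0 = k2 0" "p1 0 = p2 0"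
  shows "k1 = k2"
proof
  fix x
  have r: "DERIV (\<lambda>x. f (- x)) x :> - f' (- x)"
    if "\<And>x. DERIV f x :> f' x" for f f' :: "real \<Rightarrow> real" and x
    using DERIV_chain2[where f=f and g="\<lambda>x. - x", OF that DERIV_minus[OF DERIV_ident]] by simp
  have r': "DERIV (\<lambda>x. - f (- x)) x :> f' (- x)"
    if "\<And>x. DERIV f x :> f' x" for f f' :: "real \<Rightarrow> real" and x
    using DERIV_minus[OF r[OF that]] by simp
  show "k1 x = k2 x"
  proof (cases "0 \<le> x")
    case True then show ?thesis by (rule ode_unique_forward[OF k p pos q init])
  next
    case False
    have "k1 (- (- x)) = k2 (- (- x))"
    proof (rule ode_unique_forward[of "\<lambda>x. k1 (- x)" "\<lambda>x. - p1 (- x)" "\<lambda>x. k2 (- x)" "\<lambda>x. - p2 (- x)" q])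
      show "DERIV (\<lambda>x. k1 (- x)) x :> - p1 (- x)"
        "DERIV (\<lambda>x. k2 (- x)) x :> - p2 (- x)" for x by (intro r k)+
      show "DERIV (\<lambda>x. - p1 (- x)) x :> - ((k1 (- x) powr q - 1) / q)"
        "DERIV (\<lambda>x. - p2 (- x)) x :> - ((k2 (- x) powr q - 1) / q)" for x
        by (rule r'[OF p(1)], rule r'[OF p(2)])
    qed (use pos q init False in auto)
    then show ?thesis by simp
  qed
qed

section \<open>Canonical solutions, their least period and their area\<close>

lemma canonical_solution_derivs:
  assumes "is_canonical_solution q \<alpha> k"
  shows "DERIV k x :> deriv k x" "k x > 0" "k 0 = \<alpha>" "deriv k 0 = 0"
    "DERIV (deriv k) x :> - ((k x powr q - 1) / q)"
proof -
  have s: "smooth_fun k" using assms by (simp add: is_canonical_solution_def)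
  show "DERIV k x :> deriv k x" by (rule smooth_fun_deriv(1)[OF s])
  show "k x > 0" "k 0 = \<alpha>" "deriv k 0 = 0"
    using assms by (auto simp: is_canonical_solution_def positive_periodic_def)
  have "deriv (deriv k) x + (k x powr q - 1) / q = 0"
    using assms by (simp add: is_canonical_solution_def numeral_2_eq_2)
  then have "deriv (deriv k) x = - ((k x powr q - 1) / q)" by linarith
  then show "DERIV (deriv k) x :> - ((k x powr q - 1) / q)"
    using smooth_fun_deriv(1)[OF smooth_fun_deriv(2)[OF s], of x] by simp
qed

lemma k_sol_eqI:
  assumes "q \<noteq> 0" "is_canonical_solution q \<alpha> k" shows "k_sol q \<alpha> = k"
  unfolding k_sol_def
proof (rule the_equality)
  show "k' = k" if "is_canonical_solution q \<alpha> k'" for k'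
    using canonical_solution_derivs[OF that] canonical_solution_derivs[OF assms(2)] assms(1)
    by (intro ode_unique[of k' "deriv k'" k "deriv k" q]) auto
qed fact

lemma is_least_period_unique:
  "is_least_period f S \<Longrightarrow> is_least_period f T \<Longrightarrow> S = T"
  unfolding is_least_period_def by (meson order_antisym)

text \<open>\<open>a\<close> is the chart coordinate of the minimum of the orbit; the coordinate a
  cos t moves from \<open>a\<close> at the minimum to \<open>- a\<close> at the maximum.\<close>

locale oscillator = chart +
  fixes a :: real
  assumes a: "- g0 < a" "a < 0"
begin

lemma s_bound [simp]: "\<bar>a * cos t\<bar> < g0" "\<bar>a\<bar> < g0"
proof -
  show 1: "\<bar>a\<bar> < g0" using a by auto
  have "\<bar>a * cos t\<bar> \<le> \<bar>a\<bar> * 1" unfolding abs_mult by (intro mult_left_mono) auto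
  with 1 show "\<bar>a * cos t\<bar> < g0" by linarith
qed

lemma cont_comp:
  "continuous_on UNIV (\<lambda>t. K (a * cos t))" "continuous_on UNIV (\<lambda>t. K1 (a * cos t))"
  "continuous_on UNIV (\<lambda>t. K2 (a * cos t))"
proof -
  have "isCont (\<lambda>t. f (a * cos t)) t" if "\<And>s. \<bar>s\<bar> < g0 \<Longrightarrow> isCont f s" for f :: "real \<Rightarrow> real" and t
    by (rule isCont_o2[where g=f]) (auto intro!: continuous_intros that)
  then show "continuous_on UNIV (\<lambda>t. K (a * cos t))" "continuous_on UNIV (\<lambda>t. K1 (a * cos t))"
    "continuous_on UNIV (\<lambda>t. K2 (a * cos t))"
    using DERIV_isCont[OF K(2)] DERIV_isCont[OF K(3)] K(4)
    by (auto simp: continuous_on_eq_continuous_at)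
qed

text \<open>With \<open>k = K (a cos t)\<close> and \<open>k' = - a sin t\<close> the orbit becomes a circle, run through at the speed given by
  \<open>dx = K1 (a cos t) dt\<close>; this makes period and area differentiable in \<open>a\<close>.\<close>

definition "tm = prim (\<lambda>t. K1 (a * cos t))"
text \<open>The integrand is the derivative in \<open>a\<close> of that of \<open>tm\<close>, so
  \<open>\<xi> pi\<close> is the rate of change of the half period; \<open>ar'\<close> is related to
  \<open>ar\<close> in the same way.\<close>

definition "\<xi> = prim (\<lambda>t. cos t * K2 (a * cos t))"
definition "ar = prim (\<lambda>t. K (a * cos t) * K1 (a * cos t))"
definition "ar' = prim (\<lambda>t. cos t * (K1 (a * cos t) * K1 (a * cos t) + K (a * cos t) * K2 (a * cos t)))"

lemma conts:
  "continuous_on UNIV (\<lambda>t. cos t * K2 (a * cos t))"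
  "continuous_on UNIV (\<lambda>t. K (a * cos t) * K1 (a * cos t))"
  "continuous_on UNIV (\<lambda>t. cos t * (K1 (a * cos t) * K1 (a * cos t) + K (a * cos t) * K2 (a * cos t)))"
  by (intro continuous_intros cont_comp)+

lemmas tm_d = prim(2)[OF cont_comp(2), folded tm_def]
lemmas \<xi>_d = prim(2)[OF conts(1), folded \<xi>_def]
lemmas ar_d = prim(2)[OF conts(2), folded ar_def]
lemmas ar'_d = prim(2)[OF conts(3), folded ar'_def]

lemma at_0 [simp]: "tm 0 = 0" "\<xi> 0 = 0" "ar 0 = 0" "ar' 0 = 0"
  using prim(1) cont_comp(2) conts by (auto simp: tm_def \<xi>_def ar_def ar'_def)

lemma tm_sym: "tm (- t) = - tm t" "tm (t + 2 * pi) = tm t + 2 * tm pi"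
  unfolding tm_def using prim_even_periodic[OF cont_comp(2), of pi] by auto

lemma ar_sym: "ar (t + 2 * pi) = ar t + 2 * ar pi"
  unfolding ar_def using prim_even_periodic[OF conts(2), of pi] by auto

lemma tm_mono: "s < t \<Longrightarrow> tm s < tm t"
  using DERIV_pos_imp_increasing[of s t tm] tm_d K(5) s_bound(1) by blast

lemma tm_less_iff [simp]: "tm s < tm t \<longleftrightarrow> s < t"
  using tm_mono by (metis less_asym linorder_neqE_linordered_idom)

lemma tm_inj: "tm s = tm t \<Longrightarrow> s = t"
  by (metis less_irrefl linorder_neqE tm_mono)

text \<open>On the compact range of the orbit \<open>K1\<close> has a positive lower bound, so
  \<open>tm\<close> grows at least linearly.\<close>

lemma tm_surj: "\<exists>t. tm t = x"
proof -
  have "continuous_on {a..-a} K1"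
    using a by (intro continuous_at_imp_continuous_on ballI DERIV_isCont[OF K(3)]) auto
  then obtain s0 where s0: "s0 \<in> {a..-a}" "\<And>s. s \<in> {a..-a} \<Longrightarrow> K1 s0 \<le> K1 s"
    using continuous_attains_inf[of "{a..-a}" K1] a by auto
  define m where "m = K1 s0"
  have m: "m > 0" unfolding m_def using s0(1) a by (intro K(5)) auto
  have m': "m \<le> K1 (a * cos t)" for t
  proof -
    have "\<bar>a * cos t\<bar> \<le> \<bar>a\<bar> * 1" unfolding abs_mult by (intro mult_left_mono) auto
    then show ?thesis unfolding m_def using a by (intro s0(2)) auto
  qed
  have pos: "m * t \<le> tm t" if "t \<ge> 0" for t
  proof -
    have "tm 0 - m * 0 \<le> tm t - m * t"
    proof (rule DERIV_nonneg_imp_nondecreasing[OF that])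
      show "\<exists>y. DERIV (\<lambda>x. tm x - m * x) x :> y \<and> 0 \<le> y" for x
        using m'[of x] by (intro exI[of _ "K1 (a * cos x) - m"]) (auto intro!: derivative_eq_intros tm_d)
    qed
    then show ?thesis by simp
  qed
  define t where "t = \<bar>x\<bar> / m"
  have t: "t \<ge> 0" "m * t = \<bar>x\<bar>" using m by (auto simp: t_def)
  then have "tm (- t) \<le> x" "x \<le> tm t" using pos[OF t(1)] tm_sym(1)[of t] by linarith+
  then have "\<exists>s\<ge>-t. s \<le> t \<and> tm s = x"
    using t by (intro IVT allI impI DERIV_isCont[OF tm_d]) auto
  then show ?thesis by blast
qed

definition "ph x = (THE t. tm t = x)"

lemma tm_ph [simp]: "tm (ph x) = x"
proof -
  obtain t where "tm t = x" using tm_surj by blast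
  then have "(THE t. tm t = x) = t" using tm_inj by blast
  with \<open>tm t = x\<close> show ?thesis by (simp add: ph_def)
qed

lemma ph_tm [simp]: "ph (tm t) = t"
  by (rule tm_inj) (rule tm_ph)

lemma ph_d: "DERIV ph x :> inverse (K1 (a * cos (ph x)))"
proof (rule DERIV_inverse_function[where f=tm])
  show "DERIV tm (ph x) :> K1 (a * cos (ph x))" by (rule tm_d)
  show "K1 (a * cos (ph x)) \<noteq> 0" using K(5)[OF s_bound(1)] by (simp add: less_imp_neq[symmetric])
  show "x - 1 < x" "x < x + 1" "tm (ph y) = y" for y by auto
  have "isCont ph (tm (ph x))"
    using DERIV_isCont[OF tm_d]
    by (intro isCont_inverse_function2[where f=tm and x="ph x" and a="ph x - 1" and b="ph x + 1"]) auto
  then show "isCont ph x" by simp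
qed

definition "Y = tm pi"

lemma Y_pos: "Y > 0" using tm_mono[of 0 pi] by (simp add: Y_def)

lemma ph_simps: "ph 0 = 0" "ph Y = pi" "ph (- x) = - ph x" "ph (x + 2 * Y) = ph x + 2 * pi"
proof -
  show "ph 0 = 0" using ph_tm[of 0] by simp
  show "ph Y = pi" by (simp add: Y_def)
  show "ph (- x) = - ph x" by (rule tm_inj) (simp add: tm_sym)
  show "ph (x + 2 * Y) = ph x + 2 * pi" by (rule tm_inj) (simp add: tm_sym Y_def)
qed

lemma ph_range: "0 < x \<Longrightarrow> x < Y \<Longrightarrow> 0 < ph x \<and> ph x < pi"
  by (metis Y_def at_0(1) tm_less_iff tm_ph)

definition "k x = K (a * cos (ph x))"
definition "p x = - a * sin (ph x)"
definition "g x = (k x powr q - 1) / q"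

lemma g_eq: "g x = a * cos (ph x) / K1 (a * cos (ph x))"
  unfolding g_def k_def by (rule K(6)[OF s_bound(1), symmetric])

lemma K1_pos [simp]: "K1 (a * cos t) > 0" "K1 (a * cos t) \<noteq> 0"
  using K(5)[OF s_bound(1)[of t]] by auto

lemma k_pos [simp]: "k x > 0" unfolding k_def by (rule K(1)[OF s_bound(1)])

lemma comp_d:
  assumes "\<And>s. \<bar>s\<bar> < g0 \<Longrightarrow> DERIV f s :> f' s"
  shows "DERIV (\<lambda>x. f (a * cos (ph x))) x :> f' (a * cos (ph x)) * (p x / K1 (a * cos (ph x)))"
proof (rule DERIV_chain2[where f=f and g="\<lambda>x. a * cos (ph x)"])
  show "DERIV f (a * cos (ph x)) :> f' (a * cos (ph x))" by (rule assms[OF s_bound(1)])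
  have "DERIV (\<lambda>x. a * cos (ph x)) x :> a * (- sin (ph x) * inverse (K1 (a * cos (ph x))))"
    by (intro DERIV_cmult DERIV_chain2[OF DERIV_cos] ph_d)
  then show "DERIV (\<lambda>x. a * cos (ph x)) x :> p x / K1 (a * cos (ph x))"
    by (simp add: p_def divide_inverse mult_ac)
qed

lemma k_d: "DERIV k x :> p x"
proof -
  have "DERIV k x :> K1 (a * cos (ph x)) * (p x / K1 (a * cos (ph x)))"
    unfolding k_def by (rule comp_d[OF K(2)])
  then show ?thesis by simp
qed

lemma p_d: "DERIV p x :> - g x"
proof -
  have "DERIV p x :> - a * (cos (ph x) * inverse (K1 (a * cos (ph x))))"
    unfolding p_def by (intro DERIV_cmult DERIV_chain2[OF DERIV_sin] ph_d)
  then show ?thesis by (simp add: g_eq divide_inverse mult.assoc)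
qed

lemma g_d: "DERIV g x :> k x powr (q - 1) * p x"
proof -
  have "DERIV (\<lambda>x. k x powr q) x :> q * k x powr (q - 1) * p x"
    by (rule DERIV_chain2[where f="\<lambda>z. z powr q" and g=k, OF has_real_derivative_powr[OF k_pos] k_d])
  from DERIV_cdivide[OF DERIV_diff[OF this DERIV_const[of 1]], of q] show ?thesis
    unfolding g_def using q by simp
qed

lemma k_sym: "k (- x) = k x" "k (x + 2 * Y) = k x" "p (- x) = - p x" "p (x + 2 * Y) = p x"
  by (simp_all add: k_def p_def ph_simps)

lemma k_p_ends: "k 0 = K a" "p 0 = 0" "p Y = 0" "g 0 < 0" "g Y > 0"
proof -
  show "k 0 = K a" "p 0 = 0" "p Y = 0" by (simp_all add: k_def p_def ph_simps)
  show "g 0 < 0" "g Y > 0" unfolding g_eq ph_simps using a K1_pos[of 0] K1_pos[of pi]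
    by (auto intro: divide_neg_pos divide_pos_pos)
qed

lemma p_pos: "0 < x \<Longrightarrow> x < Y \<Longrightarrow> p x > 0"
  using ph_range[of x] a sin_gt_zero[of "ph x"] by (auto simp: p_def mult_neg_pos)

lemma canonical: "is_canonical_solution q (K a) k"
proof -
  have kd: "deriv k = p" using k_d by (auto intro: DERIV_imp_deriv)
  have pd: "deriv p = (\<lambda>x. - g x)" using p_d by (auto intro: DERIV_imp_deriv)
  have "k \<in> smooth_gen {k, p}" "p \<in> smooth_gen {k, p}" by (auto intro: smooth_gen.base)
  moreover have "(\<lambda>x. (- 1 / q) * (k x powr q + - 1)) \<in> smooth_gen {k, p}"
    using \<open>k \<in> _\<close> by (intro smooth_gen.mult smooth_gen.add smooth_gen.const smooth_gen.powr) auto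
  moreover have "(\<lambda>x. (- 1 / q) * (k x powr q + - 1)) = (\<lambda>x. - g x)" using q by (simp add: g_def fun_eq_iff field_simps)
  ultimately have "smooth_fun k"
    using k_d p_d by (intro smooth_gen_smooth_fun[of "{k,p}"])
      (auto intro: bexI[of _ p] bexI[of _ "\<lambda>x. - g x"])
  moreover have "positive_periodic k"
    unfolding positive_periodic_def using Y_pos k_sym(2)
    by (auto intro!: exI[of _ "2 * Y"] periodic_fun_simpleI')
  ultimately show ?thesis
    unfolding is_canonical_solution_def
    using k_p_ends by (simp add: numeral_2_eq_2 kd pd g_def)
qed

lemma k_sol: "k_sol q (K a) = k"
  using q canonical by (intro k_sol_eqI) auto

text \<open>A shorter period would return to zero velocity at phase pi, the maximum, where the force
  \<open>g\<close> has the opposite sign to that at the minimum.\<close>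

lemma least_period: "is_least_period k (2 * Y)"
  unfolding is_least_period_def
proof (intro conjI allI impI)
  show "2 * Y > 0" using Y_pos by simp
  show "periodic_fun_simple k (2 * Y)" by (intro periodic_fun_simpleI' k_sym)
  fix S assume S: "S > 0" "periodic_fun_simple k S"
  show "2 * Y \<le> S"
  proof (rule ccontr)
    assume "\<not> 2 * Y \<le> S"
    have kS: "k (x + S) = k x" for x by (rule periodic_fun_simpleD[OF S(2)])
    have "p (0 + S) = p 0"
    proof (rule DERIV_unique)
      show "DERIV k 0 :> p 0" by (rule k_d)
      have "DERIV (\<lambda>x. k (x + S)) 0 :> p (0 + S)"
        using k_d[of "0 + S"] by (simp only: DERIV_shift)
      then show "DERIV k 0 :> p (0 + S)" by (simp add: kS)
    qed
    then have "sin (ph S) = 0" using a by (simp add: p_def ph_simps)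
    moreover have "0 < ph S" "ph S < 2 * pi"
      using S(1) \<open>\<not> 2 * Y \<le> S\<close> tm_less_iff[of 0 "ph S"] tm_less_iff[of "ph S" "2 * pi"] tm_sym(2)[of 0]
      by (auto simp: Y_def)
    ultimately have "ph S = pi"
      using sin_gt_zero[of "ph S"] sin_lt_zero[of "ph S"] by (cases "ph S" pi rule: linorder_cases) auto
    then have "g S = g Y" by (simp add: g_eq ph_simps)
    moreover have "g S = g 0" using kS[of 0] by (simp add: g_def)
    ultimately show False using k_p_ends by simp
  qed
qed

lemma P_fun: "P_fun q (K a) = 2 * Y"
  unfolding P_fun_def k_sol using least_period is_least_period_unique by (intro the_equality) blast+

lemma ar_ph_d: "DERIV (\<lambda>x. ar (ph x)) x :> k x"
  using DERIV_chain2[OF ar_d ph_d, of x] by (simp add: k_def mult.assoc)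

lemma k_cont: "continuous_on S k" "continuous_on S p" "continuous_on S g"
  using k_d p_d g_d DERIV_isCont by (blast intro: continuous_at_imp_continuous_on)+

lemma k_integral: "s \<le> t \<Longrightarrow> (k has_integral (ar (ph t) - ar (ph s))) {s..t}"
  using ar_ph_d by (intro fundamental_theorem_real) auto

lemma ar_pos: "ar pi > 0"
proof -
  have "\<exists>y. DERIV ar t :> y \<and> 0 < y" for t
    using ar_d[of t] mult_pos_pos[OF K(1)[OF s_bound(1)[of t]] K1_pos(1)[of t]] by blast
  then show ?thesis using DERIV_pos_imp_increasing[of 0 pi ar] by simp
qed

lemma A_fun: "A_fun q (K a) = 2 * ar pi"
proof -
  have "abs_int 0 (2 * Y) k" by (intro absolutely_integrable_continuous_real k_cont)
  then have "A_fun q (K a) = integral {0..2 * Y} k"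
    unfolding A_fun_def P_fun k_sol by (rule set_lebesgue_integral_eq_integral(2))
  also have "\<dots> = 2 * ar pi"
    using k_integral[of 0 "2 * Y"] Y_pos ph_simps(4)[of 0] ar_sym[of 0] by (simp add: integral_unique ph_simps)
  finally show ?thesis .
qed

lemma E_fun: "E_fun q (K a) = (2 * Y) powr (3 - q) * (2 * ar pi) powr (q - 1)"
  by (simp add: E_fun_def P_fun A_fun)

end

section \<open>Linearized stability at fixed period\<close>

context oscillator
begin

lemma k_nonneg [simp]: "k x \<ge> 0" by (rule less_imp_le[OF k_pos])

definition "V x = k x powr (q - 1)"

lemma V_pos [simp]: "V x > 0" by (simp add: V_def less_imp_neq[symmetric])

lemma V_nonzero [simp]: "V x \<noteq> 0" using V_pos[of x] by (simp del: V_pos)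

lemma kpow_d: "DERIV (\<lambda>x. k x powr c) x :> c * k x powr (c - 1) * p x"
  by (rule DERIV_chain2[where f="\<lambda>z. z powr c" and g=k, OF has_real_derivative_powr[OF k_pos] k_d])

lemma kpow_cont: "continuous_on S (\<lambda>x. k x powr c)"
  using kpow_d DERIV_isCont by (blast intro: continuous_at_imp_continuous_on)

lemma V_cont: "continuous_on S V"
  unfolding V_def using kpow_cont by simp

text \<open>Up to a factor, \<open>\<kappa>\<close> is the derivative of the solution with respect to its initial value.\<close>

definition "\<kappa> x = cos (ph x) * K1 (a * cos (ph x)) - p x * \<xi> (ph x)"
definition "\<kappa>' x = p x / a + g x * \<xi> (ph x)"

lemma \<xi>_ph_d: "DERIV (\<lambda>x. \<xi> (ph x)) x :> cos (ph x) * K2 (a * cos (ph x)) / K1 (a * cos (ph x))"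
  using DERIV_chain2[OF \<xi>_d ph_d, of x] by (simp add: divide_inverse)

text \<open>Both sides of the chart identity for s / K1 s are differentiated in \<open>s\<close> and
  compared.\<close>

lemma V_eq: "V x = 1 / (K1 (a * cos (ph x)))^2 - a * cos (ph x) * K2 (a * cos (ph x)) / (K1 (a * cos (ph x))) ^ 3"
proof -
  define s where "s = a * cos (ph x)"
  have s: "\<bar>s\<bar> < g0" by (simp add: s_def)
  have G1: "K1 s > 0" using K(5)[OF s] .
  have "DERIV (\<lambda>s. s / K1 s) s :> (1 * K1 s - s * K2 s) / (K1 s * K1 s)"
    using G1 by (intro DERIV_divide DERIV_ident K(3) s) simp
  moreover have "DERIV (\<lambda>s. s / K1 s) s :> (K s powr (q - 1) * K1 s)"
  proof (rule has_field_derivative_transform_within)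
    have "DERIV (\<lambda>s. K s powr q) s :> q * K s powr (q - 1) * K1 s"
      by (rule DERIV_chain2[where f="\<lambda>z. z powr q" and g=K, OF has_real_derivative_powr[OF K(1)[OF s]] K(2)[OF s]])
    from DERIV_cdivide[OF DERIV_diff[OF this DERIV_const[of 1]], of q]
    show "DERIV (\<lambda>s. (K s powr q - 1) / q) s :> K s powr (q - 1) * K1 s"
      using q by simp
    show "0 < g0 - \<bar>s\<bar>" "s \<in> UNIV" using s by auto
    show "(K t powr q - 1) / q = t / K1 t" if "dist t s < g0 - \<bar>s\<bar>" for t
      using that by (intro K(6)[symmetric]) (auto simp: dist_real_def)
  qed
  ultimately have "(1 * K1 s - s * K2 s) / (K1 s * K1 s) = K s powr (q - 1) * K1 s"
    by (rule DERIV_unique)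
  then have "V x * K1 s = (K1 s - s * K2 s) / (K1 s * K1 s)" by (simp add: V_def k_def s_def)
  then show ?thesis unfolding s_def[symmetric] using G1
    by (simp add: field_simps power2_eq_square power3_eq_cube)
qed

lemma \<kappa>_d: "DERIV \<kappa> x :> \<kappa>' x"
proof -
  let ?c = "cos (ph x)" and ?s = "a * cos (ph x)"
  have "DERIV (\<lambda>x. cos (ph x)) x :> - sin (ph x) * inverse (K1 ?s)"
    by (rule DERIV_chain2[OF DERIV_cos ph_d])
  from DERIV_diff[OF DERIV_mult[OF this comp_d[where f=K1, OF K(3)]] DERIV_mult[OF p_d \<xi>_ph_d]]
  have "DERIV \<kappa> x :> - sin (ph x) * inverse (K1 ?s) * K1 ?s + K2 ?s * (p x / K1 ?s) * ?c
      - (- g x * \<xi> (ph x) + ?c * K2 ?s / K1 ?s * p x)" (is "DERIV _ _ :> ?D")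
    unfolding \<kappa>_def by simp
  also have "?D = \<kappa>' x"
    using a by (simp add: \<kappa>'_def p_def)
  finally show ?thesis .
qed

lemma \<kappa>'_d: "DERIV \<kappa>' x :> - V x * \<kappa> x"
proof -
  let ?c = "cos (ph x)" and ?s = "a * cos (ph x)"
  have "DERIV \<kappa>' x :> - g x / a + ((V x * p x) * \<xi> (ph x) + ?c * K2 ?s / K1 ?s * g x)" (is "DERIV _ _ :> ?D")
    unfolding \<kappa>'_def using g_d by (intro DERIV_add DERIV_cdivide p_d DERIV_mult \<xi>_ph_d) (simp add: V_def)
  also have "?D = - V x * \<kappa> x"
  proof -
    have "- g x / a + ?c * K2 ?s / K1 ?s * g x = - V x * ?c * K1 ?s"
      unfolding V_eq g_eq using a K1_pos[of "ph x"]
      by (simp add: divide_simps power2_eq_square power3_eq_cube) (simp add: algebra_simps)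
    then show ?thesis by (simp add: \<kappa>_def algebra_simps)
  qed
  finally show ?thesis .
qed

text \<open>The weight \<open>k powr ((q - 1) / 3)\<close> is chosen to cancel the terms that are linear in \<open>g\<close>; what
  remains is the positive function \<open>r\<close> (Schaaf's period monotonicity condition).\<close>

definition "w x = p x * k x powr ((q - 1) / 3)"
definition "w' x = - g x * k x powr ((q - 1) / 3) + (q - 1) / 3 * (p x)^2 * k x powr ((q - 1) / 3 - 1)"
definition "z x = - g x * k x powr (- 2 * (q - 1) / 3) + (q - 1) / 3 * (p x)^2 * k x powr (- (2 * q + 1) / 3)"
definition "r x = (q - 1) * (2 * q + 1) / 9 * (p x)^2 * k x powr (- (q + 1))"

lemma w_d: "DERIV w x :> w' x"
  unfolding w_def by (rule DERIV_cong[OF DERIV_mult[OF p_d kpow_d]]) (simp add: w'_def power2_eq_square algebra_simps)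

lemma z_eq: "z x = 1 / V x * w' x"
proof -
  have 1: "k x powr ((q - 1) / 3) = V x * k x powr (- 2 * (q - 1) / 3)"
    unfolding V_def powr_add[symmetric] by (rule arg_cong[where f="\<lambda>c. k x powr c"]) (simp add: field_simps)
  have 2: "k x powr ((q - 1) / 3 - 1) = V x * k x powr (- (2 * q + 1) / 3)"
    unfolding V_def powr_add[symmetric] by (rule arg_cong[where f="\<lambda>c. k x powr c"]) (simp add: field_simps)
  have "w' x = V x * z x"
    unfolding w'_def 1 2 z_def by (simp only: distrib_left mult_ac mult_minus_left mult_minus_right)
  then show ?thesis using V_pos[of x] by simp
qed

lemma z_d: "DERIV z x :> - (1 + r x) * w x"
proof -
  define e1 e2 where "e1 = - 2 * (q - 1) / 3" and "e2 = - (2 * q + 1) / 3"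
  have "DERIV (\<lambda>x. (p x)^2) x :> 2 * (- g x * p x)"
    using DERIV_power[OF p_d, of 2] by simp
  from DERIV_add[OF DERIV_mult[OF DERIV_minus[OF g_d] kpow_d[of e1]] DERIV_mult[OF DERIV_cmult[OF this, of "(q - 1) / 3"] kpow_d[of e2]]]
  have "DERIV z x :> - (k x powr (q - 1) * p x) * k x powr e1 + e1 * k x powr (e1 - 1) * p x * - g x +
     ((q - 1) / 3 * (2 * (- g x * p x)) * k x powr e2 + e2 * k x powr (e2 - 1) * p x * ((q - 1) / 3 * (p x)^2))" (is "DERIV _ _ :> ?D")
    unfolding z_def e1_def[symmetric] e2_def[symmetric] .
  also have "?D = - (1 + r x) * w x"
  proof -
    have 1: "k x powr (q - 1) * k x powr e1 = k x powr ((q - 1) / 3)"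
      unfolding powr_add[symmetric] e1_def by (rule arg_cong[where f="\<lambda>c. k x powr c"]) (simp add: field_simps)
    have 2: "e1 - 1 = e2" by (simp add: e1_def e2_def field_simps)
    have 3: "k x powr (e2 - 1) = k x powr (- (q + 1)) * k x powr ((q - 1) / 3)"
      unfolding powr_add[symmetric] e2_def by (rule arg_cong[where f="\<lambda>c. k x powr c"]) (simp add: field_simps)
    \<comment> \<open>The terms in g * p have coefficients - e1 and - 2 (q - 1) / 3, which cancel;
      this requirement is what fixes the exponent (q - 1) / 3 in \<open>w\<close>.\<close>
    have "?D
     = - (k x powr (q - 1) * k x powr e1) * p x + e2 * (q - 1) / 3 * p x * (p x)^2 * k x powr (e2 - 1)"
      unfolding 2 by (simp add: e1_def field_simps)
    also have "\<dots> = - (1 + r x) * w x"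
      unfolding 1 3 by (simp add: r_def w_def e2_def field_simps)
    finally show ?thesis .
  qed
  finally show ?thesis .
qed

lemma r_nonneg: "r x \<ge> 0" using q by (simp add: r_def)

lemma r_pos: "0 < x \<Longrightarrow> x < Y \<Longrightarrow> r x > 0"
  using q p_pos[of x] k_pos[of x] by (simp add: r_def less_imp_neq[symmetric])

lemma r_cont: "continuous_on S r"
  unfolding r_def by (intro continuous_intros k_cont kpow_cont)

lemma w_pos: "0 < x \<Longrightarrow> x < Y \<Longrightarrow> w x > 0"
  using p_pos[of x] k_pos[of x] by (simp add: w_def less_imp_neq[symmetric])

lemma w_ends: "w 0 = 0" "w Y = 0" "w' 0 \<noteq> 0" "w' Y \<noteq> 0"
  using k_p_ends k_pos[of 0] k_pos[of Y] by (auto simp: w_def w'_def less_imp_neq[symmetric])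

text \<open>This is the dual Dirichlet problem for primitives. The strict excess \<open>r\<close>
  over the coefficient 1 is what later excludes a kernel.\<close>

lemma picone_weighted: "picone 0 Y w w' z (\<lambda>x. 1 / V x) (\<lambda>x. 1 + r x)"
proof
  show "continuous_on {0..Y} (\<lambda>x. 1 / V x)"
    using V_pos by (intro continuous_intros V_cont) (simp add: less_imp_neq[symmetric])
  show "continuous_on {0..Y} (\<lambda>x. 1 + r x)" by (intro continuous_intros r_cont)
qed (use Y_pos w_d z_d z_eq w_pos w_ends in auto)

text \<open>The translation mode k' solves the linearized equation and is positive between its zeros
  at the minimum and the maximum.\<close>

lemma picone_translation: "picone 0 Y p (\<lambda>x. - g x) (\<lambda>x. - g x) (\<lambda>x. 1) V"
proof
  show "DERIV (\<lambda>x. - g x) x :> - V x * p x" for x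
    using DERIV_minus[OF g_d] by (simp add: V_def)
qed (use Y_pos p_d p_pos k_p_ends V_cont in auto)

text \<open>Sturm comparison of \<open>\<kappa>'\<close> with the supersolution \<open>w\<close>: the period is increasing in the energy.\<close>

lemma \<xi>_pi_neg: "\<xi> pi < 0"
proof -
  have \<kappa>0: "\<kappa> 0 > 0" "\<kappa>' 0 = 0" using K(5)[OF s_bound(2)] by (simp_all add: \<kappa>_def \<kappa>'_def ph_simps k_p_ends)
  have \<kappa>'c: "continuous_on S \<kappa>'" for S
    using \<kappa>'_d DERIV_isCont by (blast intro: continuous_at_imp_continuous_on)
  \<comment> \<open>Wronskian of \<open>\<kappa>'\<close> and \<open>w\<close> for the weight 1 / V:
    the flux of \<open>\<kappa>'\<close>, its derivative over \<open>V\<close>, is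
    \<open>- \<kappa>\<close>.\<close>
  define W where "W x = - \<kappa> x * w x - \<kappa>' x * z x" for x
  have W: "DERIV W x :> \<kappa>' x * w x * r x" for x
  proof -
    have "DERIV W x :> (- \<kappa>' x * w x + w' x * - \<kappa> x) - ((- V x * \<kappa> x) * z x + (- (1 + r x) * w x) * \<kappa>' x)" (is "DERIV _ _ :> ?D")
      unfolding W_def by (intro DERIV_diff DERIV_mult DERIV_minus \<kappa>_d \<kappa>'_d w_d z_d)
    also have "?D = \<kappa>' x * w x * r x"
      using V_pos[of x] by (simp add: z_eq algebra_simps)
    finally show ?thesis .
  qed
  have "\<kappa>' Y < 0"
  proof (rule ccontr)
    assume "\<not> \<kappa>' Y < 0"
    have "- V 0 * \<kappa> 0 < 0" using V_pos[of 0] \<kappa>0 by (simp add: mult_pos_pos)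
    from DERIV_neg_dec_right[OF \<kappa>'_d this]
    obtain d where d: "d > 0" "\<And>h. 0 < h \<Longrightarrow> h < d \<Longrightarrow> \<kappa>' h < 0" using \<kappa>0 by auto
    \<comment> \<open>\<open>\<kappa>'\<close> also vanishes at 0, so the search for its next zero
      starts at \<open>d'\<close>, inside the initial stretch where it is negative.\<close>
    define d' where "d' = min (d/2) Y"
    have d': "0 < d'" "d' < d" "d' \<le> Y" using d Y_pos by (auto simp: d'_def)
    define S where "S = {d'..Y} \<inter> \<kappa>' -` {0..}"
    have "compact S" unfolding S_def
      by (intro compact_Int_closed[OF compact_Icc] closed_vimage \<kappa>'c) auto
    moreover have "Y \<in> S" using \<open>\<not> \<kappa>' Y < 0\<close> d' by (auto simp: S_def)
    ultimately obtain y where y: "y \<in> S" "\<And>x. x \<in> S \<Longrightarrow> y \<le> x"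
      using compact_attains_inf[of S] by blast
    have yY: "0 < y" "y \<le> Y" using y(1) d' by (auto simp: S_def)
    have neg: "\<kappa>' x < 0" if "0 < x" "x < y" for x
    proof (cases "x < d'")
      case True then show ?thesis using d(2)[of x] d' that by auto
    next
      case False then show ?thesis using y(2)[of x] that yY by (force simp: S_def)
    qed
    have "\<kappa>' y \<le> 0"
    proof (rule tendsto_upperbound[of \<kappa>' _ "at_left y"])
      show "(\<kappa>' \<longlongrightarrow> \<kappa>' y) (at_left y)"
        using \<kappa>'c[of UNIV] by (auto simp: continuous_on_eq_continuous_at continuous_at_imp_continuous_within continuous_within[symmetric])
      show "\<forall>\<^sub>F x in at_left y. \<kappa>' x \<le> 0"
        unfolding eventually_at_left_field using neg yY by (intro exI[of _ 0]) (auto simp: less_imp_le)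
    qed simp
    with y(1) have \<kappa>'y: "\<kappa>' y = 0" by (auto simp: S_def)
    have "W y < W 0"
    proof (rule DERIV_neg_imp_decreasing_open[OF yY(1)])
      fix x assume x: "0 < x" "x < y"
      then have "\<kappa>' x * w x * r x < 0"
        using neg[OF x] w_pos[of x] r_pos[of x] yY by (simp add: mult_neg_pos)
      with W show "\<exists>y. DERIV W x :> y \<and> y < 0" by blast
    next
      show "continuous_on {0..y} W" using W DERIV_isCont by (blast intro: continuous_at_imp_continuous_on)
    qed
    \<comment> \<open>At the first zero y the drop of \<open>W\<close> gives \<kappa> y > 0, hence
      \<open>\<kappa>'\<close> is strictly decreasing there, although it arrives at 0 from negative
      values.\<close>
    then have ww: "\<kappa> y * w y > 0" by (simp add: W_def w_ends \<kappa>0 \<kappa>'y)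
    then have "y \<noteq> Y" using w_ends by auto
    then have "w y > 0" using w_pos yY by simp
    with ww have "\<kappa> y > 0" by (simp add: zero_less_mult_iff)
    then have "- V y * \<kappa> y < 0" using V_pos[of y] by (simp add: mult_pos_pos)
    from DERIV_neg_dec_left[OF \<kappa>'_d this]
    obtain e where e: "e > 0" "\<And>h. 0 < h \<Longrightarrow> h < e \<Longrightarrow> \<kappa>' y < \<kappa>' (y - h)" by blast
    define h where "h = min (e/2) (y/2)"
    have "0 < h" "h < e" "h < y" using e yY by (auto simp: h_def)
    then show False using e(2)[of h] neg[of "y - h"] \<kappa>'y by auto
  qed
  \<comment> \<open>\<open>\<kappa>' Y\<close> is \<open>g Y * \<xi> pi\<close> with positive
    \<open>g Y\<close>.\<close>
  then show ?thesis using k_p_ends by (simp add: \<kappa>'_def ph_simps mult_less_0_iff)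
qed

text \<open>The antiderivative is the variation in \<open>a\<close> of the area up to a fixed time:
  \<open>ar'\<close> is the variation at fixed phase, and \<open>\<xi>\<close> times
  \<open>k\<close> corrects for the shift of time.\<close>

lemma \<kappa>_integral: "integral {0..Y} \<kappa> = ar' pi - \<xi> pi * k Y"
proof -
  have d: "DERIV (\<lambda>x. ar' (ph x) - \<xi> (ph x) * k x) x :> \<kappa> x" for x
  proof -
    let ?c = "cos (ph x)" and ?s = "a * cos (ph x)"
    have "DERIV (\<lambda>x. ar' (ph x) - \<xi> (ph x) * k x) x :> (?c * (K1 ?s * K1 ?s + K ?s * K2 ?s)) * inverse (K1 ?s) - (?c * K2 ?s / K1 ?s * k x + p x * \<xi> (ph x))" (is "DERIV _ _ :> ?D")
      by (intro DERIV_diff DERIV_mult DERIV_chain2[OF ar'_d ph_d] \<xi>_ph_d k_d)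
    also have "?D = \<kappa> x"
      unfolding \<kappa>_def k_def using K1_pos(2)[of "ph x"] by (simp add: field_simps)
    finally show ?thesis .
  qed
  have "(\<kappa> has_integral ((ar' (ph Y) - \<xi> (ph Y) * k Y) - (ar' (ph 0) - \<xi> (ph 0) * k 0))) {0..Y}"
    using d Y_pos by (intro fundamental_theorem_real) auto
  then show ?thesis by (simp add: ph_simps integral_unique)
qed

text \<open>\<open>\<eta>\<close> is the variation of the steady state within the family of fixed period.\<close>

definition "\<sigma> = 2 / (q - 1)"
text \<open>The coefficient of \<open>x * p x + \<sigma> * k x\<close>, the generator of the scaling
  \<lambda>^\<sigma> k(\<lambda> x) at \<lambda> = 1. This value offsets the drift of the half
  period, so that \<open>\<eta>'\<close> vanishes at \<open>Y\<close>.\<close>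

definition "\<beta> = \<xi> pi / Y"
definition "\<eta> x = \<kappa> x + \<beta> * (x * p x + \<sigma> * k x)"
definition "\<eta>' x = \<kappa>' x + \<beta> * ((1 + \<sigma>) * p x - x * g x)"

lemma \<eta>_d: "DERIV \<eta> x :> \<eta>' x"
proof -
  have "DERIV \<eta> x :> \<kappa>' x + \<beta> * ((1 * p x + - g x * x) + \<sigma> * p x)"
    unfolding \<eta>_def by (intro DERIV_add DERIV_cmult DERIV_mult DERIV_ident p_d k_d \<kappa>_d)
  then show ?thesis by (simp add: \<eta>'_def algebra_simps)
qed

lemma \<eta>'_d: "DERIV \<eta>' x :> - V x * \<eta> x - - (\<beta> * \<sigma>)"
proof -
  have "DERIV \<eta>' x :> - V x * \<kappa> x + \<beta> * ((1 + \<sigma>) * - g x - (1 * g x + (V x * p x) * x))" (is "DERIV _ _ :> ?D")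
    unfolding \<eta>'_def using g_d
    by (intro DERIV_add DERIV_cmult DERIV_diff DERIV_mult DERIV_ident p_d k_d \<kappa>'_d) (simp add: V_def)
  also have "?D = - V x * \<eta> x - - (\<beta> * \<sigma>)"
  proof -
    have Vk: "V x * k x = k x powr q"
      using k_pos[of x] powr_add[of "k x" "q - 1" 1] by (simp add: V_def)
    \<comment> \<open>This homogeneity relation determines \<sigma>: under it the scaling alters the
      equation only in its constant term, so the source in the equation for \<eta> is
      constant.\<close>
    have "(\<sigma> + 2) / q = \<sigma>" using q by (simp add: \<sigma>_def field_simps)
    then have 1: "(\<sigma> + 2) * g x = \<sigma> * (V x * k x - 1)"
      unfolding Vk g_def by (metis times_divide_eq_left times_divide_eq_right)
    have "?D
      = - V x * \<kappa> x - \<beta> * (x * (V x * p x)) - \<beta> * ((\<sigma> + 2) * g x)" by (simp add: algebra_simps)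
    also have "\<dots> = - V x * \<eta> x - - (\<beta> * \<sigma>)" unfolding 1 \<eta>_def by (simp add: algebra_simps)
    finally show ?thesis .
  qed
  finally show ?thesis .
qed

lemma \<eta>'_ends: "\<eta>' 0 = 0" "\<eta>' Y = 0"
  using Y_pos by (simp_all add: \<eta>'_def \<kappa>'_def k_p_ends ph_simps \<beta>_def)

text \<open>\<open>x * p x + k x\<close> is the derivative of \<open>x * k x\<close>; its boundary
  value at \<open>Y\<close> cancels the term with \<open>k Y\<close> in
  \<open>\<kappa>_integral\<close> because \<beta> Y = \<xi> pi.\<close>

lemma \<eta>_integral: "integral {0..Y} \<eta> = ar' pi + (\<sigma> - 1) * \<beta> * ar pi"
proof -
  have "((\<lambda>x. 1 * k x + p x * x) has_integral (Y * k Y - 0 * k 0)) {0..Y}"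
    using Y_pos DERIV_mult[OF DERIV_ident k_d]
    by (intro fundamental_theorem_real) auto
  moreover have k: "(k has_integral ar pi) {0..Y}" using k_integral[of 0 Y] Y_pos by (simp add: ph_simps)
  moreover have \<kappa>: "(\<kappa> has_integral (ar' pi - \<xi> pi * k Y)) {0..Y}"
    using \<kappa>_d DERIV_isCont \<kappa>_integral
    by (metis continuous_at_imp_continuous_on integrable_continuous_real integrable_integral)
  ultimately have "((\<lambda>x. \<kappa> x + \<beta> * ((1 * k x + p x * x) + (\<sigma> - 1) * k x)) has_integral
     (ar' pi - \<xi> pi * k Y) + \<beta> * ((Y * k Y - 0 * k 0) + (\<sigma> - 1) * ar pi)) {0..Y}"
    by (intro has_integral_add has_integral_mult_right)
  then have "(\<eta> has_integral (ar' pi - \<xi> pi * k Y) + \<beta> * ((Y * k Y - 0 * k 0) + (\<sigma> - 1) * ar pi)) {0..Y}"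
    by (rule has_integral_eq[rotated]) (simp add: \<eta>_def algebra_simps)
  then show ?thesis using Y_pos by (simp add: integral_unique \<beta>_def field_simps)
qed

text \<open>Since \<open>V\<close> is even, folding onto {0..Y} splits the form into even and odd
  parts without cross terms. Nonnegativity on the odd part leaves a nonpositive form for the even
  part, which \<open>constrained_definite\<close> annihilates; the odd part is then in the equality
  case \<open>form_zero\<close>.\<close>

lemma linearized_stability:
  assumes neg: "ar' pi + (\<sigma> - 1) * \<beta> * ar pi < 0"
    and U: "ac_on (- Y) Y U v" "U (- Y) = U Y" and sq: "abs_int (-Y) Y (\<lambda>x. (v x)^2)"
    and U0: "integral {-Y..Y} U = 0"
    and le: "integral {-Y..Y} (\<lambda>x. (v x)^2 - V x * (U x)^2) \<le> 0"
  shows "\<exists>C. \<forall>x\<in>{-Y..Y}. U x = C * p x"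
proof -
  note Y = Y_pos
  have fold: "integral {-Y..Y} f = integral {0..Y} (\<lambda>x. f x + f (- x))" and
    ri: "(\<lambda>x. f (- x)) integrable_on {0..Y}"
    if f: "f integrable_on {-Y..Y}" for f :: "real \<Rightarrow> real"
  proof -
    have i: "f integrable_on {-Y..0}" "f integrable_on {0..Y}"
      using f Y by (auto intro: integrable_subinterval_real)
    then show ri: "(\<lambda>x. f (- x)) integrable_on {0..Y}"
      using Henstock_Kurzweil_Integration.integrable_reflect_real[where f=f and a="-Y" and b=0] by simp
    have "integral {-Y..Y} f = integral {-Y..0} f + integral {0..Y} f"
      using f Y by (intro integral_join[symmetric]) auto
    also have "integral {-Y..0} f = integral {0..Y} (\<lambda>x. f (- x))"
      using Henstock_Kurzweil_Integration.integral_reflect_real[where f=f and a="-Y" and b=0] by simp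
    finally show "integral {-Y..Y} f = integral {0..Y} (\<lambda>x. f x + f (- x))"
      using integral_add[OF i(2) ri] by simp
  qed
  have Up: "ac_on 0 Y U v" using Y by (intro ac_on_subinterval[OF U(1)]) auto
  have Um: "ac_on 0 Y (\<lambda>x. U (- x)) (\<lambda>x. - v (- x))"
    unfolding ac_on_def
  proof (intro conjI ballI)
    have "abs_int (-Y) (- 0) v"
      using Y by (intro absolutely_integrable_on_subinterval[OF ac_on_abs[OF U(1)]]) auto
    then have "abs_int 0 Y (\<lambda>x. v (- x))"
      using absolutely_integrable_reflect_real[where f=v and a="-Y" and b=0] by simp
    from set_integrable_mult_right[OF this, of "-1"]
    show "abs_int 0 Y (\<lambda>x. - v (- x))" by simp
    fix x assume x: "x \<in> {0..Y}"
    have "(v has_integral (U (- 0) - U (- x))) {-x..- 0}" using x by (intro ac_onD[OF U(1)]) auto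
    then have "((\<lambda>x. v (- x)) has_integral (U (- 0) - U (- x))) {0..x}"
      using has_integral_reflect_real[where f=v and a="-x" and b=0] by simp
    from has_integral_neg[OF this] show "((\<lambda>x. - v (- x)) has_integral U (- x) - U (- 0)) {0..x}" by simp
  qed
  have sp: "abs_int 0 Y (\<lambda>x. (v x)^2)"
    using Y by (intro absolutely_integrable_on_subinterval[OF sq]) auto
  have "abs_int (-Y) (- 0) (\<lambda>x. (v x)^2)"
    using Y by (intro absolutely_integrable_on_subinterval[OF sq]) auto
  then have sm: "abs_int 0 Y (\<lambda>x. (- v (- x))^2)"
    using absolutely_integrable_reflect_real[where f="\<lambda>x. (v x)^2" and a="-Y" and b=0] by simp
  define Ue where "Ue x = 1/2 * U x + 1/2 * U (- x)" for x
  define ve where "ve x = 1/2 * v x + 1/2 * - v (- x)" for x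
  define Uo where "Uo x = 1/2 * U x + (-1/2) * U (- x)" for x
  define vo where "vo x = 1/2 * v x + (-1/2) * - v (- x)" for x
  have Ue: "ac_on 0 Y Ue ve" and Uo: "ac_on 0 Y Uo vo"
    unfolding Ue_def ve_def Uo_def vo_def by (intro ac_on_add ac_on_cmul Up Um)+
  have sc: "(\<lambda>x. (c * f x)^2) absolutely_integrable_on S"
    if "(\<lambda>x. (f x)^2) absolutely_integrable_on S" for f :: "real \<Rightarrow> real" and c S
    using set_integrable_mult_right[OF that, of "c^2"] by (simp add: power_mult_distrib)
  have se: "abs_int 0 Y (\<lambda>x. (ve x)^2)" and so: "abs_int 0 Y (\<lambda>x. (vo x)^2)"
    unfolding ve_def vo_def
    by (intro abs_int_square_add set_integrable_mult_right ac_on_abs[OF Up] ac_on_abs[OF Um] sc sp sm)+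
  have Qi: "(\<lambda>x. (f x)^2 - V x * (F x)^2) integrable_on {s..t}"
    if "ac_on s t F f" "abs_int s t (\<lambda>x. (f x)^2)" for F f s t
  proof (rule integrable_diff)
    show "(\<lambda>x. (f x)^2) integrable_on {s..t}" using that(2) by (simp add: abs_int_def)
    show "(\<lambda>x. V x * (F x)^2) integrable_on {s..t}"
      by (intro integrable_continuous_real continuous_intros V_cont ac_on_continuous[OF that(1)])
  qed
  have V_even: "V (- x) = V x" for x by (simp add: V_def k_sym)
  have "integral {-Y..Y} (\<lambda>x. (v x)^2 - V x * (U x)^2)
     = integral {0..Y} (\<lambda>x. ((v x)^2 - V x * (U x)^2) + ((v (- x))^2 - V (- x) * (U (- x))^2))"
    by (rule fold[OF Qi[OF U(1) sq]])
  also have "\<dots> = integral {0..Y} (\<lambda>x. 2 * ((ve x)^2 - V x * (Ue x)^2) + 2 * ((vo x)^2 - V x * (Uo x)^2))"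
    by (intro Henstock_Kurzweil_Integration.integral_cong)
      (simp add: V_even ve_def vo_def Ue_def Uo_def power2_eq_square algebra_simps)
  also have "\<dots> = 2 * integral {0..Y} (\<lambda>x. (ve x)^2 - V x * (Ue x)^2) + 2 * integral {0..Y} (\<lambda>x. (vo x)^2 - V x * (Uo x)^2)"
    using Qi[OF Ue se] Qi[OF Uo so]
    by (intro integral_unique has_integral_add has_integral_mult_right) (auto simp: integrable_integral)
  finally have Q: "integral {0..Y} (\<lambda>x. (ve x)^2 - V x * (Ue x)^2) + integral {0..Y} (\<lambda>x. (vo x)^2 - V x * (Uo x)^2) \<le> 0"
    using le by simp
  \<comment> \<open>The condition at \<open>Y\<close> is periodicity: \<open>Y\<close> and
    \<open>- Y\<close> are the same point of the circle.\<close>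
  have Uo0: "Uo 0 = 0" "Uo Y = 0" using U(2) by (auto simp: Uo_def)
  interpret P: picone 0 Y p "\<lambda>x. - g x" "\<lambda>x. - g x" "\<lambda>x. 1" V by (rule picone_translation)
  have "integral {0..Y} (\<lambda>x. (vo x)^2 - V x * (Uo x)^2) \<ge> 0"
    using P.form_nonneg[OF Uo Uo0 so] by simp
  with Q have Qe: "integral {0..Y} (\<lambda>x. (ve x)^2 - V x * (Ue x)^2) \<le> 0" by linarith
  have "integral {0..Y} (\<lambda>x. 2 * Ue x) = 0"
    using fold[of U] U0 integrable_continuous_real[OF ac_on_continuous[OF U(1)]] by (simp add: Ue_def)
  then have Ue0: "integral {0..Y} Ue = 0" by simp
  \<comment> \<open>Monotonicity of the period makes \<beta> negative and the first factor positive;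
    the hypothesis \<open>neg\<close> is the sign of the second.\<close>
  have c: "- (\<beta> * \<sigma>) * integral {0..Y} \<eta> < 0"
    unfolding \<eta>_integral using neg \<xi>_pi_neg Y q
    by (intro mult_pos_neg) (auto simp: \<beta>_def \<sigma>_def divide_neg_pos mult_neg_pos)
  have Uez: "Ue x = 0" if "x \<in> {0..Y}" for x
    by (rule constrained_definite[OF picone_weighted V_cont V_pos r_cont r_nonneg r_pos \<eta>_d \<eta>'_d \<eta>'_ends c Ue se Ue0 Qe that])
  have "integral {0..Y} (\<lambda>x. (ve x)^2 - V x * (Ue x)^2) = integral {0..Y} (\<lambda>x. (ve x)^2)"
    using Uez by (intro Henstock_Kurzweil_Integration.integral_cong) simp
  also have "\<dots> \<ge> 0" using se by (intro integral_nonneg) (auto simp: abs_int_def)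
  finally have "integral {0..Y} (\<lambda>x. (vo x)^2 - V x * (Uo x)^2) \<le> 0" using Q by linarith
  then obtain C where C: "\<forall>x\<in>{0..Y}. Uo x = C * p x"
    using P.form_zero[OF Uo Uo0 so] by auto
  have "U x = C * p x" if "x \<in> {-Y..Y}" for x
  proof (cases "x \<ge> 0")
    case True
    then show ?thesis using bspec[OF C, of x] Uez[of x] that by (simp add: Ue_def Uo_def)
  next
    case False
    then show ?thesis using bspec[OF C, of "- x"] Uez[of "- x"] that by (simp add: Ue_def Uo_def k_sym)
  qed
  then show ?thesis by blast
qed

end

section \<open>Energy stability\<close>

lemma has_integral_affine:
  fixes f :: "real \<Rightarrow> real"
  assumes "m > 0"
  shows "((\<lambda>x. f (c + m * x)) has_integral (I / m)) {s..t} \<longleftrightarrow> (f has_integral I) {c + m * s..c + m * t}"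
proof -
  have e: "(c + m * u - c) /\<^sub>R m = u" for u using assms by simp
  show ?thesis
    using has_integral_affinity_iff[OF assms, of f c I "c + m * s" "c + m * t"]
    unfolding e by (simp add: add.commute divide_inverse_commute)
qed

lemma integral_affine:
  fixes f :: "real \<Rightarrow> real"
  assumes "m > 0" "f integrable_on {c + m * s..c + m * t}"
  shows "integral {s..t} (\<lambda>x. f (c + m * x)) = integral {c + m * s..c + m * t} f / m"
  using has_integral_affine[OF assms(1)] assms(2) by (metis integrable_integral integral_unique)

lemma abs_int_affine:
  fixes f :: "real \<Rightarrow> real"
  assumes m: "m > 0" and f: "abs_int (c + m * s) (c + m * t) f"
  shows "abs_int s t (\<lambda>x. f (c + m * x))"
proof -
  have "(\<lambda>x. g (c + m * x)) integrable_on {s..t}" if "g integrable_on {c + m * s..c + m * t}" for g :: "real \<Rightarrow> real"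
    using has_integral_affine[OF m, of g c] that by (metis has_integral_integrable integrable_integral)
  from this[of f] this[of "\<lambda>x. \<bar>f x\<bar>"] show ?thesis using f by (simp add: abs_int_def)
qed

text \<open>Replaces the chosen weak derivative and the arbitrary representative by concrete
  functions that agree with them off a null set; positivity of \<open>L\<close> keeps
  \<open>H\<close> within the range where it is continuous.\<close>

lemma energy_eq_integral:
  assumes X: "X > 0" and l: "l \<in> L2_circle X" and l': "l' \<in> L2_circle X"
    and L: "ac_on 0 X L l'" "L X = L 0" and N: "negligible N" "\<And>x. x \<in> {0..X} - N \<Longrightarrow> l x = L x"
    and Lpos: "\<And>x. x \<in> {0..X} \<Longrightarrow> L x > 0" and H: "continuous_on {0<..} H"
  shows "energy H X l = integral {0..X} (\<lambda>x. 1 / 2 * (l' x)^2 - H (L x))"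
    and "(\<lambda>x. 1 / 2 * (l' x)^2 - H (L x)) integrable_on {0..X}"
proof -
  let ?f = "\<lambda>x. 1 / 2 * (weak_deriv_circle X l x)^2 - H (l x)"
  let ?g = "\<lambda>x. 1 / 2 * (l' x)^2 - H (L x)"
  have "continuous_on {0..X} (\<lambda>x. H (L x))"
    by (rule continuous_on_compose2[OF H ac_on_continuous[OF L(1)]]) (use Lpos in auto)
  then have g: "abs_int 0 X ?g"
    by (intro set_integral_diff(1) set_integrable_mult_right L2_circleD[OF l'] absolutely_integrable_continuous_real)
  then show "?g integrable_on {0..X}" by (simp add: abs_int_def)
  have w: "has_weak_deriv_circle X l l'" by (rule has_weak_deriv_circleI[OF X l l' L N])
  obtain M where M: "negligible M" "\<And>x. x \<in> {0..X} - M \<Longrightarrow> weak_deriv_circle X l x = l' x"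
    using weak_deriv_circle_AE_unique(2)[OF X l l' w] by blast
  have NM: "negligible (N \<union> M)" using N M by simp
  have eq: "?f x = ?g x" if "x \<in> {0..X} - (N \<union> M)" for x using N(2)[of x] M(2)[of x] that by simp
  have "abs_int 0 X ?f"
    by (rule absolutely_integrable_spike[OF g NM eq])
  then have "energy H X l = integral {0..X} ?f"
    unfolding energy_def by (rule set_lebesgue_integral_eq_integral(2))
  also have "\<dots> = integral {0..X} ?g" by (rule integral_spike[OF NM]) (use eq in simp)
  finally show "energy H X l = integral {0..X} ?g" .
qed

lemma L2_circle_continuous:
  assumes "\<And>x. f (x + X) = f x" "continuous_on UNIV f" shows "f \<in> L2_circle X"
proof (rule L2_circleI)
  show "f \<in> borel_measurable lebesgue"
    using borel_measurable_continuous_onI[OF assms(2)] by (simp add: measurable_completion)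
  show "abs_int 0 X (\<lambda>x. (f x)^2)"
    by (intro absolutely_integrable_continuous_real continuous_intros continuous_on_subset[OF assms(2)]) auto
qed fact

lemma L2_circle_add_cmult:
  assumes "f \<in> L2_circle X" "g \<in> L2_circle X" shows "(\<lambda>x. f x + c * g x) \<in> L2_circle X"
proof (rule L2_circleI)
  note f = L2_circleD[OF assms(1)] and g = L2_circleD[OF assms(2)]
  show "f (x + X) + c * g (x + X) = f x + c * g x" for x by (simp add: f g)
  show "(\<lambda>x. f x + c * g x) \<in> borel_measurable lebesgue" using f(4) g(4) by measurable
  have "abs_int 0 X (\<lambda>x. (c * g x)^2)"
    using set_integrable_mult_right[OF g(2), of "c^2"] by (simp add: power_mult_distrib)
  then show "abs_int 0 X (\<lambda>x. (f x + c * g x)^2)"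
    by (intro abs_int_square_add f g set_integrable_mult_right)
qed

text \<open>The cubic remainder serves directions with positive second variation, the quartic one
  the degenerate direction.\<close>

lemma potential_taylor:
  fixes y d :: real
  assumes H: "is_energy_potential B q H" and y: "y > 0" "y + d > 0" "d \<noteq> 0"
  shows "\<exists>t. min y (y + d) < t \<and> t < max y (y + d) \<and>
      H (y + d) = H y + deriv H y * d + B * y powr (q - 1) / 2 * d^2 + B * (q - 1) * t powr (q - 2) / 6 * d ^ 3"
    and "\<exists>t. min y (y + d) < t \<and> t < max y (y + d) \<and>
      H (y + d) = H y + deriv H y * d + B * y powr (q - 1) / 2 * d^2 + B * (q - 1) * y powr (q - 2) / 6 * d ^ 3
        + B * (q - 1) * (q - 2) * t powr (q - 3) / 24 * d ^ 4"
proof -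
  define D where "D = (\<lambda>m::nat. if m = 0 then H else if m = 1 then deriv H else if m = 2 then (\<lambda>y. B * y powr (q - 1))
     else if m = 3 then (\<lambda>y. B * (q - 1) * y powr (q - 2)) else (\<lambda>y. B * (q - 1) * (q - 2) * y powr (q - 3)))"
  have D: "DERIV (D m) t :> D (Suc m) t" if "m < 4" "t > 0" for m t
  proof -
    have c: "m = 0 \<or> m = 1 \<or> m = 2 \<or> m = 3" using that by linarith
    have p: "DERIV (\<lambda>y. C * y powr e) t :> C * (e * t powr (e - 1))" for C e
      by (intro DERIV_cmult has_real_derivative_powr that)
    from H that(2) have "DERIV H t :> deriv H t"
      "DERIV (deriv H) t :> B * t powr (q - 1)"
      by (auto simp: is_energy_potential_def field_differentiable_derivI)
    with c p[of B "q - 1"] p[of "B * (q - 1)" "q - 2"] show ?thesis by (auto simp: D_def mult.assoc)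
  qed
  have T: "\<exists>t. (if y + d < y then y + d < t \<and> t < y else y < t \<and> t < y + d) \<and>
     H (y + d) = (\<Sum>m<n. D m y / fact m * ((y + d) - y) ^ m) + D n t / fact n * ((y + d) - y) ^ n"
    if "0 < n" "n \<le> 4" for n
  proof (rule Taylor[where a="min y (y + d)" and b="max y (y + d)"])
    show "D 0 = H" by (simp add: D_def)
    show "\<forall>m t. m < n \<and> min y (y + d) \<le> t \<and> t \<le> max y (y + d) \<longrightarrow> DERIV (D m) t :> D (Suc m) t"
      using that y by (auto intro!: D)
  qed (use that y in auto)
  show "\<exists>t. min y (y + d) < t \<and> t < max y (y + d) \<and>
      H (y + d) = H y + deriv H y * d + B * y powr (q - 1) / 2 * d^2 + B * (q - 1) * t powr (q - 2) / 6 * d ^ 3"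
    using T[of 3] y(3) by (auto simp: D_def eval_nat_numeral split: if_splits)
  show "\<exists>t. min y (y + d) < t \<and> t < max y (y + d) \<and>
      H (y + d) = H y + deriv H y * d + B * y powr (q - 1) / 2 * d^2 + B * (q - 1) * y powr (q - 2) / 6 * d ^ 3
        + B * (q - 1) * (q - 2) * t powr (q - 3) / 24 * d ^ 4"
    using T[of 4] y(3) by (auto simp: D_def eval_nat_numeral split: if_splits)
qed

text \<open>\<open>H\<close> is prescribed only up to an affine function; the constant
  \<open>K\<close> disappears later against zero-mean perturbations.\<close>

lemma potential_deriv_eq:
  assumes H: "is_energy_potential B q H" and q: "q > 0"
  obtains K where "\<And>y. y > 0 \<Longrightarrow> deriv H y = B * y powr q / q + K"
proof -
  have "DERIV (\<lambda>y. deriv H y - B / q * y powr q) y :> B * y powr (q - 1) - B / q * (q * y powr (q - 1))"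
    if "y > 0" for y
    using H that by (intro DERIV_diff DERIV_cmult has_real_derivative_powr) (auto simp: is_energy_potential_def)
  then have "((\<lambda>y. deriv H y - B / q * y powr q) has_real_derivative 0) (at y within {0<..})" if "y \<in> {0<..}" for y
    using that q by (auto intro: has_field_derivative_at_within)
  from has_field_derivative_zero_constant[OF _ this]
  obtain K where K: "\<And>y. y > 0 \<Longrightarrow> deriv H y - B / q * y powr q = K" by auto
  show ?thesis using K by (intro that[of K]) (simp add: algebra_simps)
qed

text \<open>If the second variation \<open>Q\<close> is positive at \<open>u\<close>, it dominates
  the cubic remainder for small \<open>e\<close>. Otherwise \<open>lin\<close> makes the continuous
  representative of \<open>u\<close> a multiple of \<open>h1\<close>, and the decision falls to the
  strictly positive quartic term, for every \<open>e\<close> that keeps the profile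
  positive.\<close>

theorem energy_stable_from_linearization:
  fixes h h1 :: "real \<Rightarrow> real"
  assumes B: "B > 0" and q: "1 < q" "q < 2" and X: "X > 0" and H: "is_energy_potential B q H"
    and hpos: "\<And>x. h x > 0" and hper: "\<And>x. h (x + X) = h x" and h1per: "\<And>x. h1 (x + X) = h1 x"
    and hd: "\<And>x. DERIV h x :> h1 x"
    and h1d: "\<And>x. DERIV h1 x :> - ((B * h x powr q - D) / q)"
    and sym: "\<And>x. h (x0 - x) = h (x0 + x)" "\<And>x. h1 (x0 - x) = - h1 (x0 + x)"
    and lin: "\<And>U v. (\<And>a b. ac_on a b U v) \<Longrightarrow> (\<And>x. U (x + X) = U x) \<Longrightarrow> v \<in> L2_circle X \<Longrightarrow>
       integral {0..X} U = 0 \<Longrightarrow> integral {0..X} (\<lambda>x. (v x)^2 - B * h x powr (q - 1) * (U x)^2) \<le> 0 \<Longrightarrow>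
       \<exists>C. \<forall>x. U x = C * h1 x"
  shows "energy_stable H X h"
  unfolding energy_stable_def
proof (intro ballI impI)
  fix u assume u: "u \<in> H1_circle X" and nz: "\<not> (AE x in lebesgue. u x = 0)" and u0: "(LINT x:{0..X}|lebesgue. u x) = 0"
  obtain v where uL: "u \<in> L2_circle X" and v: "v \<in> L2_circle X" and wd: "has_weak_deriv_circle X u v"
    using u by (auto simp: H1_circle_def)
  obtain U N where U: "\<And>a b. ac_on a b U v" and Uper: "\<And>x. U (x + X) = U x"
    and N: "negligible N" "\<And>x. x \<in> {0..X} - N \<Longrightarrow> u x = U x"
    using H1_circle_representative[OF X uL v wd] by blast
  have hc: "continuous_on S h" and h1c: "continuous_on S h1" for S
    using hd h1d DERIV_isCont by (blast intro: continuous_at_imp_continuous_on)+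
  have hpc: "continuous_on S (\<lambda>x. h x powr e)" for S e
    using hc hpos by (intro continuous_intros) (auto simp: less_imp_neq[symmetric])
  have Uc: "continuous_on {0..X} U" by (rule ac_on_continuous[OF U])
  have int: "f integrable_on {0..X}" if "continuous_on {0..X} f" for f :: "real \<Rightarrow> real"
    using that by (rule integrable_continuous_real)
  have v2: "(\<lambda>x. (v x)^2) integrable_on {0..X}" using L2_circleD(2)[OF v] by (simp add: abs_int_def)
  have U0: "integral {0..X} U = 0"
  proof -
    have "integral {0..X} U = integral {0..X} u" by (rule integral_spike[OF N(1)]) (use N in simp)
    also have "\<dots> = 0" using u0 set_lebesgue_integral_eq_integral(2)[OF L2_circleD(1)[OF uL]] by simp
    finally show ?thesis .
  qed
  \<comment> \<open>\<open>u\<close> and \<open>U\<close> agree off a null set of one period only;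
    the translates of that set by all multiples of \<open>X\<close> are needed to conclude on the
    line.\<close>
  have Unz: "\<exists>x. U x \<noteq> 0"
  proof (rule ccontr)
    assume "\<nexists>x. U x \<noteq> 0"
    then have uz: "u x = 0" if "x \<in> {0..X} - N" for x using N(2)[OF that] by simp
    have "negligible (\<Union>n::int. (+) (of_int n * X) ` N)"
      by (intro negligible_countable_Union) (auto intro: negligible_translation N)
    moreover have "u x = 0" if "x \<notin> (\<Union>n::int. (+) (of_int n * X) ` N)" for x
    proof -
      interpret periodic_fun_simple u X by unfold_locales (rule L2_circleD(3)[OF uL])
      define n where "n = \<lfloor>x / X\<rfloor>"
      define r where "r = x - of_int n * X"
      have "r \<in> {0..X}" using floor_divide_lower[OF X, of x] floor_divide_upper[OF X, of x]
        unfolding r_def n_def by (auto simp: algebra_simps)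
      moreover have "r \<notin> N" using that by (auto simp: r_def image_iff) (metis add.commute diff_add_cancel)
      ultimately have "u r = 0" by (intro uz) auto
      then show ?thesis using plus_of_int[of r n] by (simp add: r_def)
    qed
    then have "{x \<in> space lebesgue. \<not> u x = 0} \<subseteq> (\<Union>n::int. (+) (of_int n * X) ` N)" by blast
    ultimately have "AE x in lebesgue. u x = 0"
      unfolding negligible_iff_null_sets by (rule AE_I')
    with nz show False by blast
  qed
  have hL: "h \<in> L2_circle X" "h1 \<in> L2_circle X" by (intro L2_circle_continuous hper h1per hc h1c)+
  have Hd: "DERIV H y :> deriv H y" if "y > 0" for y
    using H that by (auto simp: is_energy_potential_def field_differentiable_derivI)
  have Hc: "continuous_on {0<..} H"
    using Hd DERIV_isCont by (auto intro!: continuous_at_imp_continuous_on)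
  have ach: "ac_on a b h h1" for a b
    by (intro ac_onI_C1 has_field_derivative_at_within[OF hd] h1c)
  define h2 where "h2 x = - ((B * h x powr q - D) / q)" for x
  have h2c: "continuous_on S h2" for S unfolding h2_def using q by (intro continuous_intros hpc) auto
  have ach1: "ac_on a b h1 h2" for a b
    by (intro ac_onI_C1 has_field_derivative_at_within[OF h1d[folded h2_def]] h2c)
  have h2per: "h2 (x + X) = h2 x" for x by (simp add: h2_def hper)
  have "\<exists>x\<in>{0..X}. \<forall>y\<in>{0..X}. h x \<le> h y" using X by (intro continuous_attains_inf hc) auto
  then obtain m0 where m0: "m0 > 0" "\<And>x. x \<in> {0..X} \<Longrightarrow> m0 \<le> h x" using hpos by blast
  have "\<exists>x\<in>{0..X}. \<forall>y\<in>{0..X}. \<bar>U y\<bar> \<le> \<bar>U x\<bar>" using X by (intro continuous_attains_sup continuous_intros Uc) auto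
  then obtain K0 where K0: "\<And>x. x \<in> {0..X} \<Longrightarrow> \<bar>U x\<bar> \<le> K0" by blast
  have K00: "K0 \<ge> 0" using K0[of 0] X by auto
  obtain K where K: "\<And>y. y > 0 \<Longrightarrow> deriv H y = B * y powr q / q + K"
    using potential_deriv_eq[OF H] q by auto
  have H1c: "continuous_on {0..X} (\<lambda>x. deriv H (h x))"
    using hpos by (subst K) (use q in \<open>auto intro!: continuous_intros hpc\<close>)
  \<comment> \<open>Below this size the perturbation is at most half the minimum of
    \<open>h\<close>; the 1 guards against \<open>K0 = 0\<close>.\<close>
  define e0 where "e0 = m0 / (2 * (K0 + 1))"
  have e0: "e0 > 0" using m0 K00 by (simp add: e0_def)
  have small: "\<bar>e * U x\<bar> \<le> m0 / 2" if "0 < e" "e < e0" "x \<in> {0..X}" for e x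
  proof -
    have "\<bar>e * U x\<bar> \<le> e0 * (K0 + 1)"
      unfolding abs_mult using that K0[OF that(3)] K00 by (intro mult_mono) auto
    also have "\<dots> = m0 / 2"
    proof -
      have "m0 / (2 * y) * y = m0 / 2" if "y > 0" for y using that by simp
      from this[of "K0 + 1"] show ?thesis using K00 unfolding e0_def by linarith
    qed
    finally show ?thesis .
  qed
  have pos: "h x + e * U x > 0" if "0 < e" "e < e0" "x \<in> {0..X}" for e x
    using small[OF that] m0(2)[OF that(3)] m0(1) by linarith
  define R where "R = (\<lambda>e x. H (h x + e * U x) - H (h x) - deriv H (h x) * (e * U x))"
  have Rc: "continuous_on {0..X} (R e)" if "0 < e" "e < e0" for e
    unfolding R_def using pos[OF that] hpos
    by (intro continuous_intros H1c Uc hc continuous_on_compose2[OF Hc, where f="\<lambda>x. h x + e * U x"]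
          continuous_on_compose2[OF Hc, where f=h]) auto
  text \<open>The first variation vanishes on zero-mean perturbations.\<close>
  have diff: "energy H X (\<lambda>x. h x + e * u x) - energy H X h = e^2 / 2 * integral {0..X} (\<lambda>x. (v x)^2) - integral {0..X} (R e)"
    if e: "0 < e" "e < e0" for e
  proof -
    have ac: "ac_on 0 X (\<lambda>x. h x + e * U x) (\<lambda>x. h1 x + e * v x)" by (intro ac_on_add ac_on_cmul ach U)
    note E1 = energy_eq_integral[OF X L2_circle_add_cmult[OF hL(1) uL] L2_circle_add_cmult[OF hL(2) v] ac _ N(1) _ pos[OF e] Hc]
    have E1: "energy H X (\<lambda>x. h x + e * u x) = integral {0..X} (\<lambda>x. 1 / 2 * (h1 x + e * v x)^2 - H (h x + e * U x))"
      "(\<lambda>x. 1 / 2 * (h1 x + e * v x)^2 - H (h x + e * U x)) integrable_on {0..X}"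
      using E1 hper[of 0] Uper[of 0] N(2) by auto
    have E0: "energy H X h = integral {0..X} (\<lambda>x. 1 / 2 * (h1 x)^2 - H (h x))"
      "(\<lambda>x. 1 / 2 * (h1 x)^2 - H (h x)) integrable_on {0..X}"
      using energy_eq_integral[OF X hL ach _ negligible_empty _ hpos Hc] hper[of 0] by auto
    have "((\<lambda>x. h2 x * U x + h1 x * v x) has_integral (h1 X * U X - h1 0 * U 0)) {0..X}"
      using X by (intro ac_on_mult_aux ach1 U) simp
    then have F1: "((\<lambda>x. h2 x * U x + h1 x * v x) has_integral 0) {0..X}"
      using h1per[of 0] Uper[of 0] by simp
    have "((\<lambda>x. (h2 x * U x + h1 x * v x) - (D / q + K) * U x) has_integral (0 - (D / q + K) * integral {0..X} U)) {0..X}"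
      using Uc by (intro has_integral_diff F1 has_integral_mult_right integrable_integral int)
    then have "((\<lambda>x. (h2 x * U x + h1 x * v x) - (D / q + K) * U x) has_integral 0) {0..X}" by (simp add: U0)
    then have F: "((\<lambda>x. h1 x * v x - deriv H (h x) * U x) has_integral 0) {0..X}"
      by (rule has_integral_eq[rotated]) (use q in \<open>simp add: K[OF hpos] h2_def diff_divide_distrib algebra_simps\<close>)
    have "((\<lambda>x. (1 / 2 * (h1 x)^2 - H (h x)) + e * (h1 x * v x - deriv H (h x) * U x) + e^2 / 2 * (v x)^2 - R e x) has_integral
      (energy H X h + e * 0 + e^2 / 2 * integral {0..X} (\<lambda>x. (v x)^2) - integral {0..X} (R e))) {0..X}" (is "(_ has_integral ?I) _")
      unfolding E0(1)
      by (intro has_integral_add has_integral_diff has_integral_mult_right F integrable_integral[OF E0(2)]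
            integrable_integral[OF v2] integrable_integral[OF int[OF Rc[OF e]]])
    then have "((\<lambda>x. 1 / 2 * (h1 x + e * v x)^2 - H (h x + e * U x)) has_integral
      ?I) {0..X}"
      by (rule has_integral_eq[rotated]) (simp add: R_def power2_eq_square algebra_simps)
    then show ?thesis unfolding E1(1) by (simp add: integral_unique)
  qed
  define Q where "Q = integral {0..X} (\<lambda>x. (v x)^2 - B * h x powr (q - 1) * (U x)^2)"
  define W where "W = integral {0..X} (\<lambda>x. B * h x powr (q - 1) * (U x)^2)"
  have Wi: "(\<lambda>x. B * h x powr (q - 1) * (U x)^2) integrable_on {0..X}"
    by (intro int continuous_intros hpc Uc)
  have QW: "Q = integral {0..X} (\<lambda>x. (v x)^2) - W" unfolding Q_def W_def by (rule integral_diff[OF v2 Wi])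
  have "\<exists>b>0. \<forall>e>0. e < b \<longrightarrow> energy H X h < energy H X (\<lambda>x. h x + e * u x)"
  proof (cases "Q > 0")
    case True
    \<comment> \<open>A bound for the third Taylor coefficient: as q < 2, the power decreases in
      \<open>t\<close>, and m0 / 2 is a lower bound for the perturbed profile.\<close>
    define M where "M = B * (q - 1) * (m0 / 2) powr (q - 2) / 6"
    have M: "M \<ge> 0" unfolding M_def using B q by simp
    define I3 where "I3 = integral {0..X} (\<lambda>x. \<bar>U x\<bar> ^ 3)"
    have I3: "I3 \<ge> 0" unfolding I3_def by (intro integral_nonneg int continuous_intros Uc) auto
    define b where "b = min e0 (Q / (2 * (M * I3 + 1)))"
    have b: "b > 0" using True e0 M I3 by (simp add: b_def add_nonneg_pos)
    have "energy H X h < energy H X (\<lambda>x. h x + e * u x)" if e: "0 < e" "e < b" for e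
    proof -
      have e': "e < e0" using e by (simp add: b_def)
      have Rle: "R e x \<le> e^2 / 2 * (B * h x powr (q - 1) * (U x)^2) + M * e ^ 3 * \<bar>U x\<bar> ^ 3" if x: "x \<in> {0..X}" for x
      proof (cases "e * U x = 0")
        case True then show ?thesis using e by (auto simp: R_def)
      next
        case False
        obtain t where t: "min (h x) (h x + e * U x) < t"
          and eq: "H (h x + e * U x) = H (h x) + deriv H (h x) * (e * U x) + B * h x powr (q - 1) / 2 * (e * U x)^2
             + B * (q - 1) * t powr (q - 2) / 6 * (e * U x) ^ 3"
          using potential_taylor(1)[OF H hpos pos[OF e(1) e' x] False] by blast
        have "m0 / 2 \<le> t" using t small[OF e(1) e' x] m0(2)[OF x] by linarith
        then have "t powr (q - 2) \<le> (m0 / 2) powr (q - 2)" using m0 q by (intro powr_mono2') auto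
        then have "B * (q - 1) * t powr (q - 2) / 6 \<le> M" unfolding M_def using B q
          by (intro divide_right_mono mult_left_mono) auto
        moreover have "0 \<le> B * (q - 1) * t powr (q - 2) / 6" using B q by simp
        ultimately have "B * (q - 1) * t powr (q - 2) / 6 * (e * U x) ^ 3 \<le> M * \<bar>e * U x\<bar> ^ 3"
          by (intro order_trans[OF mult_left_mono[of _ "\<bar>e * U x\<bar> ^ 3"] mult_right_mono])
            (auto simp flip: power_abs)
        then show ?thesis using e unfolding R_def eq by (simp add: abs_mult power_mult_distrib mult_ac)
      qed
      have "integral {0..X} (R e) \<le> integral {0..X} (\<lambda>x. e^2 / 2 * (B * h x powr (q - 1) * (U x)^2) + M * e ^ 3 * \<bar>U x\<bar> ^ 3)"
        by (rule integral_le) (use Rle in \<open>auto intro!: int continuous_intros hpc Uc Rc e e'\<close>)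
      also have "\<dots> = e^2 / 2 * W + M * e ^ 3 * I3"
        unfolding W_def I3_def
        by (intro integral_unique has_integral_add has_integral_mult_right integrable_integral Wi int continuous_intros Uc)
      finally have "energy H X (\<lambda>x. h x + e * u x) - energy H X h \<ge> e^2 / 2 * (Q - 2 * e * (M * I3))"
        unfolding diff[OF e(1) e'] QW by (simp add: algebra_simps power2_eq_square power3_eq_cube)
      moreover have "Q - 2 * e * (M * I3) > 0"
      proof -
        have "2 * e * (M * I3) \<le> e * (2 * (M * I3 + 1))" using e by (simp add: algebra_simps)
        also have "\<dots> < Q" using e M I3 by (simp add: b_def pos_less_divide_eq add_nonneg_pos)
        finally show ?thesis by simp
      qed
      then have "e^2 / 2 * (Q - 2 * e * (M * I3)) > 0" using e by simp
      ultimately show ?thesis by linarith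
    qed
    with b show ?thesis by blast
  next
    case False
    then obtain C where C: "\<And>x. U x = C * h1 x"
      using lin[OF U Uper v U0] unfolding Q_def by force
    have C0: "C \<noteq> 0" using Unz C by auto
    have h2d: "DERIV h2 x :> - (B * h x powr (q - 1) * h1 x)" for x
    proof -
      have "DERIV (\<lambda>x. h x powr q) x :> q * h x powr (q - 1) * h1 x"
        by (rule DERIV_chain2[where f="\<lambda>z. z powr q" and g=h, OF has_real_derivative_powr[OF hpos] hd])
      from DERIV_minus[OF DERIV_cdivide[OF DERIV_diff[OF DERIV_cmult[OF this, of B] DERIV_const[of D]], of q]]
      show ?thesis unfolding h2_def using q by (simp add: mult.assoc)
    qed
    have ach2: "ac_on 0 X h2 (\<lambda>x. - (B * h x powr (q - 1) * h1 x))"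
      by (intro ac_onI_C1 has_field_derivative_at_within[OF h2d] continuous_intros hpc h1c)
    have par: "((\<lambda>x. f x * h2 x) has_integral integral {0..X} (\<lambda>x. B * h x powr (q - 1) * (F x * h1 x))) {0..X}"
      if F: "ac_on 0 X F f" "F X = F 0" for F f
    proof -
      have "((\<lambda>x. f x * h2 x + F x * - (B * h x powr (q - 1) * h1 x)) has_integral 0) {0..X}"
        using ac_on_mult_aux[OF F(1) ach2] X F(2) h2per[of 0] by simp
      moreover have "((\<lambda>x. B * h x powr (q - 1) * (F x * h1 x)) has_integral integral {0..X} (\<lambda>x. B * h x powr (q - 1) * (F x * h1 x))) {0..X}"
        using F by (intro integrable_integral int continuous_intros hpc h1c ac_on_continuous)
      ultimately have "((\<lambda>x. (f x * h2 x + F x * - (B * h x powr (q - 1) * h1 x)) + B * h x powr (q - 1) * (F x * h1 x)) has_integral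
        0 + integral {0..X} (\<lambda>x. B * h x powr (q - 1) * (F x * h1 x))) {0..X}" by (rule has_integral_add)
      then show ?thesis by (simp add: algebra_simps)
    qed
    define J where "J = integral {0..X} (\<lambda>x. B * h x powr (q - 1) * (h1 x * h1 x))"
    have WJ: "W = C^2 * J"
      unfolding W_def J_def C by (simp add: power2_eq_square mult_ac flip: integral_mult_right)
    \<comment> \<open>\<open>v\<close> is known only as a density of \<open>C * h1\<close>.
      Integrating the nonnegative \<open>(v x - C * h2 x)^2\<close> gives the required inequality
      without identifying \<open>v\<close> with \<open>C * h2\<close> almost everywhere.\<close>
    have Wv: "W \<le> integral {0..X} (\<lambda>x. (v x)^2)"
    proof -
      have "((\<lambda>x. v x * h2 x) has_integral integral {0..X} (\<lambda>x. B * h x powr (q - 1) * (U x * h1 x))) {0..X}"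
        using Uper[of 0] by (intro par U) simp
      moreover have "integral {0..X} (\<lambda>x. B * h x powr (q - 1) * (U x * h1 x)) = C * J"
        unfolding C J_def by (simp add: mult_ac flip: integral_mult_right)
      ultimately have vh: "((\<lambda>x. v x * h2 x) has_integral C * J) {0..X}" by simp
      have hh: "((\<lambda>x. h2 x * h2 x) has_integral J) {0..X}"
        unfolding J_def using h1per[of 0] by (intro par ach1) simp
      have "((\<lambda>x. (v x)^2 - 2 * C * (v x * h2 x) + C^2 * (h2 x * h2 x)) has_integral
         (integral {0..X} (\<lambda>x. (v x)^2) - 2 * C * (C * J) + C^2 * J)) {0..X}"
        by (intro has_integral_add has_integral_diff has_integral_mult_right vh hh integrable_integral v2)
      moreover have "0 \<le> (v x)^2 - 2 * C * (v x * h2 x) + C^2 * (h2 x * h2 x)" for x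
        using zero_le_power2[of "v x - C * h2 x"] by (simp add: power2_eq_square algebra_simps)
      ultimately have "0 \<le> integral {0..X} (\<lambda>x. (v x)^2) - 2 * C * (C * J) + C^2 * J" by (rule has_integral_nonneg)
      then show ?thesis by (simp add: WJ power2_eq_square algebra_simps)
    qed
    text \<open>The cubic term of the energy is odd about the minimum \<open>x0\<close>.\<close>
    define T3 where "T3 = (\<lambda>x. B * (q - 1) * h x powr (q - 2) / 6 * (U x) ^ 3)"
    have T3c: "continuous_on S T3" for S unfolding T3_def C by (intro continuous_intros hpc h1c) auto
    have T30: "integral {0..X} T3 = 0"
    proof -
      have per: "T3 (x + X) = T3 x" for x by (simp add: T3_def C hper h1per)
      have "integral {0..X} T3 = integral {x0 - X/2..x0 - X/2 + X} T3"
        by (rule periodic_integral[OF X per absolutely_integrable_continuous_real[OF T3c], symmetric])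
      also have "\<dots> = integral {- (X/2)..X/2} (\<lambda>x. T3 (x0 + 1 * x))"
        by (subst integral_affine) (auto intro!: integrable_continuous_real T3c simp: algebra_simps)
      finally have 1: "integral {0..X} T3 = integral {- (X/2)..X/2} (\<lambda>x. T3 (x0 + x))" by simp
      have "integral {- (X/2)..X/2} (\<lambda>x. T3 (x0 + x)) = integral {- (X/2)..- (- (X/2))} (\<lambda>x. T3 (x0 + - x))"
        using Henstock_Kurzweil_Integration.integral_reflect_real[where f="\<lambda>x. T3 (x0 + x)" and a="- (X/2)" and b="X/2"] by simp
      also have "\<dots> = integral {- (X/2)..X/2} (\<lambda>x. - T3 (x0 + x))" using sym by (simp add: T3_def C)
      finally show ?thesis unfolding 1 by simp
    qed
    have "energy H X h < energy H X (\<lambda>x. h x + e * u x)" if e: "0 < e" "e < e0" for e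
    proof -
      \<comment> \<open>\<open>P\<close> is minus the fourth-order Taylor remainder, positive
        wherever \<open>U\<close> is nonzero because of the factor q - 2.\<close>
      define P where "P = (\<lambda>x. e^2 / 2 * (B * h x powr (q - 1) * (U x)^2) + e ^ 3 * T3 x - R e x)"
      have Pc: "continuous_on {0..X} P" unfolding P_def by (intro continuous_intros hpc Uc T3c Rc e)
      have P0: "P x = 0" if "U x = 0" for x using that by (simp add: P_def T3_def R_def)
      have Ppos: "P x > 0" if x: "x \<in> {0..X}" and "U x \<noteq> 0" for x
      proof -
        have nz: "e * U x \<noteq> 0" using e that by simp
        obtain t where t: "min (h x) (h x + e * U x) < t" and
          eq: "H (h x + e * U x) = H (h x) + deriv H (h x) * (e * U x) + B * h x powr (q - 1) / 2 * (e * U x)^2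
            + B * (q - 1) * h x powr (q - 2) / 6 * (e * U x) ^ 3 + B * (q - 1) * (q - 2) * t powr (q - 3) / 24 * (e * U x) ^ 4"
          using potential_taylor(2)[OF H hpos pos[OF e x] nz] by blast
        have "t > 0" using t hpos[of x] pos[OF e x] by linarith
        then have "B * (q - 1) * (2 - q) * t powr (q - 3) / 24 * (e * U x) ^ 4 > 0"
          using B q nz by simp
        moreover have "P x = B * (q - 1) * (2 - q) * t powr (q - 3) / 24 * (e * U x) ^ 4"
          unfolding P_def R_def eq T3_def by (simp add: power_mult_distrib field_simps)
        ultimately show ?thesis by simp
      qed
      have Pnn: "P x \<ge> 0" if "x \<in> {0..X}" for x using P0[of x] Ppos[OF that] by (cases "U x = 0") auto
      have "\<exists>x\<in>{0..X}. U x \<noteq> 0"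
      proof -
        obtain x where x: "U x \<noteq> 0" using Unz by blast
        interpret periodic_fun_simple U X by unfold_locales (rule Uper)
        define n where "n = \<lfloor>x / X\<rfloor>"
        define r where "r = x - of_int n * X"
        have "r \<in> {0..X}" using floor_divide_lower[OF X, of x] floor_divide_upper[OF X, of x]
          unfolding r_def n_def by (auto simp: algebra_simps)
        moreover have "U r = U x" using plus_of_int[of r n] by (simp add: r_def)
        ultimately show ?thesis using x by (intro bexI[of _ r]) auto
      qed
      then have "integral {0..X} P \<noteq> 0"
        using integral_eq_0_iff[OF Pc X Pnn] Ppos by force
      moreover have "integral {0..X} P \<ge> 0" by (intro integral_nonneg int Pc Pnn)
      ultimately have Pp: "integral {0..X} P > 0" by simp
      have "integral {0..X} P = e^2 / 2 * W + e ^ 3 * integral {0..X} T3 - integral {0..X} (R e)"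
        unfolding P_def W_def
        by (intro integral_unique has_integral_add has_integral_diff has_integral_mult_right integrable_integral Wi int T3c Rc e)
      with Pp have "integral {0..X} (R e) < e^2 / 2 * W" by (simp add: T30)
      also have "\<dots> \<le> e^2 / 2 * integral {0..X} (\<lambda>x. (v x)^2)" by (intro mult_left_mono Wv) simp
      finally show ?thesis using diff[OF e] by linarith
    qed
    with e0 show ?thesis by blast
  qed
  then show "\<forall>\<^sub>F e in at_right 0. energy H X h < energy H X (\<lambda>x. h x + e * u x)"
    unfolding eventually_at_right_field by auto
qed

section \<open>The sign of the derivative of \<open>E_fun\<close> and the return to the original
  variables\<close>

context chart
begin

text \<open>The chart has made the range of integration independent of \<open>a\<close>, so
  Leibniz's rule applies with no boundary terms.\<close>

lemma integral_cos_deriv: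
  assumes f: "\<And>s. \<bar>s\<bar> < g0 \<Longrightarrow> DERIV f s :> f' s" "\<And>s. \<bar>s\<bar> < g0 \<Longrightarrow> isCont f' s"
    and a: "- g0 < a" "a < 0"
  shows "DERIV (\<lambda>a. integral {0..pi} (\<lambda>t. f (a * cos t))) a :> integral {0..pi} (\<lambda>t. cos t * f' (a * cos t))"
proof -
  have bd: "\<bar>x * cos t\<bar> < g0" if "x \<in> {-g0<..<0}" for x t
  proof -
    have "\<bar>x * cos t\<bar> \<le> \<bar>x\<bar> * 1" unfolding abs_mult by (intro mult_left_mono) auto
    then show ?thesis using that by auto
  qed
  have fc: "continuous_on {-g0<..<g0} f" "continuous_on {-g0<..<g0} f'"
    using DERIV_isCont[OF f(1)] f(2)
    by (auto intro!: continuous_at_imp_continuous_on simp: abs_less_iff minus_less_iff)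
  have "((\<lambda>a. integral (cbox 0 pi) (\<lambda>t. f (a * cos t))) has_real_derivative integral (cbox 0 pi) (\<lambda>t. cos t * f' (a * cos t)))
     (at a within {-g0<..<0})"
  proof (rule leibniz_rule_field_derivative)
    fix x t :: real assume x: "x \<in> {-g0<..<0}"
    have "DERIV (\<lambda>x. f (x * cos t)) x :> f' (x * cos t) * cos t"
      by (rule DERIV_chain2[where f=f and g="\<lambda>x. x * cos t", OF f(1)[OF bd[OF x]]]) (auto intro!: derivative_eq_intros)
    then show "((\<lambda>x. f (x * cos t)) has_real_derivative cos t * f' (x * cos t)) (at x within {-g0<..<0})"
      by (simp add: has_field_derivative_at_within mult.commute)
  next
    fix x :: real assume x: "x \<in> {-g0<..<0}"
    show "(\<lambda>t. f (x * cos t)) integrable_on cbox 0 pi"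
      using bd[OF x] by (intro integrable_continuous continuous_on_compose2[OF fc(1)] continuous_intros)
        (auto simp: abs_less_iff minus_less_iff)
  next
    show "continuous_on ({-g0<..<0} \<times> cbox 0 pi) (\<lambda>(x, t). cos t * f' (x * cos t))"
      unfolding split_beta using bd
      by (intro continuous_intros continuous_on_compose2[OF fc(2)]) (auto simp: abs_less_iff minus_less_iff)
  qed (use a in auto)
  then show ?thesis using a by (simp add: at_within_open[of a "{-g0<..<0}"])
qed

end

text \<open>The product and chain rules through \<open>G\<close> give a derivative equal to a
  positive factor times the asserted quantity, which is the integral of \<eta>.\<close>

lemma (in oscillator) E_fun_deriv_neg:
  assumes \<alpha>: "0 < \<alpha>" "\<alpha> < 1" "a = G \<alpha>" and neg: "deriv (E_fun q) \<alpha> < 0"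
  shows "ar' pi + (\<sigma> - 1) * \<beta> * ar pi < 0"
proof -
  define PP where "PP b = integral {0..pi} (\<lambda>t. K1 (b * cos t))" for b
  define AA where "AA b = integral {0..pi} (\<lambda>t. K (b * cos t) * K1 (b * cos t))" for b
  \<comment> \<open>Differentiation at \<alpha> needs the formula for \<open>E_fun\<close> at all
    nearby amplitudes, hence an oscillator for each of them.\<close>
  have osc: "oscillator q g0 G G1 K K1 K2 (G x)" if "0 < x" "x < 1" for x
    using G[OF that] by unfold_locales auto
  have E: "E_fun q x = (2 * PP (G x)) powr (3 - q) * (2 * AA (G x)) powr (q - 1)" if x: "0 < x" "x < 1" for x
  proof -
    interpret o: oscillator q g0 G G1 K K1 K2 "G x" by (rule osc[OF x])
    have "o.Y = PP (G x)" unfolding o.Y_def o.tm_def PP_def by (rule prim_eq_integral[OF o.cont_comp(2)]) simp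
    moreover have "o.ar pi = AA (G x)" unfolding o.ar_def AA_def by (rule prim_eq_integral[OF o.conts(2)]) simp
    ultimately show ?thesis using o.E_fun G(3)[OF x] by simp
  qed
  have Y: "Y = PP a" unfolding Y_def tm_def PP_def by (rule prim_eq_integral[OF cont_comp(2)]) simp
  have A: "ar pi = AA a" unfolding ar_def AA_def by (rule prim_eq_integral[OF conts(2)]) simp
  have Pd: "DERIV PP a :> \<xi> pi"
    using integral_cos_deriv[OF K(3) K(4) a] prim_eq_integral[OF conts(1), of pi]
    by (simp add: PP_def[abs_def] \<xi>_def)
  have Ad: "DERIV AA a :> ar' pi"
  proof -
    have "DERIV (\<lambda>s. K s * K1 s) s :> K1 s * K1 s + K s * K2 s" if "\<bar>s\<bar> < g0" for s
      using DERIV_mult[OF K(2)[OF that] K(3)[OF that]] by (simp add: mult.commute)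
    moreover have "isCont (\<lambda>s. K1 s * K1 s + K s * K2 s) s" if "\<bar>s\<bar> < g0" for s
      using DERIV_isCont[OF K(2)[OF that]] DERIV_isCont[OF K(3)[OF that]] K(4)[OF that]
      by (intro continuous_intros)
    ultimately show ?thesis
      using integral_cos_deriv[of "\<lambda>s. K s * K1 s" "\<lambda>s. K1 s * K1 s + K s * K2 s", OF _ _ a]
        prim_eq_integral[OF conts(3), of pi]
      by (simp add: AA_def[abs_def] ar'_def)
  qed
  have Gd: "DERIV G \<alpha> :> G1 \<alpha>" and G1: "G1 \<alpha> > 0" using G \<alpha> by auto
  have d1: "DERIV (\<lambda>x. 2 * PP (G x)) \<alpha> :> 2 * (\<xi> pi * G1 \<alpha>)"
    by (intro DERIV_cmult DERIV_chain2[where f=PP and g=G] Gd) (subst \<alpha>(3)[symmetric], rule Pd)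
  have d2: "DERIV (\<lambda>x. 2 * AA (G x)) \<alpha> :> 2 * (ar' pi * G1 \<alpha>)"
    by (intro DERIV_cmult DERIV_chain2[where f=AA and g=G] Gd) (subst \<alpha>(3)[symmetric], rule Ad)
  define y s where "y = 2 * Y" and "s = 2 * ar pi"
  have ys: "y > 0" "s > 0" using Y_pos ar_pos by (auto simp: y_def s_def)
  have yv: "2 * PP (G \<alpha>) = y" "2 * AA (G \<alpha>) = s" by (simp_all only: y_def s_def Y A \<alpha>(3)[symmetric])
  have e1: "DERIV (\<lambda>x. (2 * PP (G x)) powr (3 - q)) \<alpha> :> (3 - q) * y powr (3 - q - 1) * (2 * (\<xi> pi * G1 \<alpha>))"
    by (rule DERIV_chain2[where f="\<lambda>z. z powr (3 - q)" and g="\<lambda>x. 2 * PP (G x)", OF _ d1])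
      (unfold yv, rule has_real_derivative_powr[OF ys(1)])
  have e2: "DERIV (\<lambda>x. (2 * AA (G x)) powr (q - 1)) \<alpha> :> (q - 1) * s powr (q - 1 - 1) * (2 * (ar' pi * G1 \<alpha>))"
    by (rule DERIV_chain2[where f="\<lambda>z. z powr (q - 1)" and g="\<lambda>x. 2 * AA (G x)", OF _ d2])
      (unfold yv, rule has_real_derivative_powr[OF ys(2)])
  define E' where "E' = (3 - q) * y powr (3 - q - 1) * (2 * (\<xi> pi * G1 \<alpha>)) * s powr (q - 1)
     + (q - 1) * s powr (q - 1 - 1) * (2 * (ar' pi * G1 \<alpha>)) * y powr (3 - q)"
  have "DERIV (\<lambda>x. (2 * PP (G x)) powr (3 - q) * (2 * AA (G x)) powr (q - 1)) \<alpha> :> E'"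
    using DERIV_mult[OF e1 e2] by (simp add: yv E'_def)
  then have "DERIV (E_fun q) \<alpha> :> E'"
  proof (rule has_field_derivative_transform_within_open)
    show "open {0<..<1::real}" by simp
    show "\<alpha> \<in> {0<..<1}" using \<alpha> by simp
    show "(2 * PP (G x)) powr (3 - q) * (2 * AA (G x)) powr (q - 1) = E_fun q x" if "x \<in> {0<..<1}" for x
      using E[of x] that by simp
  qed
  then have "E' < 0" using neg by (simp add: DERIV_imp_deriv)
  also have "E' = 4 * G1 \<alpha> * (q - 1) * y powr (3 - q - 1) * s powr (q - 1 - 1) * Y * (ar' pi + (\<sigma> - 1) * \<beta> * ar pi)" (is "_ = ?c * ?e")
  proof -
    have 1: "y powr (3 - q) = y powr (3 - q - 1) * (2 * Y)" "s powr (q - 1) = s powr (q - 1 - 1) * (2 * ar pi)"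
      using powr_add[of y "3 - q - 1" 1] powr_add[of s "q - 1 - 1" 1] ys by (auto simp: y_def s_def)
    have 2: "\<xi> pi = \<beta> * Y" using Y_pos by (simp add: \<beta>_def)
    \<comment> \<open>The relation between the exponents that makes E scale invariant; it matches E'
      with the integral of \<eta>.\<close>
    have 3: "3 - q = (q - 1) * (\<sigma> - 1)" using q by (simp add: \<sigma>_def field_simps)
    have "E' = (q - 1) * (\<sigma> - 1) * y powr (3 - q - 1) * (2 * ((\<beta> * Y) * G1 \<alpha>)) * (s powr (q - 1 - 1) * (2 * ar pi))
     + (q - 1) * s powr (q - 1 - 1) * (2 * (ar' pi * G1 \<alpha>)) * (y powr (3 - q - 1) * (2 * Y))"
      unfolding E'_def 1 2 using 3 by simp
    then show ?thesis by (simp add: algebra_simps)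
  qed
  finally have "?c * ?e < 0" .
  moreover have "?c > 0"
    using G1 q ys Y_pos by simp
  ultimately show ?thesis by (metis less_asym mult_less_0_iff)
qed

lemma is_least_period_affine:
  assumes "is_least_period f T" "m > 0" "C \<noteq> 0"
  shows "is_least_period (\<lambda>x. C * f (c + m * x)) (T / m)"
  unfolding is_least_period_def
proof (intro conjI allI impI)
  show "T / m > 0" using assms by (simp add: is_least_period_def)
  have T: "f (x + T) = f x" for x using assms(1) periodic_fun_simpleD by (auto simp: is_least_period_def)
  show "periodic_fun_simple (\<lambda>x. C * f (c + m * x)) (T / m)"
  proof (rule periodic_fun_simpleI')
    show "C * f (c + m * (x + T / m)) = C * f (c + m * x)" for x
      using T[of "c + m * x"] assms(2) by (simp add: algebra_simps)
  qed
  fix S assume S: "S > 0" "periodic_fun_simple (\<lambda>x. C * f (c + m * x)) S"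
  have "periodic_fun_simple f (m * S)"
  proof (rule periodic_fun_simpleI')
    fix x
    have "c + m * ((x - c) / m + S) = x + m * S" "c + m * ((x - c) / m) = x"
      using assms(2) by (simp_all add: distrib_left)
    then show "f (x + m * S) = f x"
      using periodic_fun_simpleD[OF S(2), of "(x - c) / m"] assms(3) by (simp only: mult_cancel_left) simp
  qed
  then have "T \<le> m * S" using assms S by (simp add: is_least_period_def)
  then show "T / m \<le> S" using assms(2) by (simp add: field_simps)
qed

text \<open>The relations \<open>sc\<close> turn the coefficient of the second variation at
  \<open>h\<close> into \<open>V / m^2\<close>, so the two quadratic forms are proportional. The
  window of length \<open>X\<close> centred at the minimum \<open>x0\<close> corresponds to
  {-Y..Y}.\<close>

lemma (in oscillator) energy_stable_rescaled:
  fixes B D X x0 \<mu> m :: real and h H :: "real \<Rightarrow> real"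
  assumes B: "B > 0" and D: "D > 0" and q2: "q < 2" and H: "is_energy_potential B q H"
    and h: "\<And>x. h (x0 + m * x) = \<mu> * k x" and m: "m > 0" and \<mu>: "\<mu> > 0"
    and sc: "B * \<mu> powr q = D" "m^2 * D = \<mu>"
    and X: "is_least_period h X"
    and neg: "ar' pi + (\<sigma> - 1) * \<beta> * ar pi < 0"
  shows "energy_stable H X h"
proof -
  have kh: "k = (\<lambda>x. 1 / \<mu> * h (x0 + m * x))" using h \<mu> by auto
  have "is_least_period k (X / m)"
    unfolding kh using X m \<mu> by (intro is_least_period_affine) auto
  then have "X / m = 2 * Y" by (rule is_least_period_unique[OF _ least_period])
  then have XY: "X = 2 * m * Y" using m by (simp add: divide_eq_eq)
  have Xp: "X > 0" using Y_pos m by (simp add: XY)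
  have hx: "h x = \<mu> * k ((x - x0) / m)" for x using h[of "(x - x0) / m"] m by simp
  define h1 where "h1 x = \<mu> / m * p ((x - x0) / m)" for x
  have sub: "DERIV (\<lambda>x. (x - x0) / m) x :> 1 / m" for x
    using DERIV_cdivide[OF DERIV_diff[OF DERIV_ident DERIV_const]] by simp
  have hpos: "h x > 0" for x using \<mu> by (simp add: hx)
  have per: "(x + X - x0) / m = (x - x0) / m + 2 * Y" for x
    using \<open>X / m = 2 * Y\<close> by (simp add: add_divide_distrib diff_divide_distrib)
  have hper: "h (x + X) = h x" "h1 (x + X) = h1 x" for x by (simp_all add: hx h1_def per k_sym)
  have hd: "DERIV h x :> h1 x" for x
    using DERIV_cmult[OF DERIV_chain2[where f=k, OF k_d sub], of \<mu>] by (simp add: hx[abs_def] h1_def)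
  have hq: "B * h x powr q = D * k ((x - x0) / m) powr q" for x
    using \<mu> sc(1) by (simp add: hx powr_mult)
  have Vh: "B * h x powr (q - 1) = V ((x - x0) / m) / m^2" for x
  proof -
    have "B * h x powr (q - 1) = B * \<mu> powr (q - 1) * V ((x - x0) / m)" using \<mu> by (simp add: hx powr_mult V_def)
    also have "B * \<mu> powr (q - 1) = D / \<mu>" using sc(1) \<mu> by (simp add: powr_diff)
    also have "\<dots> = 1 / m^2" unfolding sc(2)[symmetric] using D by simp
    finally show ?thesis by simp
  qed
  have h1d: "DERIV h1 x :> - ((B * h x powr q - D) / q)" for x
  proof -
    have "DERIV h1 x :> \<mu> / m * (- g ((x - x0) / m) * (1 / m))"
      unfolding h1_def[abs_def] by (rule DERIV_cmult[OF DERIV_chain2[where f=p, OF p_d sub]])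
    moreover have "\<mu> / m * (- g ((x - x0) / m) * (1 / m)) = - ((B * h x powr q - D) / q)"
    proof -
      have key: "m^2 * D / m * (- y * (1 / m)) = - (D * y)" for y using m by (simp add: power2_eq_square)
      show ?thesis unfolding sc(2)[symmetric] hq g_def key by (simp add: right_diff_distrib)
    qed
    ultimately show ?thesis by simp
  qed
  have sym: "h (x0 - x) = h (x0 + x)" "h1 (x0 - x) = - h1 (x0 + x)" for x
    using k_sym(1,3)[of "x / m"] by (simp_all add: hx h1_def)
  show ?thesis
  proof (rule energy_stable_from_linearization[OF B q q2 Xp H hpos hper hd h1d sym])
    fix U v assume U: "\<And>a b. ac_on a b U v" "\<And>x. U (x + X) = U x" and v: "v \<in> L2_circle X"
      and U0: "integral {0..X} U = 0" and le: "integral {0..X} (\<lambda>x. (v x)^2 - B * h x powr (q - 1) * (U x)^2) \<le> 0"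
    note vL = L2_circleD[OF v]
    define W where "W x = U (x0 + m * x)" for x
    define w where "w x = m * v (x0 + m * x)" for x
    have ends: "x0 + m * Y = x0 - m * Y + X" by (simp add: XY)
    have va: "abs_int s t v" "abs_int s t (\<lambda>x. (v x)^2)" for s t
      by (rule periodic_abs_int[OF Xp _ vL(1)], rule vL, rule periodic_abs_int[OF Xp _ vL(2)], simp add: vL)
    have fold: "integral {-Y..Y} (\<lambda>x. F (x0 + m * x)) = integral {0..X} F / m"
      if F: "abs_int 0 X F" "\<And>x. F (x + X) = F x" for F :: "real \<Rightarrow> real"
    proof -
      have "F integrable_on {x0 + m * - Y..x0 + m * Y}"
        using periodic_abs_int[OF Xp F(2,1)] by (simp add: abs_int_def)
      from integral_affine[OF m this] have "integral {-Y..Y} (\<lambda>x. F (x0 + m * x)) = integral {x0 - m * Y..x0 - m * Y + X} F / m"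
        by (simp add: ends)
      then show ?thesis using periodic_integral[OF Xp F(2,1)] by simp
    qed
    have W: "ac_on (- Y) Y W w"
      unfolding ac_on_def
    proof (intro conjI ballI)
      show "abs_int (-Y) Y w"
        unfolding w_def by (intro set_integrable_mult_right abs_int_affine m va)
      fix x assume "x \<in> {-Y..Y}"
      then have "m * - Y \<le> m * x" using m by (intro mult_left_mono) auto
      then have "(v has_integral (U (x0 + m * x) - U (x0 + m * - Y))) {x0 + m * - Y..x0 + m * x}"
        by (intro ac_onD[OF U(1)[of "x0 + m * - Y" "x0 + m * x"]]) auto
      then have "((\<lambda>x. v (x0 + m * x)) has_integral (U (x0 + m * x) - U (x0 + m * - Y)) / m) {-Y..x}"
        using has_integral_affine[OF m] by blast
      from has_integral_mult_right[OF this, of m] show "(w has_integral W x - W (- Y)) {-Y..x}"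
        using m by (simp add: w_def[abs_def] W_def)
    qed
    have w2: "abs_int (-Y) Y (\<lambda>x. (w x)^2)"
      unfolding w_def power_mult_distrib by (intro set_integrable_mult_right abs_int_affine[where f="\<lambda>x. (v x)^2"] m va)
    have WY: "W (- Y) = W Y" using U(2)[of "x0 - m * Y"] unfolding W_def ends by simp
    have Ua: "abs_int 0 X U"
      by (intro absolutely_integrable_continuous_real ac_on_continuous[OF U(1)])
    have W0: "integral {-Y..Y} W = 0" using fold[OF Ua U(2)] by (simp add: W_def[abs_def] U0)
    define F where "F x = (v x)^2 - B * h x powr (q - 1) * (U x)^2" for x
    have "abs_int 0 X (\<lambda>x. B * h x powr (q - 1) * (U x)^2)"
    proof (intro absolutely_integrable_continuous_real continuous_intros ac_on_continuous[OF U(1)])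
      show "continuous_on {0..X} h" using hd DERIV_isCont by (blast intro: continuous_at_imp_continuous_on)
      show "\<forall>x\<in>{0..X}. h x \<noteq> 0" using hpos by (auto simp: less_imp_neq[symmetric])
    qed
    then have Fa: "abs_int 0 X F" unfolding F_def[abs_def] by (rule set_integral_diff(1)[OF vL(2)])
    have Fp: "F (x + X) = F x" for x by (simp add: F_def vL hper U)
    have "(w x)^2 - V x * (W x)^2 = m^2 * F (x0 + m * x)" for x
      using m by (simp add: F_def Vh w_def W_def power_mult_distrib algebra_simps)
    then have "integral {-Y..Y} (\<lambda>x. (w x)^2 - V x * (W x)^2) = m^2 * (integral {0..X} F / m)"
      using fold[OF Fa Fp] by simp
    also have "\<dots> \<le> 0" using le m by (intro mult_nonneg_nonpos) (auto simp: F_def[abs_def] divide_nonpos_pos)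
    finally obtain C where C: "\<And>x. x \<in> {-Y..Y} \<Longrightarrow> W x = C * p x"
      using linearized_stability[OF neg W WY w2 W0] by blast
    have "U x = C * m / \<mu> * h1 x" for x
    proof -
      interpret Up: periodic_fun_simple U X by unfold_locales (rule U)
      interpret hp: periodic_fun_simple h1 X by unfold_locales (rule hper)
      \<comment> \<open>Moves \<open>x\<close> by whole periods into the window centred at
        \<open>x0\<close>, where the identity is known.\<close>
      define n where "n = \<lfloor>(x - (x0 - m * Y)) / X\<rfloor>"
      define r where "r = x - of_int n * X"
      have r: "x0 - m * Y \<le> r" "r \<le> x0 + m * Y"
        using floor_divide_lower[OF Xp, of "x - (x0 - m * Y)"] floor_divide_upper[OF Xp, of "x - (x0 - m * Y)"]
        unfolding r_def n_def ends by (auto simp: algebra_simps)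
      have "U r = W ((r - x0) / m)" using m by (simp add: W_def)
      also have "\<dots> = C * p ((r - x0) / m)" using r m by (intro C) (auto simp: field_simps)
      also have "\<dots> = C * m / \<mu> * h1 r" using m \<mu> by (simp add: h1_def)
      finally have "U r = C * m / \<mu> * h1 r" .
      then show ?thesis using Up.plus_of_int[of r n] hp.plus_of_int[of r n] by (simp add: r_def)
    qed
    then show "\<exists>C. \<forall>x. U x = C * h1 x" by blast
  qed
qed

theorem theorem3:
  fixes m n B q X \<alpha> x\<^sub>0 :: real and h H :: "real \<Rightarrow> real"
  assumes "B > 0"
    and "q = m - n + 1"
    and "is_energy_potential B q H"
    and "positive_periodic_steady_state n m B h"
    and "\<not> h constant_on UNIV"
    and "is_least_period h X"
    and "\<forall>x. h x\<^sub>0 \<le> h x"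
    and "0 < \<alpha>" and "\<alpha> < 1"
    and "rescales_to B q (\<lambda>x. h (x\<^sub>0 + x)) \<alpha>"
    and "1 < q" and "q < 2"
    and "deriv (E_fun q) \<alpha> < 0"
  shows "energy_stable H X h"
proof -
  obtain g0 G G1 K K1 K2 where "chart q g0 G G1 K K1 K2" using chart_exists[OF assms(11)] .
  then interpret chart q g0 G G1 K K1 K2 .
  interpret oscillator q g0 G G1 K K1 K2 "G \<alpha>" using G[OF assms(8,9)] by unfold_locales auto
  obtain D where D: "D > 0" and k: "(\<lambda>x. (B / D) powr (1 / q) *
              h (x\<^sub>0 + (D / B) powr (1 / (2 * q)) * D powr (- 1 / 2) * x)) = k_sol q \<alpha>"
    using assms(10) unfolding rescales_to_def by blast
  \<comment> \<open>\<mu> and \<open>c\<close> are the units of height and length undone by the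
    rescaling; they satisfy B \<mu>^q = D and c^2 D = \<mu>.\<close>
  define \<mu> where "\<mu> = (D / B) powr (1 / q)"
  define c where "c = (D / B) powr (1 / (2 * q)) * D powr (- 1 / 2)"
  have \<mu>c: "\<mu> > 0" "c > 0" using assms(1) D by (auto simp: \<mu>_def c_def)
  have "k_sol q \<alpha> = k" using k_sol G(3)[OF assms(8,9)] by simp
  moreover have "(B / D) powr (1 / q) = 1 / \<mu>" using assms(1) D by (simp add: \<mu>_def powr_divide)
  ultimately have "(\<lambda>x. 1 / \<mu> * h (x\<^sub>0 + c * x)) = local.k" using k by (simp only: c_def)
  then have h: "h (x\<^sub>0 + c * x) = \<mu> * local.k x" for x
  proof -
    have "1 / \<mu> * h (x\<^sub>0 + c * x) = local.k x" by (rule fun_cong) fact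
    then have "\<mu> * (1 / \<mu> * h (x\<^sub>0 + c * x)) = \<mu> * local.k x" by (rule arg_cong)
    then show ?thesis using \<mu>c by simp
  qed
  have "B * \<mu> powr q = D" using assms(1,11) D by (simp add: \<mu>_def powr_powr)
  moreover have "c^2 * D = \<mu>"
  proof -
    have "c^2 = (D / B) powr (1 / (2 * q) * 2) * D powr (- 1 / 2 * 2)"
      using assms(1) D by (simp add: c_def power_mult_distrib powr_powr flip: powr_numeral)
    then show ?thesis using assms(1,11) D by (simp add: \<mu>_def powr_minus)
  qed
  moreover have "ar' pi + (\<sigma> - 1) * \<beta> * ar pi < 0"
    by (rule E_fun_deriv_neg[OF assms(8,9) refl assms(13)])
  ultimately show ?thesis
    using energy_stable_rescaled[OF assms(1) D assms(12,3) h \<mu>c(2,1) _ _ assms(6)] by blast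
qed

end
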